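(* Let $t>0$, let $\mu$ be a positive finite Borel measure on $\overline{\mathbb{D}}$ with $d\mu|\mathbb{T}=\omega\,dm$ absolutely continuous, satisfying condition (B) (stated in the context), and let $F$ denote the (closed) support of the measure $\mu|\mathbb{T}$. Suppose $S_\nu$ is a Korenblum-Roberts inner function, in the sense that $\nu$ is a positive finite singular Borel measure on $\mathbb{T}$ which vanishes on every Beurling-Carleson set of zero Lebesgue measure. If $\nu$ is concentrated on the complement $\mathbb{T}\setminus F$, then $S_\nu$ is a cyclic vector for $M_z$ on $\mathcal{P}^t(\mu)$.
   Context: $\mathbb{D}$ is the open unit disk, $\mathbb{T}$ the unit circle, $m$ the normalized Lebesgue measure on $\mathbb{T}$, $A$ the area measure on $\mathbb{D}$. For a positive finite Borel measure $\mu$ on $\overline{\mathbb{D}}$, $\mu|S$ denotes its restriction to a Borel set $S$, and for $t\in(0,\infty)$, $\mathcal{P}^t(\mu)$ is the closure of the analytic polynomials in $L^t(\mu)$ (with the norm for $t\ge 1$, and the usual translation-invariant metric for $t<1$). $M_z$ is the operator $f(z)\mapsto zf(z)$. A bounded analytic function on $\mathbb{D}$ is an element of $\mathcal{P}^t(\mu)$, given on $\mathbb{T}$ by its boundary values. An element $f\in\mathcal{P}^t(\mu)$ is cyclic for $M_z$ if $\{pf: p \text{ analytic polynomial}\}$ is dense in $\mathcal{P}^t(\mu)$. A closed set $E\subseteq\mathbb{T}$, with $\mathbb{T}\setminus E=\bigcup_k A_k$ the decomposition of its complement into disjoint open arcs, is a Beurling-Carleson set if $\sum_k |A_k|\log(1/|A_k|)<\infty$,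 where $|A_k|$ is the Lebesgue measure of $A_k$. Condition (B): there are $-1<\beta\le\alpha$ such that one has continuous embeddings $\mathcal{P}^t((1-|z|)^\beta dA)\hookrightarrow\mathcal{P}^t(\mu|\mathbb{D})\hookrightarrow\mathcal{P}^t((1-|z|)^\alpha dA)$, i.e. there is $C>0$ such that for all analytic polynomials $p$, $C^{-1}\int_{\mathbb{D}}|p|^t(1-|z|)^\alpha dA\le\int_{\mathbb{D}}|p|^t\,d\mu|\mathbb{D}\le C\int_{\mathbb{D}}|p|^t(1-|z|)^\beta dA$. For a positive finite singular Borel measure $\nu$ on $\mathbb{T}$, $S_\nu(z)=\exp\left(-\int_{\mathbb{T}}\frac{\zeta+z}{\zeta-z}\,d\nu(\zeta)\right)$. A measure $\nu$ is concentrated on a Borel set $H$ if $\nu(D)=\nu(D\cap H)$ for every Borel set $D$. *)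

theory Defs
  imports "HOL-Analysis.Analysis" "HOL-Computational_Algebra.Polynomial"
begin

abbreviation unit_disk :: "complex set" where
  "unit_disk \<equiv> ball 0 1"

abbreviation unit_circle :: "complex set" where
  "unit_circle \<equiv> sphere 0 1"

text \<open>The underlying space of the measure is \<open>S\<close> itself, not the whole plane.\<close>

definition finite_borel_measure_on :: "complex set \<Rightarrow> complex measure \<Rightarrow> bool" where
  "finite_borel_measure_on S M \<longleftrightarrow>
     finite_measure M \<and> sets M = sets (restrict_space borel S)"

definition circle_measure :: "complex measure" where
  "circle_measure =
     distr (uniform_measure lborel {0..<2 * pi}) (restrict_space borel unit_circle) cis"

definition concentrated_on :: "complex measure \<Rightarrow> complex set \<Rightarrow> bool" where
  "concentrated_on M H \<longleftrightarrow> (\<forall>D\<in>sets M. emeasure M D = emeasure M (D \<inter> H))"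

definition singular_on_circle :: "complex measure \<Rightarrow> bool" where
  "singular_on_circle \<nu> \<longleftrightarrow>
     (\<exists>N\<in>sets circle_measure. emeasure circle_measure N = 0 \<and> concentrated_on \<nu> N)"

definition closed_support :: "complex measure \<Rightarrow> complex set" where
  "closed_support M =
     {z \<in> space M. \<forall>U. open U \<and> z \<in> U \<longrightarrow> emeasure M (U \<inter> space M) > 0}"

subsection \<open>The spaces \<open>L\<^sup>t\<close> and \<open>P\<^sup>t\<close>\<close>

text \<open>
  Elements are represented by functions, not by classes modulo null sets. Consequently
  \<open>Lt_dist\<close> is only a pseudometric, and the closures below are saturated
  under equality almost everywhere.
\<close>

definition Lt_space :: "real \<Rightarrow> complex measure \<Rightarrow> (complex \<Rightarrow> complex) set" where
  "Lt_space t M =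
     {f \<in> borel_measurable M. integrable M (\<lambda>z. norm (f z) powr t)}"

definition Lt_dist ::
  "real \<Rightarrow> complex measure \<Rightarrow> (complex \<Rightarrow> complex) \<Rightarrow> (complex \<Rightarrow> complex) \<Rightarrow> real" where
  "Lt_dist t M f g =
     (let I = (LINT z|M. norm (f z - g z) powr t) in if t \<ge> 1 then I powr (1 / t) else I)"

text \<open>
  Intersecting with \<open>Lt_space\<close> keeps the Bochner integral in \<open>Lt_dist\<close>
  from taking its default value 0 on non-integrable functions.
\<close>

definition Lt_closure ::
  "real \<Rightarrow> complex measure \<Rightarrow> (complex \<Rightarrow> complex) set \<Rightarrow> (complex \<Rightarrow> complex) set" where
  "Lt_closure t M S =
     {f \<in> Lt_space t M. \<forall>\<epsilon>>0. \<exists>g \<in> S \<inter> Lt_space t M. Lt_dist t M f g < \<epsilon>}"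

definition Pt_space :: "real \<Rightarrow> complex measure \<Rightarrow> (complex \<Rightarrow> complex) set" where
  "Pt_space t M = Lt_closure t M (range (poly :: complex poly \<Rightarrow> complex \<Rightarrow> complex))"

definition cyclic_for_Mz :: "real \<Rightarrow> complex measure \<Rightarrow> (complex \<Rightarrow> complex) \<Rightarrow> bool" where
  "cyclic_for_Mz t M f \<longleftrightarrow>
     f \<in> Pt_space t M \<and>
     Lt_closure t M (range (\<lambda>p :: complex poly. \<lambda>z. poly p z * f z)) = Pt_space t M"

definition condition_B :: "real \<Rightarrow> complex measure \<Rightarrow> bool" where
  "condition_B t \<mu> \<longleftrightarrow>
     (\<exists>\<alpha> \<beta> C :: real. -1 < \<beta> \<and> \<beta> \<le> \<alpha> \<and> 0 < C \<and>
        (\<forall>p :: complex poly.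
           ennreal (1 / C) *
             (\<integral>\<^sup>+z\<in>unit_disk. ennreal (norm (poly p z) powr t * (1 - norm z) powr \<alpha>) \<partial>lborel)
           \<le> (\<integral>\<^sup>+z. ennreal (norm (poly p z) powr t) \<partial>restrict_space \<mu> unit_disk) \<and>
           (\<integral>\<^sup>+z. ennreal (norm (poly p z) powr t) \<partial>restrict_space \<mu> unit_disk)
           \<le> ennreal C *
             (\<integral>\<^sup>+z\<in>unit_disk. ennreal (norm (poly p z) powr t * (1 - norm z) powr \<beta>) \<partial>lborel)))"

subsection \<open>Beurling-Carleson sets and Korenblum-Roberts inner functions\<close>

text \<open>
  The disjoint open arcs making up the complement of a closed set in the circle are the
  connected components of that complement. Lengths are normalized, so every term of the
  series is nonnegative; since the lengths have finite sum, the normalization does not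
  affect convergence.
\<close>

definition beurling_carleson :: "complex set \<Rightarrow> bool" where
  "beurling_carleson E \<longleftrightarrow>
     closed E \<and> E \<subseteq> unit_circle \<and>
     (\<lambda>A. measure circle_measure A * ln (1 / measure circle_measure A))
       summable_on components (unit_circle - E)"

definition korenblum_roberts :: "complex measure \<Rightarrow> bool" where
  "korenblum_roberts \<nu> \<longleftrightarrow>
     finite_borel_measure_on unit_circle \<nu> \<and> singular_on_circle \<nu> \<and>
     (\<forall>E. beurling_carleson E \<and> emeasure circle_measure E = 0 \<longrightarrow> emeasure \<nu> E = 0)"

definition singular_inner :: "complex measure \<Rightarrow> complex \<Rightarrow> complex" where
  "singular_inner \<nu> z = exp (- (LINT \<zeta>|\<nu>. (\<zeta> + z) / (\<zeta> - z)))"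

text \<open>
  Boundary values are radial limits; by Fatou's theorem, for a bounded analytic function
  they exist (and agree with the nontangential limits) almost everywhere on the circle.
  The value 0 is used at the exceptional points.
\<close>

definition radial_limit :: "(complex \<Rightarrow> complex) \<Rightarrow> complex \<Rightarrow> complex" where
  "radial_limit f \<zeta> =
     (if \<exists>l. ((\<lambda>r. f (complex_of_real r * \<zeta>)) \<longlongrightarrow> l) (at_left 1)
      then Lim (at_left 1) (\<lambda>r. f (complex_of_real r * \<zeta>)) else 0)"

definition with_boundary_values :: "(complex \<Rightarrow> complex) \<Rightarrow> complex \<Rightarrow> complex" where
  "with_boundary_values f z = (if z \<in> unit_disk then f z else radial_limit f z)"

end

theory Submission
  imports Defs "HOL-Complex_Analysis.Complex_Analysis"
begin

text \<open>
  Write \<open>S\<^sub>\<nu>\<close> for the singular inner function, \<open>F\<close> for the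
  support of the part of \<open>\<mu>\<close> on the circle, and \<open>s = 1 - |z|\<close>.
  Dilations show that bounded analytic functions are limits of polynomials, so everything comes
  down to finding functions \<open>g\<close>, analytic on a neighbourhood of the closed disk, for
  which the integral of \<open>|1 - g S\<^sub>\<nu>|\<^sup>t\<close> against \<open>\<mu>\<close>
  is as small as desired (\<open>cyclic_for_Mz_criterion\<close>).

  In the disk these approximate inverses come from the decomposition of Roberts. Put
  \<open>n\<^sub>k = N ^ (2 ^ k)\<close>. At stage \<open>k\<close> one removes from each of the
  \<open>n\<^sub>k\<close> equal arcs of the circle mass at most \<open>c ln n\<^sub>k /
  n\<^sub>k\<close>, and calls the removed part \<open>\<nu>\<^sub>k\<close>. A mass that survives
  all stages lives on the intersection of the arcs that were too heavy at every stage. There are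
  few of them, since each uses up \<open>c ln n\<^sub>k / n\<^sub>k\<close> of the total mass, and
  \<open>ln n\<^sub>k\<close> only doubles from one stage to the next; hence this intersection is
  a Beurling-Carleson set of measure zero (\<open>beurling_carleson_Inter_arcs\<close>), which has
  no \<open>\<nu>\<close>-mass. So \<open>\<nu>\<close> is the sum of the
  \<open>\<nu>\<^sub>k\<close> (\<open>korenblum_roberts_residual_tendsto_0\<close>).

  Now let \<open>r\<^sub>k = 1 - 1 / n\<^sub>k\<close>, and let \<open>g\<close> be the reciprocal
  of the product of the functions \<open>S\<^bsub>\<nu>\<^sub>k\<^esub>(r\<^sub>k z)\<close> for
  \<open>k < K\<close>. The quotient \<open>S\<^bsub>\<nu>\<^sub>k\<^esub>(z) /
  S\<^bsub>\<nu>\<^sub>k\<^esub>(r\<^sub>k z)\<close> is bounded by a power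
  \<open>n\<^sub>k\<^sup>a\<close> with \<open>a\<close> proportional to \<open>c\<close>, because
  the Poisson integral of \<open>\<nu>\<^sub>k\<close> at distance \<open>1 / n\<^sub>k\<close>
  from the circle sees only averages over arcs of that length. As soon as \<open>n\<^sub>k \<ge> 1
  / s\<^sup>2\<close> the points \<open>z\<close> and \<open>r\<^sub>k z\<close> are so close that
  the logarithm of the quotient is at most a constant times the mass of
  \<open>\<nu>\<^sub>k\<close>. Since the numbers \<open>ln n\<^sub>k\<close> double, the first
  bound is needed for factors whose product is at most \<open>s\<^bsup>-4a\<^esup>\<close>. Thus
  \<open>g S\<^sub>\<nu>\<close> is bounded by a constant times a small negative power of
  \<open>s\<close>, uniformly in \<open>N\<close>, and it tends to 1 pointwise as \<open>N\<close>
  grows (\<open>korenblum_roberts_approximation\<close>). Dominated convergence applies in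
  \<open>L\<^sup>t\<close> of the weight \<open>s\<^sup>\<beta>\<close>, and condition (B) carries
  the conclusion over to \<open>\<mu>\<close> on the disk.

  On \<open>F\<close>, split \<open>\<nu>\<close> into its restriction to the points at distance
  at least \<open>d\<close> from \<open>F\<close> and a rest \<open>\<sigma>\<close>, whose mass
  tends to 0 with \<open>d\<close> because \<open>\<nu>\<close> does not charge \<open>F\<close>.
  For the first part the products above converge uniformly on \<open>F\<close>. For the second,
  \<open>|1 - S\<^sub>\<sigma>|\<^sup>2 \<le> 2 Re (1 - S\<^sub>\<sigma>)\<close>, and the
  right-hand side is a nonnegative harmonic function with value at most twice the mass of
  \<open>\<sigma>\<close> at the origin. A weak-type estimate for radial maximal functions and the
  Borel-Cantelli lemma then show that, along a sequence of \<open>d\<close>, the function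
  \<open>S\<^sub>\<sigma>\<close> tends to 1 uniformly on almost every radius. This yields both
  the radial limits of \<open>S\<^sub>\<nu>\<close> almost everywhere on \<open>F\<close> and the
  convergence of \<open>g S\<^sub>\<nu>\<close> to 1 there
  (\<open>singular_inner_approximate_inverses\<close>).
\<close>

section \<open>Normalized Lebesgue measure on the circle\<close>

lemma ennreal_le_suminf: "f k \<le> (\<Sum>k. f k)" for f :: "nat \<Rightarrow> ennreal"
  using sum_le_suminf[of f "{k}"] by simp

lemma cis_borel_measurable [measurable]: "cis \<in> borel_measurable borel"
  by (rule borel_measurable_continuous_onI) (intro continuous_intros)

lemma cis_measurable_circle [measurable]:
  "cis \<in> borel \<rightarrow>\<^sub>M restrict_space borel unit_circle"
  by (rule measurable_restrict_space2) auto

lemma space_circle_measure [simp]: "space circle_measure = unit_circle"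
  by (simp add: circle_measure_def space_restrict_space)

lemma sets_circle_measure [measurable_cong, simp]:
  "sets circle_measure = sets (restrict_space borel unit_circle)"
  by (simp add: circle_measure_def)

lemma sets_borel_circle: "A \<in> sets (restrict_space borel unit_circle) \<longleftrightarrow> A \<in> sets borel \<and> A \<subseteq> unit_circle"
  by (subst sets_restrict_space_iff) (auto simp: space_restrict_space)

lemma emeasure_circle_measure:
  assumes "A \<in> sets circle_measure"
  shows "emeasure circle_measure A = emeasure lborel {\<theta>\<in>{0..<2*pi}. cis \<theta> \<in> A} / ennreal (2 * pi)"
proof -
  have "A \<in> sets borel" using assms by (simp add: sets_borel_circle)
  then have m: "cis -` A \<in> sets borel"
    using measurable_sets[of cis borel borel A]
    by auto
  have "emeasure circle_measure A = emeasure (uniform_measure lborel {0..<2*pi}) (cis -` A)"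
    using assms unfolding circle_measure_def by (subst emeasure_distr) auto
  also have "\<dots> = emeasure lborel ({0..<2*pi} \<inter> cis -` A) / ennreal (2 * pi)"
    using m by (subst emeasure_uniform_measure) auto
  finally show ?thesis by (simp add: vimage_def Int_def)
qed

lemma measure_circle_UNIV: "emeasure circle_measure unit_circle = 1"
proof -
  have "{\<theta>\<in>{0..<2*pi}. cis \<theta> \<in> unit_circle} = {0..<2*pi}" by auto
  then show ?thesis by (subst emeasure_circle_measure) (auto simp: sets_borel_circle)
qed

interpretation circle: finite_measure circle_measure
  by (rule finite_measureI) (simp add: measure_circle_UNIV)

lemma borel_measurable_Arg2pi [measurable]: "Arg2pi \<in> borel_measurable borel"
proof (rule borel_measurableI_le)
  fix t show "{z \<in> space borel. Arg2pi z \<le> t} \<in> sets borel"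
    using closed_Arg2pi2pi_le[of t] by simp
qed

lemma Arg2pi_cis: "0 \<le> \<theta> \<Longrightarrow> \<theta> < 2*pi \<Longrightarrow> Arg2pi (cis \<theta>) = \<theta>"
  by (rule Arg2pi_unique[of 1]) (auto simp: cis_conv_exp)

lemma circle_measure_arc:
  assumes "0 \<le> a" "a \<le> b" "b \<le> 2 * pi"
  shows "measure circle_measure (cis ` {a..<b}) = (b - a) / (2 * pi)"
    and "cis ` {a..<b} \<in> sets circle_measure"
proof -
  have eq: "{\<theta>\<in>{0..<2*pi}. cis \<theta> \<in> cis ` {a..<b}} = {a..<b}"
  proof (intro subset_antisym subsetI)
    fix \<theta> assume "\<theta> \<in> {\<theta>\<in>{0..<2*pi}. cis \<theta> \<in> cis ` {a..<b}}"
    then obtain s where "s \<in> {a..<b}" "cis \<theta> = cis s" "0 \<le> \<theta>" "\<theta> < 2*pi" by auto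
    moreover have "inj_on cis {0..<2*pi}" by (rule inj_on_inverseI[of _ Arg2pi]) (simp add: Arg2pi_cis)
    ultimately show "\<theta> \<in> {a..<b}" using assms by (auto dest: inj_onD)
  qed (use assms in auto)
  have "cis ` {a..<b} = {z. norm z = 1 \<and> a \<le> Arg2pi z \<and> Arg2pi z < b}"
    (is "_ = ?R")
  proof (intro subset_antisym subsetI)
    fix z assume "z \<in> cis ` {a..<b}"
    then obtain \<theta> where "z = cis \<theta>" "a \<le> \<theta>" "\<theta> < b" by auto
    then have "Arg2pi z = \<theta>" using assms by (intro Arg2pi_unique[of 1]) (auto simp: cis_conv_exp)
    then show "z \<in> ?R" using \<open>z = _\<close> \<open>a \<le> \<theta>\<close> \<open>\<theta> < b\<close> by simp
  next
    fix z assume z: "z \<in> ?R"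
    then have "z = cis (Arg2pi z)" by (metis (mono_tags, lifting) cis_conv_exp complex_norm_eq_1_exp mem_Collect_eq)
    then show "z \<in> cis ` {a..<b}" using z by auto
  qed
  moreover have "{z. norm z = 1 \<and> a \<le> Arg2pi z \<and> Arg2pi z < b} \<in> sets borel"
    by measurable
  ultimately show m: "cis ` {a..<b} \<in> sets circle_measure" by (auto simp: sets_borel_circle)
  have "emeasure circle_measure (cis ` {a..<b}) = ennreal (b - a) / ennreal (2 * pi)"
    using m by (subst emeasure_circle_measure) (use assms eq in auto)
  also have "\<dots> = ennreal ((b - a) / (2 * pi))" using assms by (simp add: divide_ennreal)
  finally show "measure circle_measure (cis ` {a..<b}) = (b - a) / (2 * pi)" 
    using assms by (simp add: measure_def)
qed

definition poisson_kernel :: "complex \<Rightarrow> complex \<Rightarrow> real" where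
  "poisson_kernel z \<zeta> = (1 - (norm z)\<^sup>2) / (norm (\<zeta> - z))\<^sup>2"

lemma integral_circle_measure:
  fixes f :: "complex \<Rightarrow> complex"
  assumes f: "continuous_on unit_circle f"
  shows "integrable circle_measure f"
    and "((\<lambda>\<theta>. f (cis \<theta>)) has_integral (2 * pi * (LINT \<zeta>|circle_measure. f \<zeta>))) {0..2*pi}"
proof -
  have fm: "f \<in> borel_measurable (restrict_space borel unit_circle)"
    using f by (rule borel_measurable_continuous_on_restrict)
  then have fm': "f \<in> borel_measurable circle_measure" by (simp cong: measurable_cong_sets)
  have "compact (f ` unit_circle)" using f by (rule compact_continuous_image) auto
  then obtain B where B: "\<And>\<zeta>. \<zeta> \<in> unit_circle \<Longrightarrow> norm (f \<zeta>) \<le> B"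
    using compact_imp_bounded bounded_iff by (metis imageI)
  show "integrable circle_measure f"
    by (rule circle.integrable_const_bound[of _ B]) (use B fm' in auto)
  have c: "continuous_on {0..2*pi} (\<lambda>\<theta>. f (cis \<theta>))"
    by (rule continuous_on_compose2[OF f]) (auto intro!: continuous_intros)
  have mm: "f \<circ> cis \<in> borel_measurable borel" 
    using measurable_comp[OF cis_measurable_circle fm] by simp
  have "(LINT \<zeta>|circle_measure. f \<zeta>) = (LINT \<theta>|uniform_measure lborel {0..<2*pi}. f (cis \<theta>))"
    unfolding circle_measure_def using fm by (subst integral_distr) auto
  also have "uniform_measure lborel {0..<2*pi} = 
      density lborel (\<lambda>\<theta>. ennreal (indicator {0..<2*pi} \<theta> / (2*pi)))"
    unfolding uniform_measure_def
    by (intro density_cong) (auto simp: indicator_def divide_ennreal[of 1, simplified])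
  also have "(LINT \<theta>|\<dots>. f (cis \<theta>)) = 
      (LINT \<theta>|lborel. (indicator {0..<2*pi} \<theta> / (2*pi)) *\<^sub>R f (cis \<theta>))"
    using mm by (subst integral_density) (auto simp: comp_def)
  also have "\<dots> = (LINT \<theta>|lborel. (indicator {0..2*pi} \<theta> *\<^sub>R f (cis \<theta>)) /\<^sub>R (2*pi))"
    using mm AE_lborel_singleton[of "2*pi"]
    by (intro integral_cong_AE) (auto simp: comp_def indicator_def field_simps elim!: eventually_mono)
  also have "\<dots> = (LINT \<theta>:{0..2*pi}|lborel. f (cis \<theta>)) /\<^sub>R (2*pi)"
    unfolding set_lebesgue_integral_def by (rule integral_scaleR_right)
  also have "(LINT \<theta>:{0..2*pi}|lborel. f (cis \<theta>)) = integral {0..2*pi} (\<lambda>\<theta>. f (cis \<theta>))"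
    by (rule set_borel_integral_eq_integral) (rule borel_integrable_atLeastAtMost', rule c)
  finally show "((\<lambda>\<theta>. f (cis \<theta>)) has_integral (2 * pi * (LINT \<zeta>|circle_measure. f \<zeta>))) {0..2*pi}"
    using integrable_integral[OF integrable_continuous_real[OF c]] 
    by (simp add: scaleR_conv_of_real field_simps)
qed

text \<open>
  The function \<open>w \<mapsto> f w (1 - |z|\<^sup>2) / (1 - cnj z w)\<close> takes the value
  \<open>f z\<close> at \<open>z\<close>. On the circle \<open>1 - cnj z w = w cnj (w -
  z)\<close>, so for this function the Cauchy kernel \<open>w / (w - z)\<close> becomes the
  Poisson kernel for \<open>f\<close>.
\<close>

lemma poisson_formula:
  assumes f: "f holomorphic_on cball 0 1" and z: "norm z < 1"
  shows "(LINT \<zeta>|circle_measure. poisson_kernel z \<zeta> *\<^sub>R f \<zeta>) = f z"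
proof -
  define F where "F w = f w * (1 - z * cnj z) / (1 - cnj z * w)" for w
  have nz: "1 - cnj z * w \<noteq> 0" if "norm w \<le> 1" for w
  proof
    assume "1 - cnj z * w = 0"
    then have "norm (cnj z * w) = 1" by (metis eq_iff_diff_eq_0 norm_one)
    moreover have "norm (cnj z * w) \<le> norm z * 1" using that by (simp add: norm_mult mult_left_le)
    ultimately show False using z by simp
  qed
  have F: "F holomorphic_on cball 0 1" unfolding F_def
    by (intro holomorphic_intros f) (use nz in auto)
  have Fz: "F z = f z" using nz[of z] z by (simp add: F_def mult.commute)
  have ci: "((\<lambda>w. F w / (w - z)) has_contour_integral (2 * pi * \<i> * F z)) (circlepath 0 1)"
    using Cauchy_integral_circlepath_simple[OF F, of z] z by simp
  then have hi: "((\<lambda>t. F (cis t) / (cis t - z) * \<i> * cis t) has_integral (2 * pi * \<i> * F z)) {0..2*pi}"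
    unfolding circlepath_def by (subst (asm) has_contour_integral_part_circlepath_iff) auto
  have eq: "F \<zeta> / (\<zeta> - z) * \<zeta> = poisson_kernel z \<zeta> *\<^sub>R f \<zeta>" if "norm \<zeta> = 1" for \<zeta>
  proof -
    have 1: "\<zeta> * cnj \<zeta> = 1" using that by (simp add: complex_norm_square[symmetric])
    have 2: "1 - cnj z * \<zeta> = \<zeta> * cnj (\<zeta> - z)" using 1 by (simp add: algebra_simps)
    have ne: "\<zeta> \<noteq> 0" "\<zeta> - z \<noteq> 0" using that z by auto
    have 3: "of_real ((norm (\<zeta> - z))\<^sup>2) = (\<zeta> - z) * cnj (\<zeta> - z)"
      by (simp only: complex_norm_square)
    have 4: "of_real (1 - (norm z)\<^sup>2) = 1 - z * cnj z"
      by (simp add: complex_norm_square del: of_real_power)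
    have 5: "f \<zeta> * Q / (\<zeta> * X) / Y * \<zeta> = Q / (Y * X) * f \<zeta>" for Q X Y
      using ne(1) by (simp add: divide_simps)
    show ?thesis
      unfolding F_def poisson_kernel_def scaleR_conv_of_real of_real_divide 2 3 4 by (rule 5)
  qed
  have cont: "continuous_on unit_circle (\<lambda>\<zeta>. poisson_kernel z \<zeta> *\<^sub>R f \<zeta>)"
    unfolding poisson_kernel_def
    by (intro continuous_intros continuous_on_subset[OF holomorphic_on_imp_continuous_on[OF f]])
       (use z in auto)
  have "((\<lambda>t. \<i> * (poisson_kernel z (cis t) *\<^sub>R f (cis t))) has_integral 
      \<i> * (2 * pi * (LINT \<zeta>|circle_measure. poisson_kernel z \<zeta> *\<^sub>R f \<zeta>))) {0..2*pi}"
    by (rule has_integral_mult_right[OF integral_circle_measure(2)[OF cont]])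
  moreover have "((\<lambda>t. \<i> * (poisson_kernel z (cis t) *\<^sub>R f (cis t))) has_integral (2 * pi * \<i> * F z)) {0..2*pi}"
    using hi by (rule has_integral_eq[rotated]) (simp add: eq[symmetric])
  ultimately have "\<i> * (2 * pi * (LINT \<zeta>|circle_measure. poisson_kernel z \<zeta> *\<^sub>R f \<zeta>)) = 2 * pi * \<i> * F z"
    by (rule has_integral_unique)
  then show ?thesis using Fz by simp
qed

lemma integral_poisson_kernel:
  assumes z: "norm z < 1"
  shows "integrable circle_measure (poisson_kernel z)" "(LINT \<zeta>|circle_measure. poisson_kernel z \<zeta>) = 1"
proof -
  have cont: "continuous_on unit_circle (poisson_kernel z)"
    unfolding poisson_kernel_def by (intro continuous_intros) (use z in auto)
  have i: "integrable circle_measure (\<lambda>\<zeta>. complex_of_real (poisson_kernel z \<zeta>))"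
    by (rule integral_circle_measure(1)) (intro continuous_intros cont)
  then show i': "integrable circle_measure (poisson_kernel z)" by (simp add: complex_of_real_integrable_eq)
  have "(LINT \<zeta>|circle_measure. poisson_kernel z \<zeta> *\<^sub>R (1::complex)) = 1"
    by (rule poisson_formula) (use z in auto)
  then have "complex_of_real (LINT \<zeta>|circle_measure. poisson_kernel z \<zeta>) = 1"
    by (simp add: scaleR_conv_of_real)
  then show "(LINT \<zeta>|circle_measure. poisson_kernel z \<zeta>) = 1"
    using of_real_eq_1_iff by blast
qed

section \<open>Herglotz integrals\<close>

lemma norm_herglotz_kernel_le:
  fixes \<zeta> z :: complex
  assumes "norm \<zeta> = 1" "norm z \<le> 1" "0 < d" "d \<le> norm (\<zeta> - z)"
  shows "norm ((\<zeta> + z) / (\<zeta> - z)) \<le> 2 / d"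
  unfolding norm_divide
  by (rule frac_le) (use assms norm_triangle_ineq[of \<zeta> z] in auto)

lemma herglotz_kernel_diff:
  fixes \<zeta> z w :: complex
  assumes "\<zeta> \<noteq> z" "\<zeta> \<noteq> w"
  shows "(\<zeta> + z) / (\<zeta> - z) - (\<zeta> + w) / (\<zeta> - w) = 2 * \<zeta> * (z - w) / ((\<zeta> - z) * (\<zeta> - w))"
  using assms by (simp add: field_simps)

lemma Re_herglotz_kernel:
  fixes \<zeta> z :: complex
  assumes "norm \<zeta> = 1"
  shows "Re ((\<zeta> + z) / (\<zeta> - z)) = poisson_kernel z \<zeta>"
proof -
  have "(\<zeta> + z) / (\<zeta> - z) = (\<zeta> + z) * cnj (\<zeta> - z) / of_real ((norm (\<zeta> - z))\<^sup>2)"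
    by (subst complex_div_cnj) simp
  also have "Re \<dots> = Re ((\<zeta> + z) * cnj (\<zeta> - z)) / (norm (\<zeta> - z))\<^sup>2"
    by (simp only: Re_divide_of_real)
  also have "Re ((\<zeta> + z) * cnj (\<zeta> - z)) = (norm \<zeta>)\<^sup>2 - (norm z)\<^sup>2"
    by (simp add: cmod_power2) (simp add: power2_eq_square algebra_simps)
  finally show ?thesis using assms by (simp add: poisson_kernel_def)
qed

lemma poisson_kernel_nonneg: "norm z \<le> 1 \<Longrightarrow> 0 \<le> poisson_kernel z \<zeta>"
  by (simp add: poisson_kernel_def power_le_one)

text \<open>
  The estimates below need only a lower bound for the distance of \<open>z\<close> to the mass.
  Inside the disk \<open>d = 1 - |z|\<close> serves; on the circle they apply at points away from
  the mass.
\<close>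

definition separated :: "(complex \<Rightarrow> real) \<Rightarrow> real \<Rightarrow> complex \<Rightarrow> bool" where
  "separated \<phi> d z \<longleftrightarrow> (\<forall>\<zeta>\<in>unit_circle. \<phi> \<zeta> \<noteq> 0 \<longrightarrow> d \<le> norm (\<zeta> - z))"

lemma separated_disk: "norm z < 1 \<Longrightarrow> separated \<phi> (1 - norm z) z"
  unfolding separated_def
proof (intro ballI impI)
  fix \<zeta> :: complex assume "\<zeta> \<in> unit_circle"
  then show "1 - norm z \<le> norm (\<zeta> - z)" using norm_triangle_ineq2[of \<zeta> z] by simp
qed

locale finite_circle_measure =
  fixes \<nu> :: "complex measure"
  assumes finite_borel: "finite_borel_measure_on unit_circle \<nu>"
begin

sublocale finite_measure \<nu>
  using finite_borel by (simp add: finite_borel_measure_on_def)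

lemma sets_nu [measurable_cong, simp]: "sets \<nu> = sets (restrict_space borel unit_circle)"
  using finite_borel by (simp add: finite_borel_measure_on_def)

lemma space_nu [simp]: "space \<nu> = unit_circle"
  using sets_eq_imp_space_eq[OF sets_nu] by (simp add: space_restrict_space)

lemma borel_imp_nu: "f \<in> borel_measurable borel \<Longrightarrow> f \<in> borel_measurable \<nu>"
  by (simp add: measurable_restrict_space1 cong: measurable_cong_sets)

text \<open>
  The pieces into which \<open>\<nu>\<close> is split are represented by their densities with
  respect to \<open>\<nu>\<close>. The singular inner function of the piece with density
  \<open>\<phi>\<close> is \<open>exp (- herglotz \<phi> z)\<close>.
\<close>

definition weight :: "(complex \<Rightarrow> real) \<Rightarrow> bool" where
  "weight \<phi> \<longleftrightarrow> \<phi> \<in> borel_measurable \<nu> \<and> (\<forall>\<zeta>\<in>unit_circle. 0 \<le> \<phi> \<zeta> \<and> \<phi> \<zeta> \<le> 1)"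

definition mass :: "(complex \<Rightarrow> real) \<Rightarrow> real" where
  "mass \<phi> = (LINT \<zeta>|\<nu>. \<phi> \<zeta>)"

definition herglotz :: "(complex \<Rightarrow> real) \<Rightarrow> complex \<Rightarrow> complex" where
  "herglotz \<phi> z = (LINT \<zeta>|\<nu>. \<phi> \<zeta> *\<^sub>R ((\<zeta> + z) / (\<zeta> - z)))"

lemma weightD:
  assumes "weight \<phi>"
  shows "\<phi> \<in> borel_measurable \<nu>" "\<zeta> \<in> unit_circle \<Longrightarrow> 0 \<le> \<phi> \<zeta>" "\<zeta> \<in> unit_circle \<Longrightarrow> \<phi> \<zeta> \<le> 1"
  using assms by (auto simp: weight_def)

lemma weight_integrable: "weight \<phi> \<Longrightarrow> integrable \<nu> \<phi>"
  by (rule integrable_const_bound[of _ 1]) (auto simp: weight_def)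

lemma mass_nonneg: "weight \<phi> \<Longrightarrow> 0 \<le> mass \<phi>"
  unfolding mass_def by (rule integral_nonneg_AE) (auto simp: weight_def)

lemma mass_mono: "weight \<phi> \<Longrightarrow> weight \<psi> \<Longrightarrow> (\<And>\<zeta>. \<zeta> \<in> unit_circle \<Longrightarrow> \<phi> \<zeta> \<le> \<psi> \<zeta>) \<Longrightarrow> mass \<phi> \<le> mass \<psi>"
  unfolding mass_def by (rule integral_mono) (auto intro: weight_integrable)

lemma weight_one: "weight (\<lambda>_. 1)"
  by (auto simp: weight_def)

lemma mass_le: "weight \<phi> \<Longrightarrow> mass \<phi> \<le> measure \<nu> unit_circle"
  using mass_mono[OF _ weight_one, of \<phi>] weightD(3)[of \<phi>] by (auto simp: mass_def)

lemma weight_integral_bound: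
  fixes k :: "complex \<Rightarrow> complex"
  assumes \<phi>: "weight \<phi>" and k: "k \<in> borel_measurable borel"
    and B: "\<And>\<zeta>. \<zeta> \<in> unit_circle \<Longrightarrow> \<phi> \<zeta> \<noteq> 0 \<Longrightarrow> norm (k \<zeta>) \<le> B"
  shows "integrable \<nu> (\<lambda>\<zeta>. \<phi> \<zeta> *\<^sub>R k \<zeta>)" "norm (LINT \<zeta>|\<nu>. \<phi> \<zeta> *\<^sub>R k \<zeta>) \<le> B * mass \<phi>"
proof -
  have [measurable]: "\<phi> \<in> borel_measurable \<nu>" "k \<in> borel_measurable \<nu>"
    using weightD(1)[OF \<phi>] borel_imp_nu[OF k] by auto
  have bd: "norm (\<phi> \<zeta> *\<^sub>R k \<zeta>) \<le> B * \<phi> \<zeta>" if "\<zeta> \<in> unit_circle" for \<zeta>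
    using B[OF that] weightD(2)[OF \<phi> that] by (cases "\<phi> \<zeta> = 0") (auto simp: mult_left_mono mult.commute[of B])
  have i: "integrable \<nu> (\<lambda>\<zeta>. B * \<phi> \<zeta>)" using weight_integrable[OF \<phi>] by simp
  show "integrable \<nu> (\<lambda>\<zeta>. \<phi> \<zeta> *\<^sub>R k \<zeta>)"
    by (rule Bochner_Integration.integrable_bound[OF i], measurable, rule AE_I2)
       (use order_trans[OF bd abs_ge_self] in simp)
  have "norm (LINT \<zeta>|\<nu>. \<phi> \<zeta> *\<^sub>R k \<zeta>) \<le> (LINT \<zeta>|\<nu>. B * \<phi> \<zeta>)"
    by (rule Bochner_Integration.integral_norm_bound_integral[OF \<open>integrable \<nu> (\<lambda>\<zeta>. \<phi> \<zeta> *\<^sub>R k \<zeta>)\<close> i]) (use bd in auto)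
  then show "norm (LINT \<zeta>|\<nu>. \<phi> \<zeta> *\<^sub>R k \<zeta>) \<le> B * mass \<phi>" by (simp add: mass_def)
qed

lemma herglotz_bound:
  assumes "weight \<phi>" "norm z \<le> 1" "0 < d" "separated \<phi> d z"
  shows "integrable \<nu> (\<lambda>\<zeta>. \<phi> \<zeta> *\<^sub>R ((\<zeta> + z) / (\<zeta> - z)))" "norm (herglotz \<phi> z) \<le> 2 / d * mass \<phi>"
proof -
  have "norm ((\<zeta> + z) / (\<zeta> - z)) \<le> 2 / d" if "\<zeta> \<in> unit_circle" "\<phi> \<zeta> \<noteq> 0" for \<zeta>
    using assms that by (intro norm_herglotz_kernel_le) (auto simp: separated_def)
  note * = weight_integral_bound[OF assms(1) _ this]
  show "integrable \<nu> (\<lambda>\<zeta>. \<phi> \<zeta> *\<^sub>R ((\<zeta> + z) / (\<zeta> - z)))" by (rule *) auto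
  show "norm (herglotz \<phi> z) \<le> 2 / d * mass \<phi>" unfolding herglotz_def by (rule *) auto
qed

text \<open>
  The two kernels differ by \<open>2 \<zeta> (z - w) / ((\<zeta> - z) (\<zeta> - w))\<close>.
\<close>

lemma herglotz_diff_bound:
  assumes \<phi>: "weight \<phi>" and z: "norm z \<le> 1" "0 < d" "separated \<phi> d z"
    and w: "norm w \<le> 1" "0 < e" "separated \<phi> e w"
  shows "norm (herglotz \<phi> z - herglotz \<phi> w) \<le> 2 * norm (z - w) / (d * e) * mass \<phi>"
proof -
  let ?k = "\<lambda>\<zeta>. 2 * \<zeta> * (z - w) / ((\<zeta> - z) * (\<zeta> - w))"
  have "herglotz \<phi> z - herglotz \<phi> w =
      (LINT \<zeta>|\<nu>. \<phi> \<zeta> *\<^sub>R ((\<zeta> + z) / (\<zeta> - z)) - \<phi> \<zeta> *\<^sub>R ((\<zeta> + w) / (\<zeta> - w)))"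
    unfolding herglotz_def using herglotz_bound(1)[OF \<phi> z] herglotz_bound(1)[OF \<phi> w] by simp
  also have "\<dots> = (LINT \<zeta>|\<nu>. \<phi> \<zeta> *\<^sub>R ?k \<zeta>)"
  proof (rule Bochner_Integration.integral_cong[OF refl])
    fix \<zeta> assume "\<zeta> \<in> space \<nu>"
    then have "\<phi> \<zeta> = 0 \<or> \<zeta> \<noteq> z \<and> \<zeta> \<noteq> w" using z w by (auto simp: separated_def)
    then show "\<phi> \<zeta> *\<^sub>R ((\<zeta> + z) / (\<zeta> - z)) - \<phi> \<zeta> *\<^sub>R ((\<zeta> + w) / (\<zeta> - w)) = \<phi> \<zeta> *\<^sub>R ?k \<zeta>"
      using herglotz_kernel_diff by (auto simp: scaleR_diff_right[symmetric])
  qed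
  also have "norm \<dots> \<le> 2 * norm (z - w) / (d * e) * mass \<phi>"
  proof (rule weight_integral_bound(2)[OF \<phi>])
    fix \<zeta> assume *: "\<zeta> \<in> unit_circle" "\<phi> \<zeta> \<noteq> 0"
    have "d * e \<le> norm (\<zeta> - z) * norm (\<zeta> - w)"
      by (rule mult_mono) (use * z w in \<open>auto simp: separated_def\<close>)
    then show "norm (?k \<zeta>) \<le> 2 * norm (z - w) / (d * e)"
      unfolding norm_divide norm_mult using * z w by (intro frac_le) auto
  qed auto
  finally show ?thesis .
qed

lemma Re_herglotz:
  assumes "weight \<phi>" "norm z \<le> 1" "0 < d" "separated \<phi> d z"
  shows "Re (herglotz \<phi> z) = (LINT \<zeta>|\<nu>. \<phi> \<zeta> * poisson_kernel z \<zeta>)"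
    and "integrable \<nu> (\<lambda>\<zeta>. \<phi> \<zeta> * poisson_kernel z \<zeta>)"
proof -
  note i = herglotz_bound(1)[OF assms]
  have eq: "Re (\<phi> \<zeta> *\<^sub>R ((\<zeta> + z) / (\<zeta> - z))) = \<phi> \<zeta> * poisson_kernel z \<zeta>" if "\<zeta> \<in> space \<nu>" for \<zeta>
    using Re_herglotz_kernel[of \<zeta> z] that by simp
  show "Re (herglotz \<phi> z) = (LINT \<zeta>|\<nu>. \<phi> \<zeta> * poisson_kernel z \<zeta>)"
    unfolding herglotz_def integral_Re[OF i, symmetric]
    by (rule Bochner_Integration.integral_cong[OF refl eq])
  show "integrable \<nu> (\<lambda>\<zeta>. \<phi> \<zeta> * poisson_kernel z \<zeta>)"
    using integrable_Re[OF i] by (subst (asm) Bochner_Integration.integrable_cong[OF refl eq])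
qed

lemma Re_herglotz_nonneg:
  assumes "weight \<phi>" "norm z \<le> 1" "0 < d" "separated \<phi> d z"
  shows "0 \<le> Re (herglotz \<phi> z)"
  unfolding Re_herglotz(1)[OF assms]
proof (rule integral_nonneg_AE, rule AE_I2)
  fix \<zeta> assume "\<zeta> \<in> space \<nu>"
  then show "0 \<le> \<phi> \<zeta> * poisson_kernel z \<zeta>"
    using weightD(2)[OF assms(1)] assms(2) poisson_kernel_nonneg by simp
qed

lemma Re_herglotz_circle:
  assumes "weight \<phi>" "norm z = 1" "0 < d" "separated \<phi> d z"
  shows "Re (herglotz \<phi> z) = 0"
  using Re_herglotz(1)[of \<phi> z d] assms by (simp add: poisson_kernel_def)

lemma herglotz_diff:
  assumes "weight \<phi>" "weight \<psi>" "norm z \<le> 1" "0 < d" "separated \<phi> d z" "separated \<psi> d z"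
  shows "herglotz (\<lambda>\<zeta>. \<phi> \<zeta> - \<psi> \<zeta>) z = herglotz \<phi> z - herglotz \<psi> z"
  unfolding herglotz_def scaleR_diff_left
  by (rule Bochner_Integration.integral_diff) (rule herglotz_bound(1)[OF _ assms(3,4)], fact, fact)+

lemma herglotz_0: "herglotz \<phi> 0 = of_real (mass \<phi>)"
proof -
  have "herglotz \<phi> 0 = (LINT \<zeta>|\<nu>. complex_of_real (\<phi> \<zeta>))"
    unfolding herglotz_def by (rule Bochner_Integration.integral_cong) (auto simp: scaleR_conv_of_real)
  then show ?thesis by (simp add: mass_def)
qed

text \<open>
  Differentiation under the integral sign: near \<open>z\<close> the difference quotients of the
  kernel differ from its derivative \<open>2 \<zeta> / (\<zeta> - z)\<^sup>2\<close> by
  \<open>O(|w - z|)\<close>, uniformly in \<open>\<zeta>\<close>.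
\<close>

lemma herglotz_holomorphic:
  assumes \<phi>: "weight \<phi>"
  shows "herglotz \<phi> holomorphic_on ball 0 1"
proof -
  have "\<exists>D. (herglotz \<phi> has_field_derivative D) (at z)" if z: "norm z < 1" for z
  proof -
    define d where "d = (1 - norm z) / 2"
    have d: "0 < d" using z by (simp add: d_def)
    define D where "D = (LINT \<zeta>|\<nu>. \<phi> \<zeta> *\<^sub>R (2 * \<zeta> / (\<zeta> - z)\<^sup>2))"
    have far: "d \<le> norm (\<zeta> - w)" if "norm \<zeta> = 1" "norm (w - z) < d" for \<zeta> w
      using norm_triangle_ineq2[of \<zeta> w] norm_triangle_ineq2[of w z] that by (simp add: d_def)
    have quot: "(2 * \<zeta> * (b - a) / (a * b)) / (b - a) - 2 * \<zeta> / b\<^sup>2 = 2 * \<zeta> * (b - a) / (a * b\<^sup>2)"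
      if "a \<noteq> 0" "b \<noteq> 0" "b - a \<noteq> 0" for a b \<zeta> :: complex
      using that by (simp add: divide_simps) (simp add: power2_eq_square algebra_simps)
    have est: "norm ((herglotz \<phi> w - herglotz \<phi> z) / (w - z) - D) \<le> 2 * mass \<phi> / d^3 * norm (w - z)"
      if w: "norm (w - z) < d" "w \<noteq> z" for w
    proof -
      let ?k = "\<lambda>\<zeta>. ((\<zeta> + w) / (\<zeta> - w) - (\<zeta> + z) / (\<zeta> - z)) / (w - z) - 2 * \<zeta> / (\<zeta> - z)\<^sup>2"
      have nw: "norm w \<le> 1" using w norm_triangle_ineq2[of w z] norm_ge_zero[of "w - z"] by (simp add: d_def field_simps del: norm_ge_zero)
      have iw: "integrable \<nu> (\<lambda>\<zeta>. \<phi> \<zeta> *\<^sub>R ((\<zeta> + w) / (\<zeta> - w)))"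
        using far w nw by (intro herglotz_bound[OF \<phi> _ d]) (auto simp: separated_def)
      have iz: "integrable \<nu> (\<lambda>\<zeta>. \<phi> \<zeta> *\<^sub>R ((\<zeta> + z) / (\<zeta> - z)))"
        using far z d by (intro herglotz_bound[OF \<phi> _ d]) (auto simp: separated_def)
      have iD: "integrable \<nu> (\<lambda>\<zeta>. \<phi> \<zeta> *\<^sub>R (2 * \<zeta> / (\<zeta> - z)\<^sup>2))"
      proof (rule weight_integral_bound(1)[OF \<phi>, of _ "2 / d\<^sup>2"])
        fix \<zeta> assume "\<zeta> \<in> unit_circle"
        then show "norm (2 * \<zeta> / (\<zeta> - z)\<^sup>2) \<le> 2 / d\<^sup>2"
          unfolding norm_divide norm_power norm_mult
          using far[of \<zeta> z] d by (intro frac_le) (auto intro: power_mono)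
      qed auto
      have "(herglotz \<phi> w - herglotz \<phi> z) / (w - z) - D = 
         (LINT \<zeta>|\<nu>. (\<phi> \<zeta> *\<^sub>R ((\<zeta> + w) / (\<zeta> - w)) - \<phi> \<zeta> *\<^sub>R ((\<zeta> + z) / (\<zeta> - z))) / (w - z) 
            - \<phi> \<zeta> *\<^sub>R (2 * \<zeta> / (\<zeta> - z)\<^sup>2))"
        unfolding herglotz_def D_def
        by (subst Bochner_Integration.integral_diff, intro integrable_divide_zero Bochner_Integration.integrable_diff iw iz,
            rule iD, subst integral_divide_zero, subst Bochner_Integration.integral_diff, rule iw, rule iz, rule refl)
      also have "\<dots> = (LINT \<zeta>|\<nu>. \<phi> \<zeta> *\<^sub>R ?k \<zeta>)"
        by (intro Bochner_Integration.integral_cong refl)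
           (simp only: scaleR_conv_of_real right_diff_distrib times_divide_eq_right)
      also have "norm \<dots> \<le> (2 / d^3 * norm (w - z)) * mass \<phi>"
      proof (rule weight_integral_bound(2)[OF \<phi>])
        fix \<zeta> assume \<zeta>: "\<zeta> \<in> unit_circle"
        have ne: "\<zeta> - w \<noteq> 0" "\<zeta> - z \<noteq> 0" using far[of \<zeta> w] far[of \<zeta> z] \<zeta> w d by auto
        have "?k \<zeta> = (2 * \<zeta> * (w - z) / ((\<zeta> - w) * (\<zeta> - z))) / (w - z) - 2 * \<zeta> / (\<zeta> - z)\<^sup>2"
          using ne by (subst herglotz_kernel_diff) auto
        also have "\<dots> = 2 * \<zeta> * (w - z) / ((\<zeta> - w) * (\<zeta> - z)\<^sup>2)"
          using quot[of "\<zeta> - w" "\<zeta> - z"] ne w by simp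
        also have "norm \<dots> \<le> 2 * norm (w - z) / (d * d\<^sup>2)"
          unfolding norm_divide norm_mult norm_power
          using far[of \<zeta> w] far[of \<zeta> z] \<zeta> w d by (intro frac_le mult_mono power_mono mult_pos_pos zero_less_power) auto
        finally show "norm (?k \<zeta>) \<le> 2 / d^3 * norm (w - z)"
          using d by (simp add: power3_eq_cube power2_eq_square)
      qed auto
      finally show ?thesis by (simp add: mult_ac)
    qed
    have "((\<lambda>w. (herglotz \<phi> w - herglotz \<phi> z) / (w - z) - D) \<longlongrightarrow> 0) (at z)"
    proof (rule tendsto_0_le[where K=1])
      show "((\<lambda>w. 2 * mass \<phi> / d^3 * norm (w - z)) \<longlongrightarrow> 0) (at z)"
        using d by (auto intro!: tendsto_eq_intros)
      show "\<forall>\<^sub>F w in at z. norm ((herglotz \<phi> w - herglotz \<phi> z) / (w - z) - D) 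
              \<le> norm (2 * mass \<phi> / d^3 * norm (w - z)) * 1"
        unfolding eventually_at
      proof (intro exI[of _ d] conjI ballI impI d)
        fix w assume "w \<noteq> z \<and> dist w z < d"
        then have "norm ((herglotz \<phi> w - herglotz \<phi> z) / (w - z) - D) \<le> 2 * mass \<phi> / d^3 * norm (w - z)"
          by (intro est) (auto simp: dist_norm)
        then show "norm ((herglotz \<phi> w - herglotz \<phi> z) / (w - z) - D) 
            \<le> norm (2 * mass \<phi> / d^3 * norm (w - z)) * 1"
          unfolding mult_1_right real_norm_def by (rule order_trans[OF _ abs_ge_self])
      qed
    qed
    then have "((\<lambda>w. (herglotz \<phi> w - herglotz \<phi> z) / (w - z)) \<longlongrightarrow> D) (at z)"
      using Lim_null by blast
    then show ?thesis by (auto simp: has_field_derivative_iff)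
  qed
  then show ?thesis
    unfolding holomorphic_on_def field_differentiable_def
    by (metis dist_0_norm has_field_derivative_at_within mem_ball)
qed

end

section \<open>A weak-type inequality for Poisson integrals\<close>

lemma norm_cis_diff: "norm (cis a - cis b) = 2 * \<bar>sin ((a - b) / 2)\<bar>"
proof -
  have "(norm (cis a - cis b))\<^sup>2 = (cos a - cos b)\<^sup>2 + (sin a - sin b)\<^sup>2"
    by (simp add: cmod_power2)
  also have "\<dots> = 2 - 2 * cos (a - b)"
    using sin_cos_squared_add[of a] sin_cos_squared_add[of b]
    by (simp add: cos_diff power2_eq_square algebra_simps)
  also have "cos (a - b) = 1 - 2 * (sin ((a - b) / 2))\<^sup>2"
    by (metis cos_double_sin nonzero_mult_div_cancel_left times_divide_eq_right zero_neq_numeral)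
  finally have "(norm (cis a - cis b))\<^sup>2 = (2 * \<bar>sin ((a - b) / 2)\<bar>)\<^sup>2"
    by (simp add: power_mult_distrib)
  then show ?thesis by (rule power2_eq_imp_eq) auto
qed

lemma norm_cis_diff_le: "norm (cis a - cis b) \<le> \<bar>a - b\<bar>"
  using abs_sin_x_le_abs_x[of "(a - b) / 2"] by (simp add: norm_cis_diff)

lemma sin_ge_chord:
  assumes "0 \<le> y" "y \<le> pi / 2"
  shows "2 * y / pi \<le> sin y"
proof -
  have "convex_on {0..pi} (\<lambda>x. - sin x)"
    by (rule f''_ge0_imp_convex[where f' = "\<lambda>x. - cos x" and f'' = sin])
       (auto intro!: derivative_eq_intros sin_ge_zero)
  then have "- sin ((1 - 2 * y / pi) *\<^sub>R 0 + (2 * y / pi) *\<^sub>R (pi / 2)) 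
      \<le> (1 - 2 * y / pi) * - sin 0 + (2 * y / pi) * - sin (pi / 2)"
    by (rule convex_onD) (use assms in auto)
  then show ?thesis by simp
qed

lemma arc_le_chord:
  assumes "\<bar>a - b\<bar> \<le> pi"
  shows "\<bar>a - b\<bar> \<le> pi / 2 * norm (cis a - cis b)"
proof -
  have "2 * (\<bar>a - b\<bar> / 2) / pi \<le> sin (\<bar>a - b\<bar> / 2)"
    by (rule sin_ge_chord) (use assms in auto)
  also have "\<dots> \<le> \<bar>sin ((a - b) / 2)\<bar>" 
  proof (cases "a \<ge> b")
    case False
    have "sin ((b - a) / 2) = - sin ((a - b) / 2)" by (metis minus_diff_eq minus_divide_left sin_minus)
    then show ?thesis using False by simp
  qed simp
  finally show ?thesis by (simp add: norm_cis_diff field_simps)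
qed

text \<open>
  Chords and arcs are comparable, so the angles that belong to the ball lie within \<open>\<pi>
  \<rho> / 2\<close> of the angle of \<open>x\<close> modulo \<open>2 \<pi>\<close>; for angles in
  \<open>[0, 2 \<pi>)\<close> three translates are enough.
\<close>

lemma circle_measure_cball:
  assumes x: "x \<in> unit_circle" and "0 \<le> \<rho>"
  shows "emeasure circle_measure (cball x \<rho> \<inter> unit_circle) \<le> ennreal (2 * \<rho>)"
proof -
  define s where "s = Arg2pi x"
  have s: "0 \<le> s" "s < 2 * pi" "x = cis s"
    using Arg2pi[of x] x complex_norm_eq_1_exp[of x] by (auto simp: s_def cis_conv_exp)
  define J where "J c = {c - pi / 2 * \<rho>..c + pi / 2 * \<rho>}" for c
  have sub: "{\<theta>\<in>{0..<2*pi}. cis \<theta> \<in> cball x \<rho> \<inter> unit_circle} \<subseteq> J s \<union> J (s + 2*pi) \<union> J (s - 2*pi)"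
  proof
    fix \<theta> assume *: "\<theta> \<in> {\<theta>\<in>{0..<2*pi}. cis \<theta> \<in> cball x \<rho> \<inter> unit_circle}"
    have main: "\<theta> \<in> J c" if "\<bar>\<theta> - c\<bar> \<le> pi" "cis c = cis s" for c
    proof -
      have "norm (cis \<theta> - cis c) \<le> \<rho>" using * s that by (simp add: dist_norm norm_minus_commute)
      then have "pi / 2 * norm (cis \<theta> - cis c) \<le> pi / 2 * \<rho>" by (intro mult_left_mono) auto
      then have "\<bar>\<theta> - c\<bar> \<le> pi / 2 * \<rho>" using arc_le_chord[OF that(1)] by (rule order_trans[rotated])
      then show ?thesis unfolding J_def atLeastAtMost_iff by (simp only: abs_le_iff) linarith
    qed
    have c: "cis (s + 2 * pi) = cis s" "cis (s - 2 * pi) = cis s"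
      by (simp_all add: complex_eq_iff cos_diff sin_diff)
    consider "\<bar>\<theta> - s\<bar> \<le> pi" | "\<bar>\<theta> - (s + 2*pi)\<bar> \<le> pi" | "\<bar>\<theta> - (s - 2*pi)\<bar> \<le> pi"
      using * s by fastforce
    then show "\<theta> \<in> J s \<union> J (s + 2*pi) \<union> J (s - 2*pi)"
      using main c by cases blast+
  qed
  have J: "emeasure lborel (J c) = ennreal (pi * \<rho>)" "J c \<in> sets lborel" for c
    using assms by (auto simp: J_def)
  have "emeasure lborel {\<theta>\<in>{0..<2*pi}. cis \<theta> \<in> cball x \<rho> \<inter> unit_circle} \<le> 
      emeasure lborel (J s \<union> J (s + 2*pi) \<union> J (s - 2*pi))"
    by (rule emeasure_mono[OF sub]) (use J in auto)
  also have "\<dots> \<le> ennreal (pi * \<rho>) + ennreal (pi * \<rho>) + ennreal (pi * \<rho>)"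
    using emeasure_subadditive[of "J s \<union> J (s + 2*pi)" lborel "J (s - 2*pi)"]
      emeasure_subadditive[of "J s" lborel "J (s + 2*pi)"] J
    by (metis (no_types, lifting) add_right_mono order_trans sets.Un)
  also have "\<dots> = ennreal (3 * (pi * \<rho>))" using assms by (simp add: ennreal_plus[symmetric] del: ennreal_plus)
  finally have "emeasure circle_measure (cball x \<rho> \<inter> unit_circle) \<le> ennreal (3 * (pi * \<rho>)) / ennreal (2 * pi)"
    by (subst emeasure_circle_measure) (auto simp: sets_borel_circle intro!: divide_right_mono_ennreal)
  also have "\<dots> = ennreal (3 * (pi * \<rho>) / (2 * pi))" using assms by (subst divide_ennreal) auto
  also have "\<dots> \<le> ennreal (2 * \<rho>)" using assms by (intro ennreal_leI) (auto simp: field_simps)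
  finally show ?thesis .
qed

text \<open>
  With \<open>h = 1 - r\<close> one has \<open>|\<zeta> - r x| \<ge> max h (|\<zeta> - x| /
  2)\<close>. Hence the Poisson kernel is dominated by a sum of multiples of indicator functions
  of the balls of radius \<open>2\<^sup>k h\<close> with coefficients \<open>32 / (4\<^sup>k
  h)\<close>, and the bounds on these balls contribute a geometric series.
\<close>

lemma nn_integral_poisson_le:
  fixes v :: "complex \<Rightarrow> ennreal"
  assumes x: "x \<in> unit_circle" and r: "0 \<le> r" "r < 1" and \<kappa>: "0 \<le> \<kappa>"
    and v [measurable]: "v \<in> borel_measurable circle_measure"
    and bd: "\<And>\<rho>. 0 < \<rho> \<Longrightarrow> (\<integral>\<^sup>+\<zeta>\<in>cball x \<rho>. v \<zeta> \<partial>circle_measure) \<le> ennreal (\<kappa> * \<rho>)"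
  shows "(\<integral>\<^sup>+\<zeta>. ennreal (poisson_kernel (of_real r * x) \<zeta>) * v \<zeta> \<partial>circle_measure) \<le> ennreal (64 * \<kappa>)"
proof -
  define h where "h = 1 - r"
  have h: "0 < h" "h \<le> 1" using r by (auto simp: h_def)
  define a where "a k = 32 / (4 ^ k * h)" for k :: nat
  have a0: "0 \<le> a k" for k using h by (simp add: a_def)
  let ?B = "\<lambda>k::nat. cball x (2 ^ k * h)"
  have [measurable]: "?B k \<inter> space circle_measure \<in> sets circle_measure" for k
    by (auto simp: sets_borel_circle)
  have [measurable]: "(\<lambda>\<zeta>. indicator (?B k) \<zeta> :: ennreal) \<in> borel_measurable circle_measure" for k
    by (rule borel_measurable_indicator') (auto simp: sets_borel_circle vimage_def Int_def)
  have pw: "ennreal (poisson_kernel (of_real r * x) \<zeta>) \<le> (\<Sum>k. ennreal (a k) * indicator (?B k) \<zeta>)"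
    if \<zeta>: "\<zeta> \<in> unit_circle" for \<zeta>
  proof -
    let ?P = "poisson_kernel (of_real r * x) \<zeta>"
    have nrx: "norm (of_real r * x) = r" using x r by (simp add: norm_mult)
    have d1: "h \<le> norm (\<zeta> - of_real r * x)"
      using norm_triangle_ineq2[of \<zeta> "of_real r * x"] \<zeta> nrx by (simp add: h_def)
    have "norm (of_real r * x - x) = h"
    proof -
      have "of_real r * x - x = of_real (r - 1) * x" by (simp add: algebra_simps)
      then show ?thesis using x r by (simp add: norm_mult h_def del: of_real_diff)
    qed
    then have d2: "norm (\<zeta> - x) \<le> 2 * norm (\<zeta> - of_real r * x)"
      using norm_triangle_ineq[of "\<zeta> - of_real r * x" "of_real r * x - x"] d1 by simp
    have "1 - r\<^sup>2 = (1 - r) * (1 + r)" by (simp add: power2_eq_square algebra_simps)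
    also have "\<dots> \<le> h * 2" unfolding h_def using r by (intro mult_left_mono) auto
    finally have num: "1 - r\<^sup>2 \<le> 2 * h" by simp
    have P: "?P \<le> 2 * h / e\<^sup>2" if "0 < e" "e \<le> norm (\<zeta> - of_real r * x)" for e
      unfolding poisson_kernel_def nrx using that num h
      by (intro frac_le power_mono) auto
    have ex: "\<exists>k. ?P \<le> a k \<and> \<zeta> \<in> ?B k"
    proof -
      obtain k0 :: nat where "norm (\<zeta> - x) / h < 2 ^ k0" using real_arch_pow[of 2 "norm (\<zeta> - x) / h"] by auto
      then have ex: "\<exists>k. norm (\<zeta> - x) \<le> 2 ^ k * h" using h by (auto simp: field_simps intro!: exI[of _ k0])
      define k where "k = (LEAST k. norm (\<zeta> - x) \<le> 2 ^ k * h)"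
      have k: "norm (\<zeta> - x) \<le> 2 ^ k * h" unfolding k_def using ex by (rule LeastI_ex)
      have "?P \<le> a k"
      proof (cases k)
        case 0
        have "?P \<le> 2 * h / h\<^sup>2" using P[OF h(1) d1] .
        also have "\<dots> \<le> a k" using h by (simp add: a_def 0 power2_eq_square field_simps)
        finally show ?thesis .
      next
        case (Suc j)
        then have "\<not> norm (\<zeta> - x) \<le> 2 ^ j * h" unfolding k_def by (intro not_less_Least) auto
        then have "2 ^ j * h / 2 \<le> norm (\<zeta> - of_real r * x)" using d2 by simp
        then have "?P \<le> 2 * h / (2 ^ j * h / 2)\<^sup>2" using h by (intro P) auto
        also have "\<dots> = 8 / (4 ^ j * h)" using h
          by (simp add: power_divide power_mult_distrib power2_eq_square power_mult[symmetric] field_simps)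
             (simp add: power_mult_distrib[symmetric])
        also have "\<dots> = a k" by (simp add: a_def Suc)
        finally show ?thesis .
      qed
      then show ?thesis using k by (auto simp: dist_norm norm_minus_commute)
    qed
    then obtain k where k: "?P \<le> a k" "\<zeta> \<in> ?B k" by blast
    have "ennreal ?P \<le> ennreal (a k) * indicator (?B k) \<zeta>" using k by (simp add: ennreal_leI)
    also have "\<dots> \<le> (\<Sum>k. ennreal (a k) * indicator (?B k) \<zeta>)" by (rule ennreal_le_suminf)
    finally show ?thesis .
  qed
  have "(\<integral>\<^sup>+\<zeta>. ennreal (poisson_kernel (of_real r * x) \<zeta>) * v \<zeta> \<partial>circle_measure)
     \<le> (\<integral>\<^sup>+\<zeta>. (\<Sum>k. ennreal (a k) * indicator (?B k) \<zeta>) * v \<zeta> \<partial>circle_measure)"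
    by (intro nn_integral_mono mult_right_mono pw) auto
  also have "\<dots> = (\<integral>\<^sup>+\<zeta>. (\<Sum>k. ennreal (a k) * (v \<zeta> * indicator (?B k) \<zeta>)) \<partial>circle_measure)"
    by (intro nn_integral_cong) (simp add: ennreal_suminf_multc[symmetric] mult_ac)
  also have "\<dots> = (\<Sum>k. \<integral>\<^sup>+\<zeta>. ennreal (a k) * (v \<zeta> * indicator (?B k) \<zeta>) \<partial>circle_measure)"
    by (rule nn_integral_suminf) measurable
  also have "\<dots> = (\<Sum>k. ennreal (a k) * (\<integral>\<^sup>+\<zeta>\<in>?B k. v \<zeta> \<partial>circle_measure))"
    by (intro suminf_cong nn_integral_cmult) measurable
  also have "\<dots> \<le> (\<Sum>k. ennreal (32 * \<kappa> * (1/2)^k))"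
  proof (rule suminf_le)
    fix k
    have "ennreal (a k) * (\<integral>\<^sup>+\<zeta>\<in>?B k. v \<zeta> \<partial>circle_measure) \<le> ennreal (a k) * ennreal (\<kappa> * (2 ^ k * h))"
      by (intro mult_left_mono bd) (use h in auto)
    also have "\<dots> = ennreal (a k * (\<kappa> * (2 ^ k * h)))" by (simp add: ennreal_mult' a0)
    also have "a k * (\<kappa> * (2 ^ k * h)) = 32 * \<kappa> * (1/2)^k"
    proof -
      have "(4::real) ^ k = 2 ^ k * 2 ^ k" by (simp add: power_mult_distrib[symmetric])
      then show ?thesis using h by (simp add: a_def power_divide)
    qed
    finally show "ennreal (a k) * (\<integral>\<^sup>+\<zeta>\<in>?B k. v \<zeta> \<partial>circle_measure) \<le> ennreal (32 * \<kappa> * (1/2)^k)" .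
  qed auto
  also have "\<dots> = ennreal (\<Sum>k. 32 * \<kappa> * (1/2)^k)"
    by (rule suminf_ennreal2) (use \<kappa> in \<open>auto intro!: summable_mult summable_geometric\<close>)
  also have "(\<Sum>k. 32 * \<kappa> * (1/2)^k) = 64 * \<kappa>"
    by (subst suminf_mult) (auto simp: suminf_geometric summable_geometric)
  finally show ?thesis .
qed

lemma emeasure_UN_le_count_space:
  assumes I: "countable I" and X: "\<And>i. i \<in> I \<Longrightarrow> X i \<in> sets M"
  shows "emeasure M (\<Union>i\<in>I. X i) \<le> (\<integral>\<^sup>+i. emeasure M (X i) \<partial>count_space I)"
proof -
  have "emeasure M (\<Union>i\<in>I. X i) = (\<integral>\<^sup>+x. indicator (\<Union>i\<in>I. X i) x \<partial>M)"
    using X I by (intro nn_integral_indicator[symmetric] sets.countable_UN') auto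
  also have "\<dots> \<le> (\<integral>\<^sup>+x. \<integral>\<^sup>+i. indicator (X i) x \<partial>count_space I \<partial>M)"
  proof (rule nn_integral_mono)
    fix x
    show "indicator (\<Union>i\<in>I. X i) x \<le> (\<integral>\<^sup>+i. indicator (X i) x \<partial>count_space I)"
    proof (cases "\<exists>i\<in>I. x \<in> X i")
      case True
      then obtain i where i: "i \<in> I" "x \<in> X i" by blast
      have "(1::ennreal) = (\<integral>\<^sup>+j. indicator {i} j \<partial>count_space I)" using i by simp
      also have "\<dots> \<le> (\<integral>\<^sup>+i. indicator (X i) x \<partial>count_space I)"
        using i by (intro nn_integral_mono) (auto simp: indicator_def)
      finally show ?thesis using True by (simp add: indicator_def)
    qed auto
  qed
  also have "\<dots> = (\<integral>\<^sup>+i. \<integral>\<^sup>+x. indicator (X i) x \<partial>M \<partial>count_space I)"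
    by (rule nn_integral_count_space_nn_integral[OF I]) (use X in auto)
  also have "\<dots> = (\<integral>\<^sup>+i. emeasure M (X i) \<partial>count_space I)"
    using X by (intro nn_integral_cong) auto
  finally show ?thesis .
qed

text \<open>
  By the preceding lemma every point of \<open>A\<close> is the centre of a ball on which the
  average of \<open>v\<close> is large. Vitali's covering lemma selects disjoint balls among these
  whose fivefold enlargements still cover \<open>A\<close>.
\<close>

lemma poisson_maximal_weak_type:
  fixes v :: "complex \<Rightarrow> ennreal"
  assumes v [measurable]: "v \<in> borel_measurable circle_measure"
    and I: "(\<integral>\<^sup>+\<zeta>. v \<zeta> \<partial>circle_measure) \<le> ennreal I" and I0: "0 \<le> I" and lam: "0 < lam"
    and A: "A \<in> sets circle_measure"
    and big: "\<And>x. x \<in> A \<Longrightarrow> \<exists>r. 0 \<le> r \<and> r < 1 \<and> 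
        ennreal lam < (\<integral>\<^sup>+\<zeta>. ennreal (poisson_kernel (of_real r * x) \<zeta>) * v \<zeta> \<partial>circle_measure)"
  shows "emeasure circle_measure A \<le> ennreal (640 * I / lam)"
proof -
  \<comment> \<open>The denominator is the constant in \<open>nn_integral_poisson_le\<close>.\<close>
  define \<kappa> where "\<kappa> = lam / 64"
  have \<kappa>: "0 < \<kappa>" using lam by (simp add: \<kappa>_def)
  have Asub: "A \<subseteq> unit_circle" using A by (simp add: sets_borel_circle)
  have "\<exists>\<rho>>0. ennreal (\<kappa> * \<rho>) < (\<integral>\<^sup>+\<zeta>\<in>cball x \<rho>. v \<zeta> \<partial>circle_measure)" if x: "x \<in> A" for x
  proof (rule ccontr)
    assume no: "\<not> ?thesis"
    obtain r where r: "0 \<le> r" "r < 1" 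
        "ennreal lam < (\<integral>\<^sup>+\<zeta>. ennreal (poisson_kernel (of_real r * x) \<zeta>) * v \<zeta> \<partial>circle_measure)"
      using big[OF x] by blast
    have "(\<integral>\<^sup>+\<zeta>. ennreal (poisson_kernel (of_real r * x) \<zeta>) * v \<zeta> \<partial>circle_measure) \<le> ennreal (64 * \<kappa>)"
      by (rule nn_integral_poisson_le[OF _ r(1,2) _ v]) (use x Asub \<kappa> no in \<open>auto simp: not_less dest: leD\<close>)
    then show False using r(3) by (simp add: \<kappa>_def)
  qed
  then obtain \<rho> where \<rho>: "\<And>x. x \<in> A \<Longrightarrow> 0 < \<rho> x"
      "\<And>x. x \<in> A \<Longrightarrow> ennreal (\<kappa> * \<rho> x) < (\<integral>\<^sup>+\<zeta>\<in>cball x (\<rho> x). v \<zeta> \<partial>circle_measure)" by metis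
  have \<rho>B: "\<rho> x \<le> I / \<kappa>" if x: "x \<in> A" for x
  proof -
    have "ennreal (\<kappa> * \<rho> x) \<le> (\<integral>\<^sup>+\<zeta>. v \<zeta> \<partial>circle_measure)"
      by (rule order.trans[OF less_imp_le[OF \<rho>(2)[OF x]]]) (auto intro!: nn_integral_mono simp: indicator_def)
    then have "ennreal (\<kappa> * \<rho> x) \<le> ennreal I" using I by (rule order_trans)
    then show ?thesis using I0 \<kappa> by (simp add: field_simps)
  qed
  obtain C where C: "countable C" "C \<subseteq> A" 
      "pairwise (\<lambda>i j. disjnt (cball i (\<rho> i)) (cball j (\<rho> j))) C"
      "A \<subseteq> (\<Union>i\<in>C. cball i (5 * \<rho> i))"
    by (rule Vitali_covering_lemma_cballs[where S=A and K=A and a="\<lambda>x. x" and r=\<rho> and B="I / \<kappa>"])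
       (use \<rho>(1) \<rho>B in \<open>auto simp: less_imp_le intro!: bexI\<close>)
  define D where "D = density circle_measure v"
  have [simp]: "sets D = sets circle_measure" by (simp add: D_def)
  have ball_sets: "cball i e \<inter> unit_circle \<in> sets circle_measure" for i e
    by (auto simp: sets_borel_circle)
  have Dball: "emeasure D (cball i e \<inter> unit_circle) = (\<integral>\<^sup>+\<zeta>\<in>cball i e. v \<zeta> \<partial>circle_measure)" for i e
    unfolding D_def using ball_sets by (subst emeasure_density) (auto intro!: nn_integral_cong simp: indicator_def)
  have "emeasure circle_measure A \<le> emeasure circle_measure (\<Union>i\<in>C. cball i (5 * \<rho> i) \<inter> unit_circle)"
  proof (rule emeasure_mono)
    show "(\<Union>i\<in>C. cball i (5 * \<rho> i) \<inter> unit_circle) \<in> sets circle_measure"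
      by (rule sets.countable_UN'[OF C(1)]) (use ball_sets in blast)
  qed (use C Asub in auto)
  also have "\<dots> \<le> (\<integral>\<^sup>+i. emeasure circle_measure (cball i (5 * \<rho> i) \<inter> unit_circle) \<partial>count_space C)"
    by (rule emeasure_UN_le_count_space[OF C(1) ball_sets])
  also have "\<dots> \<le> (\<integral>\<^sup>+i. ennreal (10 / \<kappa>) * emeasure D (cball i (\<rho> i) \<inter> unit_circle) \<partial>count_space C)"
  proof (rule nn_integral_mono)
    fix i assume "i \<in> space (count_space C)"
    then have i: "i \<in> C" "i \<in> A" "i \<in> unit_circle" using C Asub by auto
    have "emeasure circle_measure (cball i (5 * \<rho> i) \<inter> unit_circle) \<le> ennreal (2 * (5 * \<rho> i))"
      by (rule circle_measure_cball) (use i \<rho>(1) in \<open>auto simp: less_imp_le\<close>)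
    also have "\<dots> = ennreal (10 / \<kappa>) * ennreal (\<kappa> * \<rho> i)"
      using \<kappa> \<rho>(1)[OF i(2)] by (simp add: ennreal_mult'[symmetric])
    also have "\<dots> \<le> ennreal (10 / \<kappa>) * emeasure D (cball i (\<rho> i) \<inter> unit_circle)"
      unfolding Dball by (intro mult_left_mono \<rho>(2)[OF i(2), THEN less_imp_le]) auto
    finally show "emeasure circle_measure (cball i (5 * \<rho> i) \<inter> unit_circle)
       \<le> ennreal (10 / \<kappa>) * emeasure D (cball i (\<rho> i) \<inter> unit_circle)" .
  qed
  also have "\<dots> = ennreal (10 / \<kappa>) * (\<integral>\<^sup>+i. emeasure D (cball i (\<rho> i) \<inter> unit_circle) \<partial>count_space C)"
    by (rule nn_integral_cmult) auto
  also have "(\<integral>\<^sup>+i. emeasure D (cball i (\<rho> i) \<inter> unit_circle) \<partial>count_space C) = 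
      emeasure D (\<Union>i\<in>C. cball i (\<rho> i) \<inter> unit_circle)"
    by (rule emeasure_UN_countable[symmetric])
       (use C ball_sets in \<open>auto simp: disjoint_family_on_def pairwise_def disjnt_def\<close>)
  also have "\<dots> \<le> emeasure D unit_circle"
    by (rule emeasure_mono) (auto simp: sets_borel_circle)
  also have "\<dots> \<le> ennreal I"
    unfolding D_def
    by (subst emeasure_density) (auto simp: sets_borel_circle indicator_def intro!: order_trans[OF nn_integral_mono I])
  finally have "emeasure circle_measure A \<le> ennreal (10 / \<kappa>) * ennreal I"
    by (simp add: mult_left_mono)
  also have "\<dots> = ennreal (640 * I / lam)"
    using \<kappa> I0 by (subst ennreal_mult'[symmetric]) (auto simp: \<kappa>_def field_simps)
  finally show ?thesis .
qed

section \<open>Beurling-Carleson sets from unions of arcs\<close>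

definition circle_arc :: "nat \<Rightarrow> nat \<Rightarrow> complex set" where
  "circle_arc n i = cis ` {2 * pi * i / n ..< 2 * pi * (real i + 1) / n}"

definition closed_arc :: "nat \<Rightarrow> nat \<Rightarrow> complex set" where
  "closed_arc n i = cis ` {2 * pi * i / n .. 2 * pi * (real i + 1) / n}"

definition arc_index :: "nat \<Rightarrow> complex \<Rightarrow> nat" where
  "arc_index n \<zeta> = nat \<lfloor>n * Arg2pi \<zeta> / (2 * pi)\<rfloor>"

lemma arc_index_measurable [measurable]: "arc_index n \<in> borel \<rightarrow>\<^sub>M count_space UNIV"
  unfolding arc_index_def by measurable

lemma cis_Arg2pi: "\<zeta> \<in> unit_circle \<Longrightarrow> cis (Arg2pi \<zeta>) = \<zeta>"
  using complex_norm_eq_1_exp[of \<zeta>] by (simp add: cis_conv_exp)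

lemma arc_bounds:
  assumes "i < n"
  shows "0 \<le> 2 * pi * real i / n" "2 * pi * real i / n \<le> 2 * pi * (real i + 1) / n"
    "2 * pi * (real i + 1) / n \<le> 2 * pi"
proof -
  have "real i + 1 \<le> n" using assms by linarith
  then show "2 * pi * (real i + 1) / n \<le> 2 * pi" using assms by (simp add: divide_le_eq ac_simps mult_left_mono)
qed (auto intro!: divide_right_mono mult_left_mono)

lemma in_arc_iff:
  assumes n: "0 < n" and \<zeta>: "\<zeta> \<in> unit_circle"
  shows "i < n \<and> \<zeta> \<in> circle_arc n i \<longleftrightarrow> arc_index n \<zeta> = i"
proof -
  define \<theta> where "\<theta> = Arg2pi \<zeta>"
  have \<theta>: "0 \<le> \<theta>" "\<theta> < 2 * pi" "cis \<theta> = \<zeta>"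
    using Arg2pi[of \<zeta>] cis_Arg2pi[OF \<zeta>] by (auto simp: \<theta>_def)
  have fl: "\<lfloor>n * \<theta> / (2 * pi)\<rfloor> = int i \<longleftrightarrow> 2 * pi * i / n \<le> \<theta> \<and> \<theta> < 2 * pi * (real i + 1) / n" for i :: nat
    using n by (auto simp: floor_eq_iff field_simps)
  have nn: "0 \<le> \<lfloor>n * \<theta> / (2 * pi)\<rfloor>" using \<theta> n by simp
  have iff: "arc_index n \<zeta> = i \<longleftrightarrow> 2 * pi * i / n \<le> \<theta> \<and> \<theta> < 2 * pi * (real i + 1) / n" for i
    unfolding fl[symmetric] arc_index_def \<theta>_def[symmetric] using nn by auto
  show ?thesis
  proof
    assume i: "i < n \<and> \<zeta> \<in> circle_arc n i"
    then obtain s where s: "\<zeta> = cis s" "2 * pi * i / n \<le> s" "s < 2 * pi * (real i + 1) / n"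
      by (auto simp: circle_arc_def)
    have "0 \<le> s" "s < 2 * pi" using s arc_bounds[of i n] i by linarith+
    then have "\<theta> = s" using Arg2pi_cis s(1) \<theta>_def by simp
    then show "arc_index n \<zeta> = i" using iff s by simp
  next
    assume i: "arc_index n \<zeta> = i"
    have "real n * \<theta> / (2 * pi) < n" using \<theta> n by (simp add: field_simps)
    then have "\<lfloor>n * \<theta> / (2 * pi)\<rfloor> < int n" by (simp add: floor_less_iff)
    then have "i < n" using i nn unfolding arc_index_def \<theta>_def[symmetric] by linarith
    moreover have "\<zeta> \<in> circle_arc n i" using i iff \<theta> by (auto simp: circle_arc_def intro!: image_eqI[of _ _ \<theta>])
    ultimately show "i < n \<and> \<zeta> \<in> circle_arc n i" by blast
  qed
qed

lemma arc_index_less: "0 < n \<Longrightarrow> \<zeta> \<in> unit_circle \<Longrightarrow> arc_index n \<zeta> < n"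
  and in_arc_arc_index: "0 < n \<Longrightarrow> \<zeta> \<in> unit_circle \<Longrightarrow> \<zeta> \<in> circle_arc n (arc_index n \<zeta>)"
  using in_arc_iff[of n \<zeta> "arc_index n \<zeta>"] by auto

lemma arc_subset_circle: "circle_arc n i \<subseteq> unit_circle" "closed_arc n i \<subseteq> unit_circle"
  by (auto simp: circle_arc_def closed_arc_def)

lemma arc_subset_closed_arc: "circle_arc n i \<subseteq> closed_arc n i"
  by (auto simp: circle_arc_def closed_arc_def)

lemma arc_sets: "i < n \<Longrightarrow> circle_arc n i \<in> sets (restrict_space borel unit_circle)"
  using circle_measure_arc(2)[OF arc_bounds, of i n] by (simp add: circle_arc_def add.commute)

lemma measure_arc: "i < n \<Longrightarrow> measure circle_measure (circle_arc n i) = 1 / n"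
  using circle_measure_arc(1)[OF arc_bounds, of i n] 
  by (simp add: circle_arc_def ring_distribs add_divide_distrib)

lemma compact_closed_arc: "compact (closed_arc n i)"
  unfolding closed_arc_def by (intro compact_continuous_image continuous_intros) simp

lemma closed_arc_sets: "closed_arc n i \<in> sets (restrict_space borel unit_circle)"
  using compact_closed_arc[of n i] arc_subset_circle(2) by (auto simp: sets_borel_circle compact_imp_closed)

lemma measure_closed_arc_le:
  assumes "i < n"
  shows "measure circle_measure (closed_arc n i) \<le> 1 / n"
proof -
  let ?a = "2 * pi * i / n" and ?b = "2 * pi * (real i + 1) / n"
  have sub: "{\<theta>\<in>{0..<2*pi}. cis \<theta> \<in> closed_arc n i} \<subseteq> {?a..?b} \<union> {0}"
  proof
    fix \<theta> assume "\<theta> \<in> {\<theta>\<in>{0..<2*pi}. cis \<theta> \<in> closed_arc n i}"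
    then obtain s where s: "?a \<le> s" "s \<le> ?b" "cis \<theta> = cis s" and \<theta>: "0 \<le> \<theta>" "\<theta> < 2*pi"
      by (auto simp: closed_arc_def)
    show "\<theta> \<in> {?a..?b} \<union> {0}"
    proof (cases "s < 2 * pi")
      case True
      then have "\<theta> = s" using Arg2pi_cis[of s] Arg2pi_cis[of \<theta>] s \<theta> arc_bounds[OF assms] by simp
      then show ?thesis using s by simp
    next
      case False
      then have "s = 2 * pi" using s arc_bounds[OF assms] by simp
      then have "cis \<theta> = cis 0" using s by (simp add: complex_eq_iff)
      then have "\<theta> = 0" using Arg2pi_cis[of 0] Arg2pi_cis[of \<theta>] \<theta> by simp
      then show ?thesis by simp
    qed
  qed
  have "emeasure circle_measure (closed_arc n i) \<le> emeasure lborel ({?a..?b} \<union> {0}) / ennreal (2 * pi)"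
    using closed_arc_sets by (subst emeasure_circle_measure) 
       (auto intro!: divide_right_mono_ennreal emeasure_mono[OF sub, simplified])
  also have "emeasure lborel ({?a..?b} \<union> {0}) \<le> emeasure lborel {?a..?b} + emeasure lborel {0::real}"
    by (rule emeasure_subadditive) auto
  also have "\<dots> = ennreal (2 * pi / n)" using arc_bounds[OF assms] 
    by (simp add: add_divide_distrib ring_distribs)
  finally have "emeasure circle_measure (closed_arc n i) \<le> ennreal (2 * pi / n) / ennreal (2 * pi)"
    by (simp add: divide_right_mono_ennreal)
  also have "\<dots> = ennreal (1 / n)" by (subst divide_ennreal) auto
  finally show ?thesis by (simp add: circle.emeasure_eq_measure)
qed

lemma measure_ge_open_arc:
  assumes "A \<in> sets circle_measure" "0 \<le> a" "a \<le> b" "b \<le> 2 * pi" "cis ` {a<..<b} \<subseteq> A"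
  shows "(b - a) / (2 * pi) \<le> measure circle_measure A"
proof -
  have m: "{\<theta>\<in>{0..<2*pi}. cis \<theta> \<in> A} \<in> sets lborel"
    using assms(1) by (auto simp: sets_borel_circle)
  have "ennreal ((b - a) / (2 * pi)) = emeasure lborel {a<..<b} / ennreal (2 * pi)"
    using assms by (simp add: divide_ennreal)
  also have "\<dots> \<le> emeasure lborel {\<theta>\<in>{0..<2*pi}. cis \<theta> \<in> A} / ennreal (2 * pi)"
    by (intro divide_right_mono_ennreal emeasure_mono m) (use assms in auto)
  also have "\<dots> = emeasure circle_measure A" by (rule emeasure_circle_measure[symmetric, OF assms(1)])
  finally show ?thesis by (simp add: circle.emeasure_eq_measure)
qed

text \<open>
  The only distinct angles in \<open>[0, 2 \<pi>]\<close> that give the same point are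
  \<open>0\<close> and \<open>2 \<pi>\<close>.
\<close>

lemma open_arc_disjoint_closed_arc:
  assumes "i < n" "j < n" "i \<noteq> j"
  shows "cis ` {2 * pi * i / n <..< 2 * pi * (real i + 1) / n} \<inter> closed_arc n j = {}"
proof (rule ccontr)
  assume "\<not> ?thesis"
  then obtain \<theta> s where \<theta>: "2 * pi * i / n < \<theta>" "\<theta> < 2 * pi * (real i + 1) / n"
    and s: "2 * pi * j / n \<le> s" "s \<le> 2 * pi * (real j + 1) / n" and eq: "cis \<theta> = cis s"
    by (auto simp: closed_arc_def)
  have b: "0 < \<theta>" "\<theta> < 2 * pi" "0 \<le> s" "s \<le> 2 * pi"
    using \<theta> s arc_bounds[OF assms(1)] arc_bounds[OF assms(2)] by linarith+
  have T: "Arg2pi (cis \<theta>) = \<theta>" using b by (simp add: Arg2pi_cis)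
  show False
  proof (cases "s < 2 * pi")
    case True
    then have "s = \<theta>" using eq T b Arg2pi_cis[of s] by metis
    have *: "real a < real b + 1" if "2 * pi * a / n < 2 * pi * (real b + 1) / n" for a b
    proof -
      have "2 * pi * a < 2 * pi * (real b + 1)"
        using that assms(1) by (simp only: divide_less_cancel)
      then show ?thesis by (simp only: mult_less_cancel_left_pos[of "2 * pi"] pi_gt_zero mult_pos_pos zero_less_numeral)
    qed
    have "real j < real i + 1" "real i < real j + 1"
      by (rule *, use \<theta> s \<open>s = \<theta>\<close> in linarith)+
    then show False using assms(3) by linarith
  next
    case False
    then have "cis \<theta> = cis 0" using b eq by (simp add: complex_eq_iff)
    then show False using T Arg2pi_cis[of 0] b by simp
  qed
qed

text \<open>
  Let \<open>A\<close> be a component of the complement of \<open>E\<close>, let \<open>x \<in>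
  A\<close>, and let \<open>k\<close> be the first generation in which the arc around
  \<open>x\<close> is not selected. That arc is contained in \<open>A\<close> up to its end
  points, so \<open>ln (1 / |A|) \<le> ln (n k)\<close>. This is at most \<open>L x\<close>, where
  \<open>L x\<close> is \<open>ln (n 0)\<close> plus the sum of \<open>ln (n (j + 1))\<close> over
  all generations \<open>j\<close> in which the arc around \<open>x\<close> is selected. As
  \<open>|A| ln (1 / |A|)\<close> is the integral of the constant \<open>ln (1 / |A|)\<close> over
  \<open>A\<close>, the entropy of \<open>E\<close> is at most the integral of \<open>L\<close>.
\<close>

theorem beurling_carleson_Inter_arcs:
  fixes n :: "nat \<Rightarrow> nat" and H :: "nat \<Rightarrow> nat set"
  assumes n: "\<And>k. 1 \<le> n k" and H: "\<And>k. H k \<subseteq> {..<n k}"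
    and ent: "summable (\<lambda>k. ln (n (Suc k)) * (card (H k) / n k))"
    and null: "(\<lambda>k. card (H k) / n k) \<longlonglongrightarrow> 0"
  defines "E \<equiv> (\<Inter>k. \<Union>i\<in>H k. closed_arc (n k) i)"
  shows "beurling_carleson E" "emeasure circle_measure E = 0"
proof -
  have n0: "0 < n k" for k using n[of k] by simp
  have finH: "finite (H k)" for k using H finite_subset by blast
  have clU: "closed (\<Union>i\<in>H k. closed_arc (n k) i)" for k
    using finH compact_closed_arc by (intro closed_UN) (auto simp: compact_imp_closed)
  then have clE: "closed E" unfolding E_def by auto
  have Esub: "E \<subseteq> unit_circle" unfolding E_def using arc_subset_circle(2) by blast
  have E_sets: "E \<in> sets circle_measure" using clE Esub by (auto simp: sets_borel_circle)
  have U_sets: "(\<Union>i\<in>H k. closed_arc (n k) i) \<in> sets circle_measure" for k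
    using finH closed_arc_sets by (intro sets.finite_UN) auto
  have "measure circle_measure E \<le> card (H k) / n k" for k
  proof -
    have "measure circle_measure E \<le> measure circle_measure (\<Union>i\<in>H k. closed_arc (n k) i)"
      by (rule circle.finite_measure_mono) (use U_sets in \<open>auto simp: E_def\<close>)
    also have "\<dots> \<le> (\<Sum>i\<in>H k. measure circle_measure (closed_arc (n k) i))"
      by (rule circle.finite_measure_subadditive_finite) (use finH closed_arc_sets in auto)
    also have "\<dots> \<le> (\<Sum>i\<in>H k. 1 / n k)"
      by (intro sum_mono measure_closed_arc_le) (use H in blast)
    finally show ?thesis by simp
  qed
  then have "measure circle_measure E \<le> 0"
    by (intro LIMSEQ_le_const[OF null]) auto
  then show "emeasure circle_measure E = 0"
    by (simp add: circle.emeasure_eq_measure measure_le_0_iff)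
  define U where "U k = (\<Union>i\<in>H k. circle_arc (n k) i)" for k
  have Us[measurable]: "U k \<in> sets circle_measure" for k
    unfolding U_def sets_circle_measure using finH arc_sets H by (intro sets.finite_UN) blast+
  define L where "L x = ennreal (ln (n 0)) + (\<Sum>k. ennreal (ln (n (Suc k))) * indicator (U k) x)" for x
  have L_meas[measurable]: "L \<in> borel_measurable circle_measure" unfolding L_def by measurable
  have ln0: "0 \<le> ln (real (n k))" for k using n[of k] by simp
  have "(\<integral>\<^sup>+x. L x \<partial>circle_measure) = ennreal (ln (n 0)) * emeasure circle_measure unit_circle + 
     (\<Sum>k. ennreal (ln (n (Suc k))) * emeasure circle_measure (U k))"
    unfolding L_def using Us by (simp add: nn_integral_add nn_integral_suminf nn_integral_cmult_indicator)
  also have "\<dots> \<le> ennreal (ln (n 0)) + (\<Sum>k. ennreal (ln (n (Suc k)) * (card (H k) / n k)))"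
  proof (intro add_mono suminf_le)
    fix k
    have "measure circle_measure (U k) \<le> (\<Sum>i\<in>H k. measure circle_measure (circle_arc (n k) i))"
      unfolding U_def by (rule circle.finite_measure_subadditive_finite[OF finH]) (use arc_sets H in auto)
    also have "\<dots> = (\<Sum>i\<in>H k. 1 / n k)"
      by (intro sum.cong refl measure_arc) (use H in blast)
    finally have "measure circle_measure (U k) \<le> card (H k) / n k" by simp
    then show "ennreal (ln (n (Suc k))) * emeasure circle_measure (U k) \<le> ennreal (ln (n (Suc k)) * (card (H k) / n k))"
      using ln0[of "Suc k"] by (subst ennreal_mult'') (auto simp: circle.emeasure_eq_measure intro!: mult_left_mono ennreal_leI)
  qed (auto simp: measure_circle_UNIV)
  also have "(\<Sum>k. ennreal (ln (n (Suc k)) * (card (H k) / n k))) = ennreal (\<Sum>k. ln (n (Suc k)) * (card (H k) / n k))"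
    by (rule suminf_ennreal2[OF _ ent]) (use ln0 in simp)
  finally have Lfin: "(\<integral>\<^sup>+x. L x \<partial>circle_measure) < top"
    by (rule order.strict_trans1) (simp add: ennreal_plus[symmetric] del: ennreal_plus)
  have comp_sets: "A \<in> sets circle_measure" if A: "A \<in> components (unit_circle - E)" for A
  proof -
    obtain T where "closed T" "A = (unit_circle - E) \<inter> T"
      using closedin_component[OF A] by (auto simp: closedin_closed)
    then show ?thesis using clE by (auto simp: sets_borel_circle)
  qed
  have key: "0 < measure circle_measure A \<and> ennreal (ln (1 / measure circle_measure A)) \<le> L x"
    if A: "A \<in> components (unit_circle - E)" and x: "x \<in> A" for A x
  proof -
    have xc: "x \<in> unit_circle" "x \<notin> E" using in_components_subset[OF A] x by auto
    then have "\<exists>k. x \<notin> U k" unfolding E_def U_def using arc_subset_closed_arc by blast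
    then obtain k where k: "x \<notin> U k" "\<And>j. j < k \<Longrightarrow> x \<in> U j"
      using exists_least_iff[of "\<lambda>k. x \<notin> U k"] by blast
    define i where "i = arc_index (n k) x"
    have i: "i < n k" "x \<in> circle_arc (n k) i"
      using arc_index_less[OF n0 xc(1)] in_arc_arc_index[OF n0 xc(1)] by (auto simp: i_def)
    then have iH: "i \<notin> H k" using k(1) by (auto simp: U_def)
    let ?a = "2 * pi * i / n k" and ?b = "2 * pi * (real i + 1) / n k"
    obtain s where s: "x = cis s" "?a \<le> s" "s < ?b" using i(2) by (auto simp: circle_arc_def)
    \<comment> \<open>The connected set must contain \<open>x\<close>, which may be the left end point of its arc.\<close>
    define J where "J = (if s = ?a then {?a..<?b} else {?a<..<?b})"
    have sJ: "s \<in> J" and Jsub: "J \<subseteq> insert s {?a<..<?b}" "{?a<..<?b} \<subseteq> J"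
      using s by (auto simp: J_def)
    have "connected J" by (simp add: J_def)
    then have conn: "connected (cis ` J)" by (intro connected_continuous_image continuous_intros)
    have "cis ` {?a<..<?b} \<inter> closed_arc (n k) j = {}" if "j \<in> H k" for j
      using open_arc_disjoint_closed_arc[of i "n k" j] i iH that H[of k] by (auto simp: add.commute)
    then have "cis ` {?a<..<?b} \<inter> E = {}" unfolding E_def by blast
    then have "cis ` J \<subseteq> unit_circle - E" using Jsub s(1) xc by auto
    then have "cis ` J \<subseteq> A"
      using components_maximal[OF A conn] x sJ s(1) by blast
    then have "cis ` {?a<..<?b} \<subseteq> A" using Jsub by blast
    from measure_ge_open_arc[OF comp_sets[OF A] arc_bounds[OF i(1)] this]
    have mA: "1 / n k \<le> measure circle_measure A"
      by (simp add: ring_distribs add_divide_distrib)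
    have pos: "0 < measure circle_measure A" using mA n0[of k] by (meson less_le_trans of_nat_0_less_iff zero_less_divide_1_iff)
    have "1 / measure circle_measure A \<le> n k" using mA pos n0[of k] by (simp add: field_simps)
    then have "ln (1 / measure circle_measure A) \<le> ln (n k)" using pos n0[of k] by (subst ln_le_cancel_iff) auto
    then have "ennreal (ln (1 / measure circle_measure A)) \<le> ennreal (ln (n k))" by (rule ennreal_leI)
    also have "\<dots> \<le> L x"
    proof (cases k)
      case 0
      then show ?thesis by (simp add: L_def)
    next
      case (Suc j)
      have "ennreal (ln (n k)) = ennreal (ln (n (Suc j))) * indicator (U j) x"
        using k(2)[of j] Suc by simp
      also have "\<dots> \<le> (\<Sum>k. ennreal (ln (n (Suc k))) * indicator (U k) x)"
        by (rule ennreal_le_suminf)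
      finally show ?thesis by (simp add: L_def add_increasing)
    qed
    finally show ?thesis using pos by blast
  qed
  let ?f = "\<lambda>A. measure circle_measure A * ln (1 / measure circle_measure A)"
  have m1: "measure circle_measure A \<le> 1" for A
    using circle.finite_measure_mono[of A unit_circle] measure_circle_UNIV
    by (metis circle.bounded_measure enn2real_1 measure_def space_circle_measure)
  have fnn: "0 \<le> ?f A" for A
  proof (cases "measure circle_measure A = 0")
    case False
    then have "0 < measure circle_measure A" by (simp add: zero_less_measure_iff)
    then show ?thesis using m1[of A] by (intro mult_nonneg_nonneg ln_ge_zero) (auto simp: field_simps)
  qed simp
  define D where "D = density circle_measure L"
  have D_sets[simp]: "sets D = sets circle_measure" by (simp add: D_def)
  have "?f summable_on components (unit_circle - E)"
  proof (rule nonneg_bdd_above_summable_on[OF fnn])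
    show "bdd_above (sum ?f ` {F. F \<subseteq> components (unit_circle - E) \<and> finite F})"
    proof (rule bdd_aboveI2)
      fix F assume F: "F \<in> {F. F \<subseteq> components (unit_circle - E) \<and> finite F}"
      have "ennreal (sum ?f F) = (\<Sum>A\<in>F. ennreal (?f A))" using fnn by simp
      also have "\<dots> \<le> (\<Sum>A\<in>F. emeasure D A)"
      proof (rule sum_mono)
        fix A assume "A \<in> F"
        then have A: "A \<in> components (unit_circle - E)" using F by blast
        note [measurable] = comp_sets[OF A, unfolded sets_circle_measure]
        have "ennreal (?f A) = ennreal (ln (1 / measure circle_measure A)) * emeasure circle_measure A"
          by (simp add: circle.emeasure_eq_measure ennreal_mult' mult.commute)
        also have "\<dots> = (\<integral>\<^sup>+x\<in>A. ennreal (ln (1 / measure circle_measure A)) \<partial>circle_measure)"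
          using comp_sets[OF A] by (simp add: nn_integral_cmult_indicator)
        also have "\<dots> \<le> (\<integral>\<^sup>+x\<in>A. L x \<partial>circle_measure)"
          using key[OF A] by (intro nn_integral_mono) (auto simp: indicator_def)
        also have "\<dots> = emeasure D A" using comp_sets[OF A] by (simp add: D_def emeasure_density)
        finally show "ennreal (?f A) \<le> emeasure D A" .
      qed
      also have "\<dots> = emeasure D (\<Union>A\<in>F. A)"
      proof (rule sum_emeasure)
        have FC: "F \<subseteq> components (unit_circle - E)" "finite F" using F by auto
        then show "finite F" "(\<lambda>A. A) ` F \<subseteq> sets D" using comp_sets by auto
        show "disjoint_family_on (\<lambda>A. A) F"
          unfolding disjoint_family_on_def using FC(1) components_nonoverlap by (metis subsetD)
      qed
      also have "\<dots> \<le> emeasure D (space D)" by (rule emeasure_space)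
      also have "\<dots> = (\<integral>\<^sup>+x. L x \<partial>circle_measure)" 
        unfolding D_def by (subst emeasure_density) (auto simp: sets_borel_circle intro!: nn_integral_cong)
      finally have "ennreal (sum ?f F) \<le> (\<integral>\<^sup>+x. L x \<partial>circle_measure)" .
      then have "enn2real (ennreal (sum ?f F)) \<le> enn2real (\<integral>\<^sup>+x. L x \<partial>circle_measure)"
        using Lfin by (rule enn2real_mono)
      then show "sum ?f F \<le> enn2real (\<integral>\<^sup>+x. L x \<partial>circle_measure)"
        using fnn by (subst (asm) enn2real_ennreal) (auto intro!: sum_nonneg)
    qed
  qed
  then show "beurling_carleson E" using clE Esub by (simp add: beurling_carleson_def)
qed

section \<open>The decomposition of a Korenblum-Roberts measure\<close>

context finite_circle_measure
begin

definition arc_mass :: "(complex \<Rightarrow> real) \<Rightarrow> nat \<Rightarrow> nat \<Rightarrow> real" where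
  "arc_mass \<phi> n i = (LINT \<zeta>|\<nu>. \<phi> \<zeta> * indicator (circle_arc n i) \<zeta>)"

lemma integrable_times_arc:
  fixes f :: "complex \<Rightarrow> real"
  assumes "integrable \<nu> f" "i < n"
  shows "integrable \<nu> (\<lambda>\<zeta>. f \<zeta> * indicator (circle_arc n i) \<zeta>)"
  using assms arc_sets by (intro integrable_real_mult_indicator) auto

lemma indicator_arc:
  assumes "\<zeta> \<in> unit_circle" "i < n"
  shows "indicator (circle_arc n i) \<zeta> = (if arc_index n \<zeta> = i then 1 else 0 :: real)"
  using in_arc_iff[OF _ assms(1), of n i] assms(2) by (auto simp: indicator_def)

lemma sum_indicator_arc:
  assumes "\<zeta> \<in> unit_circle" "1 \<le> n"
  shows "(\<Sum>i<n. indicator (circle_arc n i) \<zeta>) = (1 :: real)"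
proof -
  have "(\<Sum>i<n. indicator (circle_arc n i) \<zeta>) = (\<Sum>i<n. if arc_index n \<zeta> = i then 1 else 0 :: real)"
    by (rule sum.cong) (use indicator_arc assms in auto)
  also have "\<dots> = 1" using arc_index_less[of n \<zeta>] assms by simp
  finally show ?thesis .
qed

lemma integral_eq_sum_arcs:
  fixes f :: "complex \<Rightarrow> real"
  assumes f: "integrable \<nu> f" and n: "1 \<le> n"
  shows "(LINT \<zeta>|\<nu>. f \<zeta>) = (\<Sum>i<n. LINT \<zeta>|\<nu>. f \<zeta> * indicator (circle_arc n i) \<zeta>)"
proof -
  have "(LINT \<zeta>|\<nu>. f \<zeta>) = (LINT \<zeta>|\<nu>. (\<Sum>i<n. f \<zeta> * indicator (circle_arc n i) \<zeta>))"
    by (rule Bochner_Integration.integral_cong)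
       (use sum_indicator_arc n in \<open>auto simp: sum_distrib_left[symmetric]\<close>)
  also have "\<dots> = (\<Sum>i<n. LINT \<zeta>|\<nu>. f \<zeta> * indicator (circle_arc n i) \<zeta>)"
    by (rule Bochner_Integration.integral_sum) (use integrable_times_arc[OF f] in auto)
  finally show ?thesis .
qed

lemma arc_mass_nonneg: "weight \<phi> \<Longrightarrow> 0 \<le> arc_mass \<phi> n i"
  unfolding arc_mass_def by (rule integral_nonneg_AE) (auto simp: weight_def)

text \<open>
  Harnack's inequality on an arc of length \<open>2 \<pi> / n \<le> 2 \<pi> (1 - |z|)\<close>:
  there \<open>|\<zeta>' - z| \<le> (2 \<pi> + 1) |\<zeta> - z|\<close>, and \<open>2 \<pi> + 1 <
  8\<close>.
\<close>

lemma poisson_kernel_arc_le: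
  assumes z: "norm z \<le> 1 - 1 / real n" and n: "1 \<le> n" and \<zeta>: "\<zeta> \<in> circle_arc n i" "\<zeta>' \<in> circle_arc n i"
  shows "poisson_kernel z \<zeta> \<le> 64 * poisson_kernel z \<zeta>'"
proof -
  have c: "norm \<zeta> = 1" "norm \<zeta>' = 1" using \<zeta>[THEN subsetD[OF arc_subset_circle(1)]] by auto
  have n0: "0 < 1 / real n" using n by simp
  have nz: "norm z < 1" using z n0 by linarith
  obtain s s' where s: "\<zeta> = cis s" "2 * pi * i / n \<le> s" "s < 2 * pi * (real i + 1) / n"
    and s': "\<zeta>' = cis s'" "2 * pi * i / n \<le> s'" "s' < 2 * pi * (real i + 1) / n"
    using \<zeta> by (auto simp: circle_arc_def)
  have "2 * pi * (real i + 1) / n = 2 * pi * i / n + 2 * pi / n" by (simp add: ring_distribs add_divide_distrib)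
  then have "\<bar>s' - s\<bar> \<le> 2 * pi / n" using s s' by linarith
  then have d: "norm (\<zeta>' - \<zeta>) \<le> 2 * pi / n" unfolding s(1) s'(1) using norm_cis_diff_le order_trans by blast
  have far: "1 / n \<le> norm (\<zeta> - z)" using norm_triangle_ineq2[of \<zeta> z] c z by linarith
  have far': "1 / n \<le> norm (\<zeta>' - z)" using norm_triangle_ineq2[of \<zeta>' z] c z by linarith
  have "norm (\<zeta>' - z) \<le> norm (\<zeta>' - \<zeta>) + norm (\<zeta> - z)"
    using norm_triangle_ineq[of "\<zeta>' - \<zeta>" "\<zeta> - z"] by simp
  also have "\<dots> \<le> 2 * pi * (1 / n) + norm (\<zeta> - z)" using d by simp
  also have "\<dots> \<le> 2 * pi * norm (\<zeta> - z) + norm (\<zeta> - z)" using far by (intro add_mono mult_left_mono) auto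
  also have "\<dots> \<le> 8 * norm (\<zeta> - z)"
  proof -
    have "2 * pi * norm (\<zeta> - z) \<le> 7 * norm (\<zeta> - z)" using pi_less_4 pi_approx by (intro mult_right_mono) auto
    then show ?thesis by simp
  qed
  finally have "norm (\<zeta>' - z) \<le> 8 * norm (\<zeta> - z)" .
  then have "(norm (\<zeta>' - z))\<^sup>2 \<le> (8 * norm (\<zeta> - z))\<^sup>2" by (intro power_mono) auto
  then have sq: "(norm (\<zeta>' - z))\<^sup>2 \<le> 64 * (norm (\<zeta> - z))\<^sup>2" by (simp add: power_mult_distrib)
  have pos: "0 < norm (\<zeta> - z)" "0 < norm (\<zeta>' - z)" using far far' n0 by linarith+
  have "1 / (norm (\<zeta> - z))\<^sup>2 \<le> 64 / (norm (\<zeta>' - z))\<^sup>2" using sq pos by (simp add: field_simps)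
  then have "(1 - (norm z)\<^sup>2) * (1 / (norm (\<zeta> - z))\<^sup>2) \<le> (1 - (norm z)\<^sup>2) * (64 / (norm (\<zeta>' - z))\<^sup>2)"
    using nz by (intro mult_left_mono) (auto simp: power_le_one)
  then show ?thesis by (simp add: poisson_kernel_def mult.commute)
qed

text \<open>
  At distance at least \<open>1 / n\<close> from the circle the Poisson kernel is comparable on
  each arc to its mean value over that arc. So the real part of the Herglotz integral is at most
  64 times the largest density \<open>n Q\<close>, because the kernel has integral 1.
\<close>

lemma Re_herglotz_le_of_arc_mass:
  assumes \<psi>: "weight \<psi>" and n: "1 \<le> n" and Q: "\<And>i. i < n \<Longrightarrow> arc_mass \<psi> n i \<le> Q"
    and z: "norm z \<le> 1 - 1 / real n"
  shows "Re (herglotz \<psi> z) \<le> 64 * (n * Q)"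
proof -
  have "0 < 1 / real n" using n by simp
  then have nz: "norm z < 1" using z by linarith
  note sep = separated_disk[OF nz, of \<psi>]
  let ?P = "poisson_kernel z"
  have P0: "0 \<le> ?P \<zeta>" for \<zeta> using poisson_kernel_nonneg nz by simp
  have iP: "integrable circle_measure (\<lambda>\<zeta>. ?P \<zeta> * indicator (circle_arc n i) \<zeta>)" if "i < n" for i
    using integral_poisson_kernel(1)[OF nz] arc_sets[OF that] by (intro integrable_real_mult_indicator) auto
  define p where "p i = (LINT \<zeta>|circle_measure. ?P \<zeta> * indicator (circle_arc n i) \<zeta>)" for i
  have p0: "0 \<le> p i" for i unfolding p_def by (rule integral_nonneg_AE) (use P0 in auto)
  have "(\<Sum>i<n. p i) = (LINT \<zeta>|circle_measure. (\<Sum>i<n. ?P \<zeta> * indicator (circle_arc n i) \<zeta>))"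
    unfolding p_def by (rule Bochner_Integration.integral_sum[symmetric]) (use iP in auto)
  also have "\<dots> = (LINT \<zeta>|circle_measure. ?P \<zeta>)"
    by (rule Bochner_Integration.integral_cong)
       (use sum_indicator_arc n in \<open>auto simp: sum_distrib_left[symmetric]\<close>)
  finally have sump: "(\<Sum>i<n. p i) = 1" using integral_poisson_kernel(2)[OF nz] by simp
  have Pp: "?P \<zeta> \<le> 64 * n * p i" if i: "i < n" and \<zeta>: "\<zeta> \<in> circle_arc n i" for i \<zeta>
  proof -
    have "?P \<zeta> * (1 / n) = (LINT \<xi>|circle_measure. ?P \<zeta> * indicator (circle_arc n i) \<xi>)"
      using arc_sets[OF i] measure_arc[OF i] Int_absorb2[OF arc_subset_circle(1), of n i] by simp
    also have "\<dots> \<le> (LINT \<xi>|circle_measure. 64 * (?P \<xi> * indicator (circle_arc n i) \<xi>))"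
    proof (rule integral_mono)
      show "integrable circle_measure (\<lambda>\<xi>. ?P \<zeta> * indicat_real (circle_arc n i) \<xi>)"
        using arc_sets[OF i] by (intro integrable_mult_right integrable_real_indicator) (auto simp: circle.emeasure_eq_measure)
    qed (use iP[OF i] poisson_kernel_arc_le[OF z n \<zeta>] in \<open>auto simp: indicator_def\<close>)
    also have "\<dots> = 64 * p i" by (simp add: p_def)
    finally show ?thesis using n by (simp add: field_simps)
  qed
  have int: "integrable \<nu> (\<lambda>\<zeta>. \<psi> \<zeta> * ?P \<zeta>)"
    by (rule Re_herglotz(2)[OF \<psi> _ _ sep]) (use nz in auto)
  have "Re (herglotz \<psi> z) = (LINT \<zeta>|\<nu>. \<psi> \<zeta> * ?P \<zeta>)"
    by (rule Re_herglotz(1)[OF \<psi> _ _ sep]) (use nz in auto)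
  also have "\<dots> = (\<Sum>i<n. LINT \<zeta>|\<nu>. \<psi> \<zeta> * ?P \<zeta> * indicator (circle_arc n i) \<zeta>)"
    by (rule integral_eq_sum_arcs[OF int n])
  also have "\<dots> \<le> (\<Sum>i<n. 64 * n * Q * p i)"
  proof (rule sum_mono)
    fix i assume "i \<in> {..<n}"
    then have i: "i < n" by simp
    have "(LINT \<zeta>|\<nu>. \<psi> \<zeta> * ?P \<zeta> * indicator (circle_arc n i) \<zeta>) \<le> 
        (LINT \<zeta>|\<nu>. 64 * n * p i * (\<psi> \<zeta> * indicator (circle_arc n i) \<zeta>))"
    proof (rule integral_mono)
      fix \<zeta> assume "\<zeta> \<in> space \<nu>"
      then have "0 \<le> \<psi> \<zeta>" using weightD(2)[OF \<psi>] by simp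
      then have "\<psi> \<zeta> * ?P \<zeta> \<le> \<psi> \<zeta> * (64 * n * p i)" if "\<zeta> \<in> circle_arc n i"
        using Pp[OF i that] by (intro mult_left_mono)
      then show "\<psi> \<zeta> * ?P \<zeta> * indicator (circle_arc n i) \<zeta> \<le> 64 * n * p i * (\<psi> \<zeta> * indicator (circle_arc n i) \<zeta>)"
        by (auto simp: indicator_def mult_ac)
    qed (intro integrable_times_arc[OF int i] integrable_mult_right integrable_times_arc[OF weight_integrable[OF \<psi>] i])+
    also have "\<dots> = 64 * n * p i * arc_mass \<psi> n i" by (simp add: arc_mass_def)
    also have "\<dots> \<le> 64 * n * p i * Q" using Q[OF i] p0 by (intro mult_left_mono mult_nonneg_nonneg) auto
    finally show "(LINT \<zeta>|\<nu>. \<psi> \<zeta> * ?P \<zeta> * indicator (circle_arc n i) \<zeta>) \<le> 64 * n * Q * p i"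
      by (simp add: mult_ac)
  qed
  also have "\<dots> = 64 * (n * Q)" by (simp add: sum_distrib_left[symmetric] sump)
  finally show ?thesis .
qed

text \<open>
  Stage \<open>k\<close> of the decomposition of Roberts. From an arc with remaining mass at most
  \<open>q k\<close> everything is removed; from a heavier arc the mass \<open>q k\<close>, in
  proportion to the remaining density. The first case includes arcs without remaining mass, so the
  quotient \<open>q k / I\<close> has a positive denominator.
\<close>

fun residual :: "(nat \<Rightarrow> nat) \<Rightarrow> (nat \<Rightarrow> real) \<Rightarrow> (complex \<Rightarrow> real) \<Rightarrow> nat \<Rightarrow> complex \<Rightarrow> real" where
  "residual n q \<phi> 0 = \<phi>"
| "residual n q \<phi> (Suc k) = (\<lambda>\<zeta>. 
     let I = arc_mass (residual n q \<phi> k) (n k) (arc_index (n k) \<zeta>)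
     in if I \<le> q k then 0 else residual n q \<phi> k \<zeta> * (1 - q k / I))"

definition layer :: "(nat \<Rightarrow> nat) \<Rightarrow> (nat \<Rightarrow> real) \<Rightarrow> (complex \<Rightarrow> real) \<Rightarrow> nat \<Rightarrow> complex \<Rightarrow> real" where
  "layer n q \<phi> k \<zeta> = residual n q \<phi> k \<zeta> - residual n q \<phi> (Suc k) \<zeta>"

lemma residual_step:
  assumes "weight (residual n q \<phi> k)" "0 < q k"
  shows "weight (residual n q \<phi> (Suc k))"
    and "\<zeta> \<in> unit_circle \<Longrightarrow> residual n q \<phi> (Suc k) \<zeta> \<le> residual n q \<phi> k \<zeta>"
proof -
  have [measurable]: "residual n q \<phi> k \<in> borel_measurable \<nu>" using assms weightD by blast
  have [measurable]: "arc_index (n k) \<in> \<nu> \<rightarrow>\<^sub>M count_space UNIV"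
    using measurable_restrict_space1[OF arc_index_measurable] by (simp cong: measurable_cong_sets)
  have "residual n q \<phi> (Suc k) \<in> borel_measurable \<nu>"
    unfolding residual.simps Let_def by measurable
  moreover have fac: "0 \<le> 1 - q k / I \<and> 1 - q k / I \<le> 1" if "\<not> I \<le> q k" for I
    using that assms(2) by (simp add: field_simps)
  ultimately show "weight (residual n q \<phi> (Suc k))"
    using assms unfolding weight_def by (auto simp: Let_def intro!: mult_nonneg_nonneg mult_le_one)
  show "residual n q \<phi> (Suc k) \<zeta> \<le> residual n q \<phi> k \<zeta>" if "\<zeta> \<in> unit_circle"
    using weightD(2)[OF assms(1) that] fac by (auto simp: Let_def intro!: mult_left_le)
qed

lemma weight_residual: "weight \<phi> \<Longrightarrow> (\<And>k. 0 < q k) \<Longrightarrow> weight (residual n q \<phi> k)"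
  by (induction k) (auto intro: residual_step simp del: residual.simps(2))

lemma weight_layer:
  assumes "weight \<phi>" "\<And>k. 0 < q k"
  shows "weight (layer n q \<phi> k)"
proof -
  note w = weight_residual[OF assms(1), of q, OF assms(2)]
  have "layer n q \<phi> k \<in> borel_measurable \<nu>"
    unfolding layer_def[abs_def] using weightD(1)[OF w] by (intro borel_measurable_diff)
  then show ?thesis
    unfolding weight_def layer_def
  proof (intro conjI ballI)
    fix \<zeta> :: complex assume \<zeta>: "\<zeta> \<in> unit_circle"
    show "0 \<le> residual n q \<phi> k \<zeta> - residual n q \<phi> (Suc k) \<zeta>"
      using residual_step(2)[OF w assms(2) \<zeta>] by (simp del: residual.simps)
    show "residual n q \<phi> k \<zeta> - residual n q \<phi> (Suc k) \<zeta> \<le> 1"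
      using weightD(3)[OF w[of n k] \<zeta>] weightD(2)[OF w[of n "Suc k"] \<zeta>]
      by (simp del: residual.simps)
  qed (simp add: layer_def[abs_def])
qed

lemma mass_layer:
  assumes "weight \<phi>" "\<And>k. 0 < q k"
  shows "mass (layer n q \<phi> k) = mass (residual n q \<phi> k) - mass (residual n q \<phi> (Suc k))"
  unfolding mass_def layer_def using weight_integrable[OF weight_residual[OF assms]]
  by (simp del: residual.simps)

lemma arc_mass_layer:
  assumes "weight \<phi>" "\<And>k. 0 < q k" "i < n k"
  shows "arc_mass (layer n q \<phi> k) (n k) i = min (q k) (arc_mass (residual n q \<phi> k) (n k) i)"
proof -
  define I where "I = arc_mass (residual n q \<phi> k) (n k) i"
  define c where "c = (if I \<le> q k then 1 else q k / I)"
  have "arc_mass (layer n q \<phi> k) (n k) i = 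
      (LINT \<zeta>|\<nu>. c * (residual n q \<phi> k \<zeta> * indicator (circle_arc (n k) i) \<zeta>))"
    unfolding arc_mass_def
  proof (rule Bochner_Integration.integral_cong[OF refl])
    fix \<zeta> assume "\<zeta> \<in> space \<nu>"
    then have "indicator (circle_arc (n k) i) \<zeta> = (if arc_index (n k) \<zeta> = i then 1 else 0 :: real)"
      using indicator_arc assms(3) by simp
    then show "layer n q \<phi> k \<zeta> * indicator (circle_arc (n k) i) \<zeta> = 
      c * (residual n q \<phi> k \<zeta> * indicator (circle_arc (n k) i) \<zeta>)"
      by (auto simp: layer_def Let_def I_def c_def algebra_simps)
  qed
  also have "\<dots> = c * I" by (simp add: I_def arc_mass_def)
  also have "\<dots> = min (q k) I" using assms(2)[of k] by (auto simp: c_def min_def)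
  finally show ?thesis by (simp add: I_def)
qed

lemma sum_mass_layer:
  assumes "weight \<phi>" "\<And>k. 0 < q k"
  shows "(\<Sum>k<K. mass (layer n q \<phi> k)) = mass \<phi> - mass (residual n q \<phi> K)"
  by (induction K) (auto simp: mass_layer[OF assms] simp del: residual.simps(2))

lemma summable_mass_layer:
  assumes "weight \<phi>" "\<And>k. 0 < q k"
  shows "summable (\<lambda>k. mass (layer n q \<phi> k))"
proof (rule summableI_nonneg_bounded)
  show "0 \<le> mass (layer n q \<phi> k)" for k using mass_nonneg weight_layer assms by blast
  show "(\<Sum>k<K. mass (layer n q \<phi> k)) \<le> mass \<phi>" for K
    unfolding sum_mass_layer[OF assms] using mass_nonneg weight_residual assms by (simp add: le_diff_eq)
qed

definition heavy :: "(nat \<Rightarrow> nat) \<Rightarrow> (nat \<Rightarrow> real) \<Rightarrow> (complex \<Rightarrow> real) \<Rightarrow> nat \<Rightarrow> nat set" where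
  "heavy n q \<phi> k = {i. i < n k \<and> q k < arc_mass (residual n q \<phi> k) (n k) i}"

text \<open>
  Every heavy arc carries exactly the mass \<open>q k\<close> of the layer.
\<close>

lemma card_heavy:
  assumes "weight \<phi>" "\<And>k. 0 < q k" "1 \<le> n k"
  shows "real (card (heavy n q \<phi> k)) * q k \<le> mass (layer n q \<phi> k)"
proof -
  note w = weight_layer[OF assms(1,2)]
  have "arc_mass (layer n q \<phi> k) (n k) i = q k" if "i \<in> heavy n q \<phi> k" for i
    using that arc_mass_layer[OF assms(1,2), of i n k] by (auto simp: heavy_def)
  then have "real (card (heavy n q \<phi> k)) * q k = (\<Sum>i\<in>heavy n q \<phi> k. arc_mass (layer n q \<phi> k) (n k) i)"
    by simp
  also have "\<dots> \<le> (\<Sum>i<n k. arc_mass (layer n q \<phi> k) (n k) i)"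
    by (rule sum_mono2) (auto simp: heavy_def arc_mass_nonneg[OF w])
  also have "\<dots> = mass (layer n q \<phi> k)"
    unfolding mass_def arc_mass_def using integral_eq_sum_arcs[OF weight_integrable[OF w] assms(3)] by simp
  finally show ?thesis .
qed

lemma residual_nonzero_imp_heavy:
  assumes "residual n q \<phi> (Suc k) \<zeta> \<noteq> 0" "\<zeta> \<in> unit_circle" "1 \<le> n k"
  shows "arc_index (n k) \<zeta> \<in> heavy n q \<phi> k"
  using assms arc_index_less[of "n k" \<zeta>] by (auto simp: heavy_def Let_def split: if_splits)

text \<open>
  A point keeps a positive residual density at all stages only if it lies in a heavy arc of each
  generation. The intersection of these unions of arcs is a Beurling-Carleson set of measure zero:
  \<open>ln (n (k + 1)) = 2 ln (n k)\<close>, so the \<open>k\<close>-th term of the series that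
  controls its entropy is at most \<open>2 / c\<close> times the mass of the \<open>k\<close>-th
  layer, and the layers have finite total mass.
\<close>

theorem korenblum_roberts_residual_tendsto_0:
  assumes KR: "\<And>E. beurling_carleson E \<Longrightarrow> emeasure circle_measure E = 0 \<Longrightarrow> emeasure \<nu> E = 0"
    and \<phi>: "weight \<phi>" and N: "2 \<le> N" and c: "0 < c"
  defines "n \<equiv> (\<lambda>k. N ^ (2 ^ k))"
  defines "q \<equiv> (\<lambda>k. c * ln (n k) / n k)"
  shows "(\<lambda>k. mass (residual n q \<phi> k)) \<longlonglongrightarrow> 0"
proof -
  have n2: "2 \<le> n k" for k
  proof -
    have "N ^ 1 \<le> N ^ (2 ^ k)" using N by (intro power_increasing) auto
    then show ?thesis using N by (simp add: n_def)
  qed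
  then have n1: "1 \<le> n k" for k using le_trans one_le_numeral by blast
  have ln2: "ln 2 \<le> ln (n k)" for k using n2[of k] by (subst ln_le_cancel_iff) auto
  have lnpos: "0 < ln (real (n k))" for k using ln2[of k] by (rule less_le_trans[rotated]) simp
  have q0: "0 < q k" for k using lnpos[of k] n1[of k] c by (simp add: q_def)
  have ent: "ln (n k) * (card (heavy n q \<phi> k) / n k) \<le> mass (layer n q \<phi> k) / c" for k
    using card_heavy[OF \<phi>, of q n k, OF q0 n1] c by (simp add: q_def field_simps)
  have sml: "summable (\<lambda>k. mass (layer n q \<phi> k) / c)"
    by (intro summable_divide summable_mass_layer \<phi> q0)
  define E where "E = (\<Inter>k. \<Union>i\<in>heavy n q \<phi> k. closed_arc (n k) i)"
  have "beurling_carleson E \<and> emeasure circle_measure E = 0"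
  proof -
    have H1: "heavy n q \<phi> k \<subseteq> {..<n k}" for k by (auto simp: heavy_def)
    have H2: "summable (\<lambda>k. ln (n (Suc k)) * (card (heavy n q \<phi> k) / n k))"
    proof (rule summable_comparison_test'[where N=0])
      show "summable (\<lambda>k. 2 * (mass (layer n q \<phi> k) / c))" by (intro summable_mult sml)
      fix k
      have "real (n (Suc k)) = real (n k) ^ 2" by (simp add: n_def power_mult[symmetric] mult.commute)
      then have "ln (real (n (Suc k))) = 2 * ln (n k)" using n1[of k] by (simp add: ln_realpow)
      then have *: "ln (n (Suc k)) * (card (heavy n q \<phi> k) / n k) \<le> 2 * (mass (layer n q \<phi> k) / c)"
        using ent[of k] by (simp add: mult.assoc)
      have "0 \<le> ln (n (Suc k)) * (card (heavy n q \<phi> k) / n k)"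
        using lnpos[of "Suc k"] by (intro mult_nonneg_nonneg) auto
      then show "norm (ln (n (Suc k)) * (card (heavy n q \<phi> k) / n k)) \<le> 2 * (mass (layer n q \<phi> k) / c)"
        using * by simp
    qed
    have H3: "(\<lambda>k. card (heavy n q \<phi> k) / n k) \<longlonglongrightarrow> 0"
    proof (rule tendsto_sandwich[OF _ _ tendsto_const])
      show "(\<lambda>k. mass (layer n q \<phi> k) / c / ln 2) \<longlonglongrightarrow> 0"
        using tendsto_divide[OF summable_LIMSEQ_zero[OF sml] tendsto_const[of "ln 2"]] by simp
      show "\<forall>\<^sub>F k in sequentially. card (heavy n q \<phi> k) / n k \<le> mass (layer n q \<phi> k) / c / ln 2"
      proof (intro always_eventually allI)
        fix k
        have "ln 2 * (card (heavy n q \<phi> k) / n k) \<le> ln (n k) * (card (heavy n q \<phi> k) / n k)"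
          using ln2[of k] by (intro mult_right_mono) auto
        then have "ln 2 * (card (heavy n q \<phi> k) / n k) \<le> mass (layer n q \<phi> k) / c" using ent[of k] by linarith
        then show "card (heavy n q \<phi> k) / n k \<le> mass (layer n q \<phi> k) / c / ln 2"
          by (subst pos_le_divide_eq) (auto simp: mult.commute)
      qed
    qed simp
    show ?thesis
      unfolding E_def using beurling_carleson_Inter_arcs[of n "heavy n q \<phi>", OF n1 H1 H2 H3] by simp
  qed
  then have E0: "emeasure \<nu> E = 0" and Ecl: "closed E" "E \<subseteq> unit_circle" 
    using KR by (auto simp: beurling_carleson_def)
  then have "E \<in> null_sets \<nu>" by (auto simp: null_sets_def sets_borel_circle)
  then have AE: "AE \<zeta> in \<nu>. \<zeta> \<notin> E" by (rule AE_not_in)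
  have w: "weight (residual n q \<phi> k)" for k by (rule weight_residual[OF \<phi> q0])
  have "(\<lambda>k. LINT \<zeta>|\<nu>. residual n q \<phi> k \<zeta>) \<longlonglongrightarrow> (LINT \<zeta>|\<nu>. 0)"
  proof (rule integral_dominated_convergence[where w="\<lambda>_. 1"])
    show "AE \<zeta> in \<nu>. (\<lambda>k. residual n q \<phi> k \<zeta>) \<longlonglongrightarrow> 0"
      using AE AE_space
    proof eventually_elim
      case (elim \<zeta>)
      then have \<zeta>: "\<zeta> \<in> unit_circle" by simp
      obtain k where k: "\<zeta> \<notin> (\<Union>i\<in>heavy n q \<phi> k. closed_arc (n k) i)" using elim by (auto simp: E_def)
      have "arc_index (n k) \<zeta> \<notin> heavy n q \<phi> k"
        using k in_arc_arc_index[of "n k" \<zeta>] arc_subset_closed_arc \<zeta> n1[of k] by fastforce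
      then have z: "residual n q \<phi> (Suc k) \<zeta> = 0" using residual_nonzero_imp_heavy \<zeta> n1 by blast
      have "residual n q \<phi> j \<zeta> = 0" if "Suc k \<le> j" for j
        using that z by (induction j rule: dec_induct) (auto simp: Let_def)
      then show ?case by (intro tendsto_eventually) (auto simp: eventually_sequentially)
    qed
    show "AE \<zeta> in \<nu>. norm (residual n q \<phi> k \<zeta>) \<le> 1" for k
      using weightD(2,3)[OF w[of k]] by (intro AE_I2) auto
  qed (use weightD(1)[OF w] in auto)
  then show ?thesis by (simp add: mass_def)
qed

end

section \<open>Approximate inverses of singular inner functions\<close>

text \<open>
  The terms double, so the sum is less than twice the last one.
\<close>

lemma sum_ln_double_powers_le:
  fixes y :: real and N :: nat
  assumes N: "2 \<le> N" and y: "1 \<le> y"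
  shows "(\<Sum>k<K. if real (N ^ (2 ^ k)) < y then ln (real (N ^ (2 ^ k))) else 0) \<le> 2 * ln y"
proof (induction K)
  case 0
  then show ?case using y by simp
next
  case (Suc K)
  show ?case
  proof (cases "real (N ^ (2 ^ K)) < y")
    case True
    have lnN: "0 \<le> ln (real N)" using N by simp
    have ln: "ln (real (N ^ (2 ^ k))) = 2 ^ k * ln N" for k using N by (simp add: ln_realpow)
    have "(\<Sum>k<Suc K. if real (N ^ (2 ^ k)) < y then ln (real (N ^ (2 ^ k))) else 0) \<le> (\<Sum>k<Suc K. 2 ^ k * ln N)"
      by (intro sum_mono) (use lnN ln in auto)
    also have "\<dots> = (2 ^ Suc K - 1) * ln N"
      unfolding sum_distrib_right[symmetric] using geometric_sum[of "2::real" "Suc K"] by simp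
    also have "\<dots> \<le> 2 * (2 ^ K * ln N)" using lnN by (simp add: algebra_simps)
    also have "\<dots> = 2 * ln (real (N ^ (2 ^ K)))" by (simp only: ln)
    also have "\<dots> \<le> 2 * ln y" using True N y by (simp del: of_nat_power)
    finally show ?thesis .
  qed (use Suc in simp)
qed

lemma norm_exp_minus_1_le:
  fixes w :: complex
  assumes "norm w \<le> 1"
  shows "norm (exp w - 1) \<le> 3 * norm w"
proof -
  have "norm (exp w - (\<Sum>k\<le>0. w ^ k / fact k)) \<le> exp \<bar>Re w\<bar> * norm w ^ Suc 0 / fact 0"
    by (rule Taylor_exp)
  then have "norm (exp w - 1) \<le> exp \<bar>Re w\<bar> * norm w" by simp
  also have "exp \<bar>Re w\<bar> \<le> exp 1" using abs_Re_le_cmod[of w] assms by simp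
  also have "exp 1 \<le> (3::real)" using exp_le .
  finally show ?thesis by (simp add: mult_right_mono)
qed

text \<open>
  \<open>|\<zeta> - r z| \<ge> 1 - r |z| \<ge> (1 - r) |z| = |z - r z|\<close>.
\<close>

lemma norm_scaled_diff_ge:
  fixes \<zeta> z :: complex
  assumes "norm \<zeta> = 1" "norm z \<le> 1" "0 \<le> r" "r \<le> 1"
  shows "norm (\<zeta> - z) / 2 \<le> norm (\<zeta> - of_real r * z)"
proof -
  have "of_real r * z - z = of_real (r - 1) * z" by (simp add: algebra_simps)
  then have 1: "norm (of_real r * z - z) = (1 - r) * norm z" using assms by (simp add: norm_mult del: of_real_diff)
  have "norm (\<zeta> - z) \<le> norm (\<zeta> - of_real r * z) + (1 - r) * norm z"
    using norm_triangle_ineq[of "\<zeta> - of_real r * z" "of_real r * z - z"] 1 by simp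
  also have "(1 - r) * norm z \<le> (1 - r) * 1" using assms by (intro mult_left_mono) auto
  also have "(1 - r) * 1 \<le> 1 - r * norm z" using assms by (simp add: mult_left_le)
  also have "\<dots> \<le> norm (\<zeta> - of_real r * z)"
    using norm_triangle_ineq2[of \<zeta> "of_real r * z"] assms by (simp add: norm_mult)
  finally show ?thesis by simp
qed

context finite_circle_measure
begin

lemma separated_mono:
  "separated \<phi> d z \<Longrightarrow> e \<le> d \<Longrightarrow> (\<And>\<zeta>. \<zeta> \<in> unit_circle \<Longrightarrow> \<psi> \<zeta> \<noteq> 0 \<Longrightarrow> \<phi> \<zeta> \<noteq> 0) \<Longrightarrow> separated \<psi> e z"
  unfolding separated_def by (meson order_trans)

lemma herglotz_dilation_bound:
  assumes \<psi>: "weight \<psi>" and z: "norm z \<le> 1" "0 < d" "separated \<psi> d z" and r: "0 \<le> r" "r \<le> 1"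
  shows "norm (herglotz \<psi> z - herglotz \<psi> (of_real r * z)) \<le> 4 * (1 - r) / d\<^sup>2 * mass \<psi>"
proof -
  have "z - of_real r * z = of_real (1 - r) * z" by (simp add: algebra_simps)
  then have n: "norm (z - of_real r * z) \<le> 1 - r" using r z by (simp add: norm_mult mult_left_le del: of_real_diff)
  have s: "separated \<psi> (d / 2) (of_real r * z)"
    unfolding separated_def
  proof (intro ballI impI)
    fix \<zeta> assume \<zeta>: "\<zeta> \<in> unit_circle" "\<psi> \<zeta> \<noteq> 0"
    have "d / 2 \<le> norm (\<zeta> - z) / 2" using z(3) \<zeta> by (auto simp: separated_def)
    also have "\<dots> \<le> norm (\<zeta> - of_real r * z)" by (rule norm_scaled_diff_ge) (use \<zeta> z r in auto)
    finally show "d / 2 \<le> norm (\<zeta> - of_real r * z)" .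
  qed
  have nr: "norm (of_real r * z) \<le> 1" using r z by (simp add: norm_mult mult_le_one)
  have "norm (herglotz \<psi> z - herglotz \<psi> (of_real r * z)) \<le> 2 * norm (z - of_real r * z) / (d * (d / 2)) * mass \<psi>"
    by (rule herglotz_diff_bound[OF \<psi> z nr _ s]) (use z in simp)
  also have "\<dots> \<le> 2 * (1 - r) / (d * (d / 2)) * mass \<psi>"
    using n z mass_nonneg[OF \<psi>] by (intro mult_right_mono divide_right_mono mult_left_mono) auto
  also have "\<dots> = 4 * (1 - r) / d\<^sup>2 * mass \<psi>" by (simp add: power2_eq_square)
  finally show ?thesis .
qed

text \<open>
  Here \<open>exp (- herglotz \<phi> z)\<close> is the inner function that is to be inverted, and
  \<open>exp (G z)\<close> is the reciprocal of the product of the dilated inner functions of the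
  first \<open>K\<close> layers. The logarithm of the product of the two is \<open>- (\<Sum>k<K. D
  k z)\<close> minus the Herglotz integral of the residual, where \<open>D k z\<close> compares
  the Herglotz integral of layer \<open>k\<close> at \<open>z\<close> and at \<open>r\<^sub>k
  z\<close>.

  There are two bounds for \<open>D k z\<close>. Close points give \<open>|D k z| \<le> 4
  m\<^sub>k / (n\<^sub>k d\<^sup>2)\<close>, where \<open>m\<^sub>k\<close> is the mass of the
  layer and \<open>d\<close> the distance to it; a large \<open>N\<close> makes the sum small. The
  arc masses of the layer give \<open>- Re (D k z) \<le> 64 c ln n\<^sub>k\<close>, which is used
  for \<open>n\<^sub>k < 1 / (1 - |z|)\<^sup>2\<close> and does not depend on \<open>N\<close>
  after summation.
\<close>

theorem korenblum_roberts_approximation: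
  assumes KR: "\<And>E. beurling_carleson E \<Longrightarrow> emeasure circle_measure E = 0 \<Longrightarrow> emeasure \<nu> E = 0"
    and \<phi>: "weight \<phi>" and \<epsilon>: "0 < \<epsilon>" and \<eta>: "0 < \<eta>"
  obtains G R where "1 < R" "G holomorphic_on ball 0 R"
    "\<And>z. norm z < 1 \<Longrightarrow> norm (exp (G z - herglotz \<phi> z)) 
        \<le> exp (4 * measure \<nu> unit_circle) * (1 - norm z) powr - \<epsilon>"
    "\<And>z. norm z \<le> 1 \<Longrightarrow> separated \<phi> \<eta> z \<Longrightarrow> norm (exp (G z - herglotz \<phi> z) - 1) \<le> \<eta>"
proof -
  define M where "M = measure \<nu> unit_circle"
  \<comment> \<open>A factor 64 is lost in \<open>Re_herglotz_le_of_arc_mass\<close> and a factor 4 in the sum of the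
    \<open>ln (n k)\<close> over \<open>n k < 1 / (1 - |z|)\<^sup>2\<close>.\<close>
  define c where "c = \<epsilon> / 256"
  have c: "0 < c" using \<epsilon> by (simp add: c_def)
  define \<delta> where "\<delta> = min 1 (\<eta> / 3)"
  have \<delta>: "0 < \<delta>" "\<delta> \<le> 1" "3 * \<delta> \<le> \<eta>" using \<eta> by (auto simp: \<delta>_def min_def)
  have M0: "0 \<le> M" by (simp add: M_def)
  obtain N0 :: nat where N0: "8 * M / (\<delta> * \<eta>\<^sup>2) \<le> N0" using real_arch_simple by blast
  define N where "N = max 2 N0"
  have N2: "2 \<le> N" by (simp add: N_def)
  have "8 * M / (\<delta> * \<eta>\<^sup>2) \<le> N" using N0 by (simp add: N_def)
  then have NM: "4 * M / (N * \<eta>\<^sup>2) \<le> \<delta> / 2" using \<delta> \<eta> N2 by (simp add: field_simps)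
  define n where "n = (\<lambda>k::nat. N ^ (2 ^ k))"
  define q where "q = (\<lambda>k. c * ln (n k) / n k)"
  have nN: "N \<le> n k" for k
  proof -
    have "N ^ 1 \<le> N ^ (2 ^ k)" using N2 by (intro power_increasing) auto
    then show ?thesis by (simp add: n_def)
  qed
  have n2: "2 \<le> n k" for k using nN[of k] N2 by linarith
  have n1: "1 \<le> n k" "0 < n k" for k using n2[of k] by linarith+
  have nmono: "n k \<le> n l" if "k \<le> l" for k l
    unfolding n_def using N2 that by (intro power_increasing) auto
  have lnpos: "0 < ln (real (n k))" for k using n2[of k] by simp
  have q0: "0 < q k" for k using lnpos[of k] n1[of k] c by (simp add: q_def)
  have "(\<lambda>k. mass (residual n q \<phi> k)) \<longlonglongrightarrow> 0"
    unfolding q_def n_def by (rule korenblum_roberts_residual_tendsto_0[OF KR \<phi> N2 c])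
  then have "\<forall>\<^sub>F k in sequentially. mass (residual n q \<phi> k) < \<delta> * \<eta> / 4"
    by (rule order_tendstoD) (use \<delta> \<eta> in auto)
  then obtain K where K: "mass (residual n q \<phi> K) < \<delta> * \<eta> / 4"
    by (auto simp: eventually_sequentially)
  let ?\<psi> = "layer n q \<phi>" and ?R = "residual n q \<phi>"
  have wR: "weight (?R k)" and w\<psi>: "weight (?\<psi> k)" for k
    by (rule weight_residual[OF \<phi> q0], rule weight_layer[OF \<phi> q0])
  define r where "r k = 1 - 1 / real (n k)" for k
  have r: "0 \<le> r k" "r k \<le> 1" "r k < 1" "1 / 2 \<le> r k" for k
    using n2[of k] by (auto simp: r_def field_simps)
  define G where "G z = (\<Sum>k<K. herglotz (?\<psi> k) (of_real (r k) * z))" for z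
  define D where "D k z = herglotz (?\<psi> k) z - herglotz (?\<psi> k) (of_real (r k) * z)" for k z
  have nz_res: "?R k \<zeta> \<noteq> 0 \<Longrightarrow> \<phi> \<zeta> \<noteq> 0" for k \<zeta>
    by (induction k) (auto simp: Let_def split: if_splits)
  have nz_lay: "?\<psi> k \<zeta> \<noteq> 0 \<Longrightarrow> \<phi> \<zeta> \<noteq> 0" for k \<zeta>
    unfolding layer_def using nz_res[of k \<zeta>] nz_res[of "Suc k" \<zeta>] by (metis diff_self)
  have sepR: "separated (?R k) d z" if "separated \<phi> d z" for k d z
    using that nz_res by (rule separated_mono[OF _ order_refl])
  have sepL: "separated (?\<psi> k) d z" if "separated \<phi> d z" for k d z
    using that nz_lay by (rule separated_mono[OF _ order_refl])
  have split: "G z - herglotz \<phi> z = - (\<Sum>k<K. D k z) - herglotz (?R K) z"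
    if z: "norm z \<le> 1" "0 < d" "separated \<phi> d z" for z d
  proof -
    have "(\<Sum>k<K. herglotz (?\<psi> k) z) = (\<Sum>k<K. herglotz (?R k) z - herglotz (?R (Suc k)) z)"
      unfolding layer_def[abs_def]
      by (intro sum.cong refl herglotz_diff[OF wR wR z(1,2) sepR sepR] z)
    also have "\<dots> = herglotz (?R 0) z - herglotz (?R K) z" by (rule sum_lessThan_telescope')
    finally have "herglotz \<phi> z = (\<Sum>k<K. herglotz (?\<psi> k) z) + herglotz (?R K) z" by simp
    then show ?thesis by (simp add: G_def D_def sum_subtractf)
  qed
  have Dbd: "norm (D k z) \<le> 4 / (n k * d\<^sup>2) * mass (?\<psi> k)"
    if z: "norm z \<le> 1" "0 < d" "separated \<phi> d z" for z k and d :: real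
    using herglotz_dilation_bound[OF w\<psi> z(1,2) sepL[OF z(3)] r(1,2), of k k] by (simp add: D_def r_def)
  have summass: "(\<Sum>k<K. mass (?\<psi> k)) \<le> M"
    unfolding sum_mass_layer[OF \<phi> q0] M_def using mass_le[OF \<phi>] mass_nonneg[OF wR, of K] by linarith
  have mass0: "0 \<le> mass (?\<psi> k)" for k by (rule mass_nonneg[OF w\<psi>])
  show thesis
  proof (rule that)
    show "1 < 1 / r K" using r[of K] by simp
    have hol: "(\<lambda>z. herglotz (?\<psi> k) (of_real (r k) * z)) holomorphic_on ball 0 (1 / r K)"
      if "k \<in> {..<K}" for k
    proof -
      from that have "r k \<le> r K" using nmono[of k K] n1[of k] n1[of K] by (simp add: r_def field_simps)
      have "herglotz (?\<psi> k) \<circ> (\<lambda>z. of_real (r k) * z) holomorphic_on ball 0 (1 / r K)"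
      proof (rule holomorphic_on_compose_gen[OF _ herglotz_holomorphic[OF w\<psi>]])
        show "(\<lambda>z::complex. of_real (r k) * z) ` ball 0 (1 / r K) \<subseteq> ball 0 1"
        proof (rule image_subsetI)
          fix z :: complex assume "z \<in> ball 0 (1 / r K)"
          then have "norm z < 1 / r K" by simp
          then have "r K * norm z < 1" using r(4)[of K] by (simp add: field_simps)
          moreover have "r k * norm z \<le> r K * norm z" using \<open>r k \<le> r K\<close> by (intro mult_right_mono) auto
          ultimately show "of_real (r k) * z \<in> ball 0 1" using r[of k] by (simp add: norm_mult)
        qed
      qed (intro holomorphic_intros)
      then show ?thesis by (simp add: comp_def)
    qed
    show "G holomorphic_on ball 0 (1 / r K)"
      unfolding G_def[abs_def] by (rule holomorphic_on_sum) (rule hol)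
  next
    fix z :: complex assume z: "norm z \<le> 1" "separated \<phi> \<eta> z"
    have "norm (G z - herglotz \<phi> z) \<le> (\<Sum>k<K. norm (D k z)) + norm (herglotz (?R K) z)"
      unfolding split[OF z(1) \<eta> z(2)]
      by (rule order_trans[OF norm_triangle_ineq4]) (simp add: norm_sum)
    also have "\<dots> \<le> (\<Sum>k<K. 4 / (N * \<eta>\<^sup>2) * mass (?\<psi> k)) + 2 / \<eta> * mass (?R K)"
    proof (intro add_mono sum_mono)
      fix k
      have "norm (D k z) \<le> 4 / (n k * \<eta>\<^sup>2) * mass (?\<psi> k)" by (rule Dbd[OF z(1) \<eta> z(2)])
      also have "\<dots> \<le> 4 / (N * \<eta>\<^sup>2) * mass (?\<psi> k)"
        using nN[of k] N2 \<eta> mass0 by (intro mult_right_mono divide_left_mono) auto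
      finally show "norm (D k z) \<le> 4 / (N * \<eta>\<^sup>2) * mass (?\<psi> k)" .
    qed (rule herglotz_bound(2)[OF wR z(1) \<eta> sepR[OF z(2)]])
    also have "(\<Sum>k<K. 4 / (N * \<eta>\<^sup>2) * mass (?\<psi> k)) \<le> 4 / (N * \<eta>\<^sup>2) * M"
      unfolding sum_distrib_left[symmetric] using summass by (intro mult_left_mono) auto
    also have "\<dots> \<le> \<delta> / 2" using NM by simp
    also have "2 / \<eta> * mass (?R K) \<le> \<delta> / 2" using K \<eta> by (simp add: field_simps)
    finally have "norm (G z - herglotz \<phi> z) \<le> \<delta>" by simp
    then show "norm (exp (G z - herglotz \<phi> z) - 1) \<le> \<eta>"
      using norm_exp_minus_1_le[of "G z - herglotz \<phi> z"] \<delta> by linarith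
  next
    fix z :: complex assume z: "norm z < 1"
    define s where "s = 1 - norm z"
    have s: "0 < s" "s \<le> 1" using z by (auto simp: s_def)
    have sep: "separated \<phi> s z" unfolding s_def by (rule separated_disk[OF z])
    have z1: "norm z \<le> 1" using z by simp
    define y where "y = 1 / s\<^sup>2"
    have y: "1 \<le> y" using s by (simp add: y_def power_le_one)
    have "Re (G z - herglotz \<phi> z) = (\<Sum>k<K. - Re (D k z)) - Re (herglotz (?R K) z)"
      unfolding split[OF z1 s(1) sep] by (simp add: sum_negf)
    also have "\<dots> \<le> (\<Sum>k<K. - Re (D k z))"
      using Re_herglotz_nonneg[OF wR z1 s(1) sepR[OF sep]] by simp
    also have "\<dots> \<le> (\<Sum>k<K. 64 * c * (if real (N ^ (2 ^ k)) < y then ln (real (N ^ (2 ^ k))) else 0) + 4 * mass (?\<psi> k))"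
    proof (rule sum_mono)
      fix k
      show "- Re (D k z) \<le> 64 * c * (if real (N ^ (2 ^ k)) < y then ln (real (N ^ (2 ^ k))) else 0) + 4 * mass (?\<psi> k)"
      proof (cases "real (n k) < y")
        case True
        have nrz: "norm (of_real (r k) * z) \<le> 1 - 1 / n k"
        proof -
          have "norm (of_real (r k) * z) = r k * norm z" using r(1)[of k] by (simp add: norm_mult)
          also have "\<dots> \<le> r k" using r(1)[of k] z1 by (simp add: mult_left_le)
          finally show ?thesis by (simp add: r_def)
        qed
        have "- Re (D k z) \<le> Re (herglotz (?\<psi> k) (of_real (r k) * z))"
          using Re_herglotz_nonneg[OF w\<psi> z1 s(1) sepL[OF sep]] by (simp add: D_def)
        also have "\<dots> \<le> 64 * (n k * q k)"
        proof (rule Re_herglotz_le_of_arc_mass[OF w\<psi> n1(1) _ nrz])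
          fix i assume "i < n k"
          from arc_mass_layer[of \<phi> q i n k, OF \<phi> q0 this]
          show "arc_mass (?\<psi> k) (n k) i \<le> q k" by simp
        qed
        also have "\<dots> = 64 * c * ln (n k)" using n1(2)[of k] by (simp add: q_def)
        finally show ?thesis using True mass0[of k] by (simp add: n_def)
      next
        case False
        then have "1 \<le> n k * s\<^sup>2" using s by (simp add: y_def field_simps not_less)
        then have "4 / (n k * s\<^sup>2) * mass (?\<psi> k) \<le> 4 * mass (?\<psi> k)"
          using mass0[of k] by (intro mult_right_mono) (auto simp: divide_le_eq)
        then have "- Re (D k z) \<le> 4 * mass (?\<psi> k)"
          using Dbd[OF z1 s(1) sep, of k] abs_Re_le_cmod[of "D k z"] by linarith
        then show ?thesis using False by (simp add: n_def)
      qed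
    qed
    also have "\<dots> = 64 * c * (\<Sum>k<K. if real (N ^ (2 ^ k)) < y then ln (real (N ^ (2 ^ k))) else 0) + 4 * (\<Sum>k<K. mass (?\<psi> k))"
      by (simp add: sum.distrib sum_distrib_left)
    also have "\<dots> \<le> 64 * c * (2 * ln y) + 4 * M"
      using sum_ln_double_powers_le[OF N2 y, of K] summass c by (intro add_mono mult_left_mono) auto
    also have "ln y = - 2 * ln s" using s by (simp add: y_def ln_div ln_realpow)
    also have "64 * c * (2 * (- 2 * ln s)) + 4 * M = 4 * M + - \<epsilon> * ln s" by (simp add: c_def)
    finally have "Re (G z - herglotz \<phi> z) \<le> 4 * M + - \<epsilon> * ln s" .
    then have "norm (exp (G z - herglotz \<phi> z)) \<le> exp (4 * M + - \<epsilon> * ln s)" by (simp add: norm_exp_eq_Re)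
    also have "\<dots> = exp (4 * M) * s powr - \<epsilon>" using s by (simp add: exp_add powr_def exp_diff exp_minus divide_inverse)
    finally show "norm (exp (G z - herglotz \<phi> z)) \<le> exp (4 * measure \<nu> unit_circle) * (1 - norm z) powr - \<epsilon>"
      by (simp add: M_def s_def)
  qed
qed

end

section \<open>Radial maximal functions of singular inner functions\<close>

context finite_circle_measure
begin

lemma norm_exp_herglotz_le:
  assumes "weight \<phi>" "norm z < 1"
  shows "norm (exp (- herglotz \<phi> z)) \<le> 1"
  using Re_herglotz_nonneg[OF assms(1) _ _ separated_disk[OF assms(2)]] assms(2) by (simp add: norm_exp_eq_Re)

lemma norm_one_minus_exp_herglotz:
  assumes "weight \<phi>" "norm z < 1"
  shows "(norm (1 - exp (- herglotz \<phi> z)))\<^sup>2 \<le> 2 * Re (1 - exp (- herglotz \<phi> z))"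
proof -
  let ?S = "exp (- herglotz \<phi> z)"
  have "(norm (1 - S))\<^sup>2 = 1 - 2 * Re S + (norm S)\<^sup>2" for S
    by (simp only: cmod_power2) (simp add: power2_eq_square algebra_simps)
  moreover have "(norm ?S)\<^sup>2 \<le> 1" using norm_exp_herglotz_le[OF assms] by (simp add: power_le_one)
  moreover have "Re (1 - ?S) = 1 - Re ?S" by (simp only: minus_complex.sel one_complex.sel)
  ultimately show ?thesis by (smt (verit, ccfv_threshold))
qed

text \<open>
  The function \<open>u\<close> is nonnegative and harmonic in the open disk, so inside each
  circle of radius \<open>\<rho> < 1\<close> it is the Poisson integral of its values on that
  circle, whose mean is \<open>u 0 = 1 - exp (- mass \<phi>) \<le> mass \<phi>\<close>. The
  weak-type inequality gives the bound for radii below \<open>\<rho>\<close>, and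
  \<open>\<rho>\<close> tends to 1.
\<close>

lemma emeasure_radial_maximal_le:
  assumes \<phi>: "weight \<phi>" and lam: "0 < lam"
  defines "u \<equiv> \<lambda>z. Re (1 - exp (- herglotz \<phi> z))"
  defines "A \<equiv> {x \<in> unit_circle. \<exists>r. 0 \<le> r \<and> r < 1 \<and> lam < u (of_real r * x)}"
  shows "A \<in> sets circle_measure" "emeasure circle_measure A \<le> ennreal (640 * mass \<phi> / lam)"
proof -
  define B where "B \<rho> = {x \<in> unit_circle. \<exists>r. 0 \<le> r \<and> r < \<rho> \<and> lam < u (of_real r * x)}" for \<rho> :: real
  have hol: "herglotz \<phi> holomorphic_on ball 0 1" by (rule herglotz_holomorphic[OF \<phi>])
  have holS: "(\<lambda>z. 1 - exp (- herglotz \<phi> z)) holomorphic_on ball 0 1"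
    by (intro holomorphic_intros hol)
  have contu: "continuous_on (ball 0 1) u"
    unfolding u_def by (intro continuous_on_Re holomorphic_on_imp_continuous_on holS)
  have openW: "open {z \<in> ball 0 1. lam < u z}"
    using continuous_open_preimage[OF contu, of "{lam<..}"] by (auto simp: vimage_def Int_def)
  have B_sets: "B \<rho> \<in> sets circle_measure" if "\<rho> \<le> 1" for \<rho>
  proof -
    have "B \<rho> = unit_circle \<inter> (\<Union>r\<in>{0..<\<rho>}. (\<lambda>x. of_real r * x) -` {z \<in> ball 0 1. lam < u z})"
      using that by (auto simp: B_def norm_mult)
    moreover have "open (\<Union>r\<in>{0..<\<rho>}. (\<lambda>x::complex. of_real r * x) -` {z \<in> ball 0 1. lam < u z})"
      by (intro open_UN ballI open_vimage openW continuous_intros)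
    ultimately show ?thesis by (auto simp: sets_borel_circle)
  qed
  have unn: "0 \<le> u z" if "norm z < 1" for z
    unfolding u_def minus_complex.sel one_complex.sel
    using order_trans[OF complex_Re_le_cmod norm_exp_herglotz_le[OF \<phi> that]] by linarith
  have u0: "u 0 \<le> mass \<phi>"
    using exp_ge_add_one_self[of "- mass \<phi>"] by (simp add: u_def herglotz_0 exp_of_real flip: of_real_minus)
  have bound: "emeasure circle_measure (B \<rho>) \<le> ennreal (640 * mass \<phi> / lam)" if \<rho>: "0 < \<rho>" "\<rho> < 1" for \<rho>
  proof (rule poisson_maximal_weak_type)
    let ?f = "\<lambda>w. 1 - exp (- herglotz \<phi> (of_real \<rho> * w))"
    have maps: "norm (of_real \<rho> * w) < 1" if "norm w \<le> 1" for w :: complex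
    proof -
      have "\<rho> * norm w \<le> \<rho>" using \<rho> that by (intro mult_left_le) auto
      moreover have "norm (of_real \<rho> * w) = \<rho> * norm w" using \<rho> by (simp add: norm_mult)
      ultimately show ?thesis using \<rho> by linarith
    qed
    have holf: "?f holomorphic_on cball 0 1"
    proof -
      have "(\<lambda>z. 1 - exp (- herglotz \<phi> z)) \<circ> (\<lambda>w. of_real \<rho> * w) holomorphic_on cball 0 1"
        by (rule holomorphic_on_compose_gen[OF _ holS]) (use maps in \<open>auto intro!: holomorphic_intros\<close>)
      then show ?thesis by (simp add: comp_def)
    qed
    let ?u = "\<lambda>\<zeta>. u (of_real \<rho> * \<zeta>)"
    have cont: "continuous_on unit_circle ?u"
      by (rule continuous_on_compose2[OF contu]) (use maps in \<open>auto intro!: continuous_intros\<close>)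
    have mu: "?u \<in> borel_measurable circle_measure"
      using borel_measurable_continuous_on_restrict[OF cont] by (simp cong: measurable_cong_sets)
    then show mv: "(\<lambda>\<zeta>. ennreal (?u \<zeta>)) \<in> borel_measurable circle_measure" by measurable
    have pois: "(\<integral>\<^sup>+\<zeta>. ennreal (poisson_kernel z \<zeta>) * ennreal (?u \<zeta>) \<partial>circle_measure) = ennreal (u (of_real \<rho> * z))"
      if z: "norm z < 1" for z
    proof -
      have contP: "continuous_on unit_circle (\<lambda>\<zeta>. poisson_kernel z \<zeta> *\<^sub>R ?f \<zeta>)"
        unfolding poisson_kernel_def
        by (intro continuous_intros continuous_on_subset[OF holomorphic_on_imp_continuous_on[OF holf]])
           (use z in auto)
      note int = integral_circle_measure(1)[OF contP]
      have "(LINT \<zeta>|circle_measure. poisson_kernel z \<zeta> *\<^sub>R ?f \<zeta>) = ?f z"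
        by (rule poisson_formula[OF holf z])
      then have "Re (LINT \<zeta>|circle_measure. poisson_kernel z \<zeta> *\<^sub>R ?f \<zeta>) = u (of_real \<rho> * z)" by (simp add: u_def)
      then have eq: "(LINT \<zeta>|circle_measure. poisson_kernel z \<zeta> * ?u \<zeta>) = u (of_real \<rho> * z)"
        unfolding integral_Re[OF int, symmetric] by (simp add: u_def)
      have "integrable circle_measure (\<lambda>\<zeta>. poisson_kernel z \<zeta> * ?u \<zeta>)"
        using integrable_Re[OF int] by (simp add: u_def)
      then have "(\<integral>\<^sup>+\<zeta>. ennreal (poisson_kernel z \<zeta> * ?u \<zeta>) \<partial>circle_measure) = ennreal (u (of_real \<rho> * z))"
        unfolding eq[symmetric]
        by (rule nn_integral_eq_integral) (use poisson_kernel_nonneg unn maps z in \<open>auto intro!: mult_nonneg_nonneg\<close>)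
      moreover have "(\<integral>\<^sup>+\<zeta>. ennreal (poisson_kernel z \<zeta>) * ennreal (?u \<zeta>) \<partial>circle_measure)
          = (\<integral>\<^sup>+\<zeta>. ennreal (poisson_kernel z \<zeta> * ?u \<zeta>) \<partial>circle_measure)"
        by (intro nn_integral_cong ennreal_mult'[symmetric]) (use poisson_kernel_nonneg z in auto)
      ultimately show ?thesis by simp
    qed
    show "(\<integral>\<^sup>+\<zeta>. ennreal (?u \<zeta>) \<partial>circle_measure) \<le> ennreal (mass \<phi>)"
    proof -
      have "(\<integral>\<^sup>+\<zeta>. ennreal (?u \<zeta>) \<partial>circle_measure) = (\<integral>\<^sup>+\<zeta>. ennreal (poisson_kernel 0 \<zeta>) * ennreal (?u \<zeta>) \<partial>circle_measure)"
        by (intro nn_integral_cong) (simp add: poisson_kernel_def)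
      also have "\<dots> = ennreal (u 0)" using pois[of 0] by simp
      finally show ?thesis using u0 by (simp add: ennreal_leI)
    qed
    show "0 \<le> mass \<phi>" by (rule mass_nonneg[OF \<phi>])
    show "B \<rho> \<in> sets circle_measure" using B_sets \<rho> by simp
    fix x assume "x \<in> B \<rho>"
    then obtain r where r: "0 \<le> r" "r < \<rho>" "lam < u (of_real r * x)" and x: "norm x = 1"
      by (auto simp: B_def)
    have "of_real \<rho> * (of_real (r / \<rho>) * x) = of_real r * x" using \<rho> by simp
    moreover have "norm (of_real (r / \<rho>) * x) < 1"
      using r \<rho> x by (simp only: norm_mult norm_of_real) simp
    ultimately have "(\<integral>\<^sup>+\<zeta>. ennreal (poisson_kernel (of_real (r / \<rho>) * x) \<zeta>) * ennreal (?u \<zeta>) \<partial>circle_measure) 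
        = ennreal (u (of_real r * x))"
      using pois[of "of_real (r / \<rho>) * x"] by metis
    then show "\<exists>r. 0 \<le> r \<and> r < 1 \<and> ennreal lam < 
        (\<integral>\<^sup>+\<zeta>. ennreal (poisson_kernel (of_real r * x) \<zeta>) * ennreal (?u \<zeta>) \<partial>circle_measure)"
      using r \<rho> lam by (intro exI[of _ "r / \<rho>"]) (auto simp: ennreal_less_iff simp del: of_real_divide)
  qed (rule lam)
  define R where "R i = 1 - 1 / real (i + 2)" for i :: nat
  have R: "0 < R i" "R i < 1" for i by (auto simp: R_def field_simps)
  have R_mono: "R i \<le> R j" if "i \<le> j" for i j using that by (simp add: R_def field_simps)
  have AU: "A = (\<Union>i. B (R i))"
  proof (intro subset_antisym subsetI)
    fix x assume "x \<in> A"
    then obtain r where r: "0 \<le> r" "r < 1" "lam < u (of_real r * x)" "x \<in> unit_circle" by (auto simp: A_def)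
    obtain i where i: "inverse (real (Suc i)) < 1 - r" using reals_Archimedean[of "1 - r"] r by auto
    have "1 / real (i + 2) \<le> inverse (real (Suc i))" by (simp add: field_simps)
    then have "r < R i" using i by (simp add: R_def)
    then show "x \<in> (\<Union>i. B (R i))" using r by (auto simp: B_def)
  next
    fix x assume "x \<in> (\<Union>i. B (R i))"
    then show "x \<in> A" using R(2) by (auto simp: A_def B_def intro: less_trans)
  qed
  have Bs: "range (\<lambda>i. B (R i)) \<subseteq> sets circle_measure" using B_sets R by (auto simp: less_imp_le)
  then show "A \<in> sets circle_measure" unfolding AU by blast
  have "incseq (\<lambda>i. B (R i))"
    unfolding B_def by (rule incseq_SucI) (use R_mono[OF le_SucI[OF order_refl]] less_le_trans in blast)
  then have "emeasure circle_measure A = (SUP i. emeasure circle_measure (B (R i)))"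
    unfolding AU by (rule SUP_emeasure_incseq[OF Bs, symmetric])
  also have "\<dots> \<le> ennreal (640 * mass \<phi> / lam)" by (intro SUP_least bound R)
  finally show "emeasure circle_measure A \<le> ennreal (640 * mass \<phi> / lam)" .
qed

text \<open>
  Masses \<open>4\<^bsup>-j\<^esup>\<close> against thresholds \<open>2\<^bsup>-j\<^esup>\<close>
  give exceptional sets of measure \<open>O(2\<^bsup>-j\<^esup>)\<close>, to which the
  Borel-Cantelli lemma applies.
\<close>

lemma AE_radial_maximal_small:
  assumes \<phi>: "\<And>j. weight (\<phi> j)" and m: "\<And>j. mass (\<phi> j) \<le> (1/4) ^ j"
  shows "AE x in circle_measure. \<forall>\<^sub>F j in sequentially. \<forall>r. 0 \<le> r \<and> r < 1 \<longrightarrow>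
           norm (1 - exp (- herglotz (\<phi> j) (of_real r * x))) \<le> sqrt (2 * (1/2) ^ j)"
proof -
  define A where "A j = {x \<in> unit_circle. \<exists>r. 0 \<le> r \<and> r < 1 \<and>
      (1/2) ^ j < Re (1 - exp (- herglotz (\<phi> j) (of_real r * x)))}" for j
  have A_sets: "A j \<in> sets circle_measure" 
    and A_le: "emeasure circle_measure (A j) \<le> ennreal (640 * mass (\<phi> j) / (1/2) ^ j)" for j
    unfolding A_def by (rule emeasure_radial_maximal_le[OF \<phi>]; simp)+
  have A_le': "measure circle_measure (A j) \<le> 640 * (1/2) ^ j" for j
  proof -
    have "measure circle_measure (A j) \<le> 640 * mass (\<phi> j) / (1/2) ^ j"
      using A_le[of j] mass_nonneg[OF \<phi>, of j] by (simp add: circle.emeasure_eq_measure)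
    also have "\<dots> \<le> 640 * (1/4) ^ j / (1/2) ^ j"
      using m[of j] by (intro divide_right_mono mult_left_mono) auto
    also have "\<dots> = 640 * ((1/4) / (1/2)) ^ j" by (simp only: power_divide times_divide_eq_right)
    finally show ?thesis by simp
  qed
  have "AE x in circle_measure. \<forall>\<^sub>F j in sequentially. x \<in> space circle_measure - A j"
  proof (rule borel_cantelli_AE1[OF A_sets])
    show "emeasure circle_measure (A j) < \<infinity>" for j by (simp add: circle.emeasure_eq_measure)
    show "summable (\<lambda>j. measure circle_measure (A j))"
      by (rule summable_comparison_test'[of "\<lambda>j. 640 * (1/2) ^ j" 0])
         (use A_le' in \<open>auto intro!: summable_mult summable_geometric\<close>)
  qed
  then show ?thesis
  proof eventually_elim
    case (elim x)
    then show ?case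
    proof eventually_elim
      case (elim j)
      show ?case
      proof (intro allI impI)
        fix r :: real assume r: "0 \<le> r \<and> r < 1"
        let ?w = "1 - exp (- herglotz (\<phi> j) (of_real r * x))"
        have "Re ?w \<le> (1/2) ^ j" using elim r by (force simp: A_def not_less)
        moreover have "(norm ?w)\<^sup>2 \<le> 2 * Re ?w"
          by (rule norm_one_minus_exp_herglotz[OF \<phi>]) (use r elim in \<open>auto simp: norm_mult\<close>)
        ultimately have "(norm ?w)\<^sup>2 \<le> 2 * (1/2) ^ j" by linarith
        then show "norm ?w \<le> sqrt (2 * (1/2) ^ j)" by (rule real_le_rsqrt)
      qed
    qed
  qed
qed

end

section \<open>Approximate inverses near and away from the support\<close>

context finite_circle_measure
begin

lemma singular_inner_herglotz: "singular_inner \<nu> z = exp (- herglotz (\<lambda>_. 1) z)"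
  by (simp add: singular_inner_def herglotz_def)

text \<open>
  The weight is the indicator function of the points at distance at least \<open>d\<close> from
  \<open>F\<close>. The complements of these sets decrease to \<open>F\<close>, which is a null
  set.
\<close>

lemma exists_separating_weight:
  assumes F: "closed F" "emeasure \<nu> (F \<inter> unit_circle) = 0" and e: "0 < e" "0 < e'"
  obtains d \<phi> where "0 < d" "d \<le> e" "weight \<phi>" "weight (\<lambda>\<zeta>. 1 - \<phi> \<zeta>)"
    "mass (\<lambda>\<zeta>. 1 - \<phi> \<zeta>) \<le> e'" "\<And>x. x \<in> F \<Longrightarrow> separated \<phi> d x"
proof -
  define W where "W d = {\<zeta>. \<forall>x\<in>F. d \<le> dist \<zeta> x}" for d :: real
  have clW: "closed (W d)" for d
  proof -
    have "W d = (\<Inter>x\<in>F. {\<zeta>. d \<le> dist \<zeta> x})" by (auto simp: W_def)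
    then show ?thesis by (auto intro!: closed_INT closed_Collect_le continuous_intros)
  qed
  have W_anti: "W d \<subseteq> W d'" if "d' \<le> d" for d d' using that by (force simp: W_def)
  define V where "V n = unit_circle - W (e / real (Suc n))" for n :: nat
  have V_sets: "V n \<in> sets \<nu>" for n using clW by (auto simp: V_def sets_borel_circle)
  have "decseq V" unfolding decseq_def V_def
    by (intro allI impI Diff_mono order_refl W_anti divide_left_mono) (use e in auto)
  have VF: "(\<Inter>n. V n) \<subseteq> F \<inter> unit_circle"
  proof
    fix \<zeta> assume \<zeta>: "\<zeta> \<in> (\<Inter>n. V n)"
    show "\<zeta> \<in> F \<inter> unit_circle"
    proof (rule ccontr)
      assume "\<zeta> \<notin> F \<inter> unit_circle"
      then have "\<zeta> \<in> - F" using \<zeta> by (auto simp: V_def)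
      then obtain b where b: "0 < b" "ball \<zeta> b \<subseteq> - F" using F(1) by (metis open_Compl open_contains_ball)
      obtain n :: nat where n: "inverse (real (Suc n)) < b / e" using reals_Archimedean[of "b / e"] b e by auto
      then have "e / real (Suc n) < b" using e by (simp add: field_simps)
      moreover have "b \<le> dist \<zeta> x" if "x \<in> F" for x using b(2) that by (force simp: not_less[symmetric])
      ultimately have "\<zeta> \<in> W (e / real (Suc n))" by (force simp: W_def)
      then show False using \<zeta> by (auto simp: V_def)
    qed
  qed
  have "(\<lambda>n. measure \<nu> (V n)) \<longlonglongrightarrow> measure \<nu> (\<Inter>n. V n)"
    by (rule finite_Lim_measure_decseq) (use V_sets \<open>decseq V\<close> in auto)
  moreover have "measure \<nu> (\<Inter>n. V n) = 0"
  proof -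
    have "F \<inter> unit_circle \<in> sets \<nu>" using F(1) by (auto simp: sets_borel_circle)
    then have "measure \<nu> (\<Inter>n. V n) \<le> measure \<nu> (F \<inter> unit_circle)"
      using VF by (intro finite_measure_mono) auto
    also have "\<dots> = 0" using F(2) by (simp add: measure_def)
    finally show ?thesis by (simp only: measure_le_0_iff)
  qed
  ultimately have "\<forall>\<^sub>F n in sequentially. measure \<nu> (V n) < e'"
    using e by (auto intro: order_tendstoD)
  then obtain n where n: "measure \<nu> (V n) < e'" by (auto simp: eventually_sequentially)
  define d where "d = e / real (Suc n)"
  define \<phi> where "\<phi> = (indicator (W d) :: complex \<Rightarrow> real)"
  have [measurable]: "W d \<in> sets borel" using clW by (rule borel_closed)
  have \<phi>m: "\<phi> \<in> borel_measurable \<nu>" unfolding \<phi>_def by (rule borel_imp_nu) measurable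
  show thesis
  proof (rule that)
    show "0 < d" using e by (simp add: d_def)
    show "d \<le> e" using e by (simp add: d_def divide_le_eq)
    have "0 \<le> \<phi> \<zeta>" "\<phi> \<zeta> \<le> 1" for \<zeta> by (auto simp: \<phi>_def indicator_def)
    moreover have "(\<lambda>\<zeta>. 1 - \<phi> \<zeta>) \<in> borel_measurable \<nu>" using \<phi>m by measurable
    ultimately show "weight \<phi>" "weight (\<lambda>\<zeta>. 1 - \<phi> \<zeta>)" using \<phi>m by (auto simp: weight_def)
    have "mass (\<lambda>\<zeta>. 1 - \<phi> \<zeta>) = (LINT \<zeta>|\<nu>. indicator (V n) \<zeta>)"
      unfolding mass_def
      by (rule Bochner_Integration.integral_cong) (auto simp: \<phi>_def V_def d_def indicator_def)
    also have "\<dots> = measure \<nu> (V n)" using V_sets[of n] by (simp add: V_def Int_absorb2)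
    finally show "mass (\<lambda>\<zeta>. 1 - \<phi> \<zeta>) \<le> e'" using n by simp
    show "separated \<phi> d x" if "x \<in> F" for x
      using that by (auto simp: separated_def \<phi>_def indicator_def W_def dist_norm)
  qed
qed

lemma herglotz_radial_tendsto:
  assumes \<phi>: "weight \<phi>" and x: "norm x = 1" "0 < d" "separated \<phi> d x"
  shows "((\<lambda>r. herglotz \<phi> (of_real r * x)) \<longlongrightarrow> herglotz \<phi> x) (at_left 1)"
proof -
  have "((\<lambda>r. herglotz \<phi> (of_real r * x) - herglotz \<phi> x) \<longlongrightarrow> 0) (at_left (1::real))"
  proof (rule tendsto_0_le[where K=1])
    show "((\<lambda>r. 4 * (1 - r) / d\<^sup>2 * mass \<phi>) \<longlongrightarrow> 0) (at_left (1::real))"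
      using x(2) by (auto intro!: tendsto_eq_intros)
    have "\<forall>\<^sub>F r in at_left (1::real). r \<in> {0<..<1}" by (rule eventually_at_left_real) simp
    then show "\<forall>\<^sub>F r in at_left 1. norm (herglotz \<phi> (of_real r * x) - herglotz \<phi> x) 
        \<le> norm (4 * (1 - r) / d\<^sup>2 * mass \<phi>) * 1"
    proof eventually_elim
      case (elim r)
      have "norm (herglotz \<phi> x - herglotz \<phi> (of_real r * x)) \<le> 4 * (1 - r) / d\<^sup>2 * mass \<phi>"
        by (rule herglotz_dilation_bound[OF \<phi> _ x(2,3)]) (use x elim in auto)
      then show ?case unfolding mult_1_right real_norm_def norm_minus_commute[of "herglotz \<phi> (of_real r * x)"]
        by (rule order_trans[OF _ abs_ge_self])
    qed
  qed
  then show ?thesis using Lim_null by blast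
qed

text \<open>
  Each \<open>g j\<close> inverts, up to a small error, the inner function of the part
  \<open>\<phi> j\<close> of \<open>\<nu>\<close> that is separated from \<open>F\<close>; the
  remaining part \<open>\<sigma> j\<close> has mass at most \<open>4\<^bsup>-j\<^esup>\<close>.

  Let \<open>p j x\<close> be the value at \<open>x \<in> F\<close> of the inner function of
  \<open>\<phi> j\<close>, which is analytic at \<open>x\<close> and unimodular there. For almost
  every \<open>x\<close> and large \<open>j\<close> the inner function of \<open>\<sigma>
  j\<close> is within \<open>e j\<close> of 1 on the whole radius, so the singular inner function
  of \<open>\<nu>\<close> is within about \<open>e j\<close> of \<open>p j x\<close> near the end
  of the radius. Therefore \<open>p j x\<close> is a Cauchy sequence and its limit is the radial
  limit.
\<close>

theorem singular_inner_approximate_inverses: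
  assumes KR: "\<And>E. beurling_carleson E \<Longrightarrow> emeasure circle_measure E = 0 \<Longrightarrow> emeasure \<nu> E = 0"
    and F: "closed F" "F \<subseteq> unit_circle" "emeasure \<nu> F = 0" and \<epsilon>: "0 < \<epsilon>"
  obtains g :: "nat \<Rightarrow> complex \<Rightarrow> complex" and C :: real where
    "\<And>j. \<exists>R>1. g j holomorphic_on ball 0 R"
    "\<And>j z. norm z < 1 \<Longrightarrow> norm (g j z * singular_inner \<nu> z) \<le> C * (1 - norm z) powr - \<epsilon>"
    "\<And>z. norm z < 1 \<Longrightarrow> (\<lambda>j. g j z * singular_inner \<nu> z) \<longlonglongrightarrow> 1"
    "\<And>j x. x \<in> F \<Longrightarrow> norm (g j x) \<le> 2"
    "AE x in circle_measure. x \<in> F \<longrightarrow> (\<exists>l. ((\<lambda>r. singular_inner \<nu> (of_real r * x)) \<longlongrightarrow> l) (at_left 1) \<and>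
        norm l \<le> 1 \<and> (\<lambda>j. g j x * l) \<longlonglongrightarrow> 1)"
proof -
  let ?S = "singular_inner \<nu>"
  have FF: "F \<inter> unit_circle = F" using F(2) by blast
  have "\<exists>d \<phi>. 0 < d \<and> d \<le> 1 / real (Suc j) \<and> weight \<phi> \<and> weight (\<lambda>\<zeta>. 1 - \<phi> \<zeta>) \<and>
      mass (\<lambda>\<zeta>. 1 - \<phi> \<zeta>) \<le> (1/4) ^ j \<and> (\<forall>x\<in>F. separated \<phi> d x)" for j
  proof (rule exists_separating_weight[of F "1 / real (Suc j)" "(1/4) ^ j"])
    show "emeasure \<nu> (F \<inter> unit_circle) = 0" using F(3) FF by simp
  qed (use F(1) in \<open>simp, simp, simp, blast\<close>)
  then obtain d \<phi> where d: "\<And>j. 0 < d j" "\<And>j. d j \<le> 1 / real (Suc j)" and w: "\<And>j. weight (\<phi> j)"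
    and w': "\<And>j. weight (\<lambda>\<zeta>. 1 - \<phi> j \<zeta>)" and m: "\<And>j. mass (\<lambda>\<zeta>. 1 - \<phi> j \<zeta>) \<le> (1/4) ^ j"
    and sep: "\<And>j x. x \<in> F \<Longrightarrow> separated (\<phi> j) (d j) x" by metis
  define \<sigma> where "\<sigma> j = (\<lambda>\<zeta>. 1 - \<phi> j \<zeta>)" for j
  have w\<sigma>: "weight (\<sigma> j)" and m\<sigma>: "mass (\<sigma> j) \<le> (1/4) ^ j" for j using w' m by (auto simp: \<sigma>_def)
  define C where "C = exp (4 * measure \<nu> unit_circle)"
  have "\<exists>G. (\<exists>R>1. G holomorphic_on ball 0 R) \<and>
    (\<forall>z. norm z < 1 \<longrightarrow> norm (exp (G z - herglotz (\<phi> j) z)) \<le> C * (1 - norm z) powr - \<epsilon>) \<and>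
    (\<forall>z. norm z \<le> 1 \<longrightarrow> separated (\<phi> j) (d j) z \<longrightarrow> norm (exp (G z - herglotz (\<phi> j) z) - 1) \<le> d j)" for j
    by (rule korenblum_roberts_approximation[OF KR w[of j] \<epsilon> d(1)[of j]]) (auto simp: C_def)
  then obtain G where hol: "\<And>j. \<exists>R>1. G j holomorphic_on ball 0 R"
    and grow: "\<And>j z. norm z < 1 \<Longrightarrow> norm (exp (G j z - herglotz (\<phi> j) z)) \<le> C * (1 - norm z) powr - \<epsilon>"
    and close: "\<And>j z. norm z \<le> 1 \<Longrightarrow> separated (\<phi> j) (d j) z \<Longrightarrow> norm (exp (G j z - herglotz (\<phi> j) z) - 1) \<le> d j"
    by metis
  have d0: "d \<longlonglongrightarrow> 0"
  proof (rule tendsto_sandwich[OF _ _ tendsto_const])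
    show "(\<lambda>j. 1 / real (Suc j)) \<longlonglongrightarrow> 0" using LIMSEQ_inverse_real_of_nat by (simp add: inverse_eq_divide)
  qed (use d in \<open>auto intro!: always_eventually less_imp_le\<close>)
  have S_split: "?S z = exp (- herglotz (\<phi> j) z) * exp (- herglotz (\<sigma> j) z)" if z: "norm z < 1" for j z
  proof -
    have "herglotz (\<sigma> j) z = herglotz (\<lambda>_. 1) z - herglotz (\<phi> j) z"
      unfolding \<sigma>_def
      by (rule herglotz_diff[OF weight_one w _ _ separated_disk[OF z] separated_disk[OF z]]) (use z in auto)
    then show ?thesis by (simp add: singular_inner_herglotz exp_add[symmetric])
  qed
  define g where "g j z = exp (G j z)" for j z
  have gS: "g j z * ?S z = exp (G j z - herglotz (\<phi> j) z) * exp (- herglotz (\<sigma> j) z)" if "norm z < 1" for j z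
    unfolding S_split[OF that, of j] g_def by (simp add: exp_diff exp_minus field_simps)
  define p where "p j x = exp (- herglotz (\<phi> j) x)" for j x
  have np: "norm (p j x) = 1" if "x \<in> F" for j x
    using Re_herglotz_circle[OF w _ d(1) sep[OF that]] that F(2) by (auto simp: p_def norm_exp_eq_Re)
  have gp: "norm (g j x * p j x - 1) \<le> d j" if "x \<in> F" for j x
    using close[OF _ sep[OF that]] that F(2) by (auto simp: p_def g_def exp_diff exp_minus divide_inverse)
  have g2: "norm (g j x) \<le> 2" if "x \<in> F" for j x
  proof -
    have "norm (g j x) = norm (g j x * p j x)" using np[OF that] by (simp add: norm_mult)
    also have "\<dots> \<le> norm (g j x * p j x - 1) + norm (1::complex)" by (metis diff_add_cancel norm_triangle_ineq)
    also have "\<dots> \<le> d j + 1" using gp[OF that, of j] by simp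
    also have "\<dots> \<le> 2" using d(2)[of j] order_trans[of "d j" "1 / real (Suc j)" 1] by (simp add: divide_le_eq)
    finally show ?thesis .
  qed
  show thesis
  proof (rule that)
    show "\<exists>R>1. g j holomorphic_on ball 0 R" for j
      using hol[of j] unfolding g_def[abs_def] by (auto intro!: holomorphic_intros)
    show "norm (g j z * ?S z) \<le> C * (1 - norm z) powr - \<epsilon>" if z: "norm z < 1" for j z
    proof -
      have "norm (g j z * ?S z) \<le> norm (exp (G j z - herglotz (\<phi> j) z)) * 1"
        unfolding gS[OF z] norm_mult by (intro mult_left_mono norm_exp_herglotz_le w\<sigma> z) auto
      then show ?thesis using grow[OF z, of j] by simp
    qed
    show "(\<lambda>j. g j z * ?S z) \<longlonglongrightarrow> 1" if z: "norm z < 1" for z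
    proof -
      have ev: "\<forall>\<^sub>F j in sequentially. d j < 1 - norm z" using d0 z by (intro order_tendstoD) auto
      have "(\<lambda>j. exp (G j z - herglotz (\<phi> j) z) - 1) \<longlonglongrightarrow> 0"
      proof (rule tendsto_0_le[OF d0, where K=1])
        show "\<forall>\<^sub>F j in sequentially. norm (exp (G j z - herglotz (\<phi> j) z) - 1) \<le> norm (d j) * 1"
          using ev
        proof eventually_elim
          case (elim j)
          have "separated (\<phi> j) (d j) z"
            by (rule separated_mono[OF separated_disk[OF z]]) (use elim in auto)
          then show ?case using close[of z j] z d(1)[of j] by simp
        qed
      qed
      then have 1: "(\<lambda>j. exp (G j z - herglotz (\<phi> j) z)) \<longlonglongrightarrow> 1" by (simp add: LIM_zero_iff)
      have "(\<lambda>j. herglotz (\<sigma> j) z) \<longlonglongrightarrow> 0"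
      proof (rule tendsto_0_le[where K="2 / (1 - norm z)"])
        show "(\<lambda>j. (1/4) ^ j :: real) \<longlonglongrightarrow> 0" by (rule LIMSEQ_realpow_zero) auto
        show "\<forall>\<^sub>F j in sequentially. norm (herglotz (\<sigma> j) z) \<le> norm ((1/4) ^ j :: real) * (2 / (1 - norm z))"
        proof (intro always_eventually allI)
          fix j
          have "norm (herglotz (\<sigma> j) z) \<le> 2 / (1 - norm z) * mass (\<sigma> j)"
            by (rule herglotz_bound(2)[OF w\<sigma> _ _ separated_disk[OF z]]) (use z in auto)
          also have "\<dots> \<le> 2 / (1 - norm z) * (1/4) ^ j" using z m\<sigma> by (intro mult_left_mono) auto
          finally show "norm (herglotz (\<sigma> j) z) \<le> norm ((1/4) ^ j :: real) * (2 / (1 - norm z))"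
            by (simp add: mult.commute norm_power)
        qed
      qed
      then have "(\<lambda>j. exp (- herglotz (\<sigma> j) z)) \<longlonglongrightarrow> exp (- 0)" by (intro tendsto_intros)
      from tendsto_mult[OF 1 this] show ?thesis unfolding gS[OF z] by simp
    qed
    show "norm (g j x) \<le> 2" if "x \<in> F" for j x by (rule g2[OF that])
    define e where "e j = sqrt (2 * (1/2) ^ j)" for j :: nat
    have e0: "e \<longlonglongrightarrow> 0"
    proof -
      have "(\<lambda>j. 2 * (1/2) ^ j :: real) \<longlonglongrightarrow> 2 * 0" by (intro tendsto_intros LIMSEQ_realpow_zero) auto
      then have "(\<lambda>j. sqrt (2 * (1/2) ^ j)) \<longlonglongrightarrow> sqrt (2 * 0)" by (intro tendsto_real_sqrt)
      then show ?thesis by (simp add: e_def[abs_def])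
    qed
    show "AE x in circle_measure. x \<in> F \<longrightarrow> (\<exists>l. ((\<lambda>r. ?S (of_real r * x)) \<longlongrightarrow> l) (at_left 1) \<and>
        norm l \<le> 1 \<and> (\<lambda>j. g j x * l) \<longlonglongrightarrow> 1)"
      using AE_radial_maximal_small[OF w\<sigma> m\<sigma>]
    proof eventually_elim
      case (elim x)
      show ?case
      proof
        assume x: "x \<in> F"
        then have nx: "norm x = 1" using F(2) by auto
        obtain J where J: "\<And>j r. J \<le> j \<Longrightarrow> 0 \<le> r \<Longrightarrow> r < 1 \<Longrightarrow>
            norm (1 - exp (- herglotz (\<sigma> j) (of_real r * x))) \<le> e j"
          using elim unfolding eventually_sequentially e_def by blast
        have ev01: "\<forall>\<^sub>F r in at_left (1::real). r \<in> {0<..<1}" by (rule eventually_at_left_real) simp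
        have near: "\<forall>\<^sub>F r in at_left 1. norm (?S (of_real r * x) - p j x) < e j + \<eta>"
          if j: "J \<le> j" and \<eta>: "0 < \<eta>" for j \<eta>
        proof -
          have "((\<lambda>r. exp (- herglotz (\<phi> j) (of_real r * x))) \<longlongrightarrow> p j x) (at_left 1)"
            unfolding p_def by (intro tendsto_intros herglotz_radial_tendsto[OF w nx d(1) sep[OF x]])
          then have "\<forall>\<^sub>F r in at_left 1. dist (exp (- herglotz (\<phi> j) (of_real r * x))) (p j x) < \<eta>"
            using \<eta> by (rule tendstoD)
          then show ?thesis using ev01
          proof eventually_elim
            case (elim r)
            let ?z = "of_real r * x"
            have nz: "norm ?z < 1" using elim nx by (simp add: norm_mult)
            let ?a = "exp (- herglotz (\<phi> j) ?z)" and ?b = "exp (- herglotz (\<sigma> j) ?z)"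
            have "?S ?z - p j x = ?a * (?b - 1) + (?a - p j x)"
              unfolding S_split[OF nz, of j] by (simp add: algebra_simps)
            then have "norm (?S ?z - p j x) \<le> norm ?a * norm (?b - 1) + norm (?a - p j x)"
              by (metis norm_mult norm_triangle_ineq)
            also have "norm ?a * norm (?b - 1) \<le> 1 * e j"
              by (intro mult_mono norm_exp_herglotz_le[OF w nz])
                 (use J[OF j, of r] elim in \<open>auto simp: norm_minus_commute\<close>)
            also have "norm (?a - p j x) < \<eta>" using elim by (simp add: dist_norm)
            finally show ?case by simp
          qed
        qed
        have pp: "norm (p j x - p k x) \<le> e j + e k" if "J \<le> j" "J \<le> k" for j k
        proof (rule field_le_epsilon)
          fix \<eta> :: real assume "0 < \<eta>"
          then have "\<forall>\<^sub>F r in at_left 1. norm (?S (of_real r * x) - p j x) < e j + \<eta> / 2 \<and>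
              norm (?S (of_real r * x) - p k x) < e k + \<eta> / 2"
            using near[OF that(1), of "\<eta> / 2"] near[OF that(2), of "\<eta> / 2"] by (intro eventually_conj) auto
          then obtain r where "norm (?S (of_real r * x) - p j x) < e j + \<eta> / 2" 
              "norm (?S (of_real r * x) - p k x) < e k + \<eta> / 2"
            using eventually_happens'[OF trivial_limit_at_left_real] by blast
          moreover have "norm (p j x - p k x) \<le> norm (?S (of_real r * x) - p j x) + norm (?S (of_real r * x) - p k x)"
            using norm_triangle_ineq4[of "?S (of_real r * x) - p k x" "?S (of_real r * x) - p j x"] by simp
          ultimately show "norm (p j x - p k x) \<le> e j + e k + \<eta>" by simp
        qed
        have "Cauchy (\<lambda>j. p j x)"
        proof (rule CauchyI)
          fix \<eta> :: real assume "0 < \<eta>"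
          then have "\<forall>\<^sub>F j in sequentially. e j < \<eta> / 2" using e0 by (intro order_tendstoD) auto
          then obtain M where M: "\<And>j. M \<le> j \<Longrightarrow> e j < \<eta> / 2" by (auto simp: eventually_sequentially)
          show "\<exists>M. \<forall>m\<ge>M. \<forall>n\<ge>M. norm (p m x - p n x) < \<eta>"
          proof (intro exI[of _ "max M J"] allI impI)
            fix m n assume "max M J \<le> m" "max M J \<le> n"
            then show "norm (p m x - p n x) < \<eta>" using pp[of m n] M[of m] M[of n] by simp
          qed
        qed
        then obtain l where l: "(\<lambda>j. p j x) \<longlonglongrightarrow> l" using Cauchy_convergent convergent_def by blast
        have pl: "norm (p j x - l) \<le> e j" if "J \<le> j" for j
        proof (rule LIMSEQ_le)
          show "(\<lambda>k. norm (p j x - p k x)) \<longlonglongrightarrow> norm (p j x - l)" by (intro tendsto_intros l)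
          show "(\<lambda>k. e j + e k) \<longlonglongrightarrow> e j" using tendsto_add[OF tendsto_const e0, of "e j"] by simp
          show "\<exists>N. \<forall>k\<ge>N. norm (p j x - p k x) \<le> e j + e k" using pp[OF that] by blast
        qed
        show "\<exists>l. ((\<lambda>r. ?S (of_real r * x)) \<longlongrightarrow> l) (at_left 1) \<and> norm l \<le> 1 \<and> (\<lambda>j. g j x * l) \<longlonglongrightarrow> 1"
        proof (intro exI[of _ l] conjI)
          show "((\<lambda>r. ?S (of_real r * x)) \<longlongrightarrow> l) (at_left 1)"
          proof (rule tendstoI)
            fix \<eta> :: real assume \<eta>: "0 < \<eta>"
            then have "\<forall>\<^sub>F j in sequentially. e j < \<eta> / 3 \<and> J \<le> j"
              using e0 by (intro eventually_conj order_tendstoD eventually_ge_at_top) auto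
            then obtain j where j: "e j < \<eta> / 3" "J \<le> j" by (auto simp: eventually_sequentially)
            have "0 < \<eta> / 3" using \<eta> by simp
            from near[OF j(2) this] show "\<forall>\<^sub>F r in at_left 1. dist (?S (of_real r * x)) l < \<eta>"
            proof eventually_elim
              case (elim r)
              have "norm (?S (of_real r * x) - l) \<le> norm (?S (of_real r * x) - p j x) + norm (p j x - l)"
                using norm_triangle_ineq[of "?S (of_real r * x) - p j x" "p j x - l"] by simp
              then show ?case using elim pl[OF j(2)] j by (simp add: dist_norm)
            qed
          qed
          have "(\<lambda>j. norm (p j x)) \<longlonglongrightarrow> norm l" by (intro tendsto_intros l)
          then show "norm l \<le> 1" unfolding np[OF x] by (simp add: LIMSEQ_const_iff)
          have "(\<lambda>j. g j x * l - 1) \<longlonglongrightarrow> 0"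
          proof (rule Lim_null_comparison)
            show "(\<lambda>j. d j + 2 * norm (l - p j x)) \<longlonglongrightarrow> 0"
            proof -
              have "(\<lambda>j. d j + 2 * norm (l - p j x)) \<longlonglongrightarrow> 0 + 2 * norm (l - l)"
                by (intro tendsto_intros d0 l)
              then show ?thesis by simp
            qed
            show "\<forall>\<^sub>F j in sequentially. norm (g j x * l - 1) \<le> d j + 2 * norm (l - p j x)"
            proof (intro always_eventually allI)
              fix j
              have "g j x * l - 1 = (g j x * p j x - 1) + g j x * (l - p j x)" by (simp add: algebra_simps)
              then have "norm (g j x * l - 1) \<le> norm (g j x * p j x - 1) + norm (g j x) * norm (l - p j x)"
                by (metis norm_mult norm_triangle_ineq)
              also have "\<dots> \<le> d j + 2 * norm (l - p j x)"
                using gp[OF x] g2[OF x] by (intro add_mono mult_right_mono) auto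
              finally show "norm (g j x * l - 1) \<le> d j + 2 * norm (l - p j x)" .
            qed
          qed
          then show "(\<lambda>j. g j x * l) \<longlonglongrightarrow> 1" by (simp add: LIM_zero_iff)
        qed
      qed
    qed
  qed
qed

end

section \<open>Approximation in \<open>L\<^sup>t\<close>\<close>

text \<open>
  The Taylor series converges uniformly on the closed unit disk.
\<close>

lemma polynomial_approx_holomorphic:
  assumes F: "F holomorphic_on ball 0 R" and R: "1 < R" and e: "0 < e"
  obtains p :: "complex poly" where "\<And>z. norm z \<le> 1 \<Longrightarrow> norm (poly p z - F z) < e"
proof -
  define a where "a n = (deriv ^^ n) F 0 / fact n" for n
  have sums: "(\<lambda>n. a n * (w - 0) ^ n) sums F w" if "norm w < R" for w
    unfolding a_def by (rule holomorphic_power_series[OF F]) (use that in auto)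
  define \<rho> where "\<rho> = (1 + R) / 2"
  have \<rho>: "1 < \<rho>" "\<rho> < R" using R by (auto simp: \<rho>_def)
  have "summable (\<lambda>n. a n * (of_real \<rho>) ^ n)"
    using sums[of "of_real \<rho>"] \<rho> by (auto simp: sums_iff)
  then have "ereal (norm (of_real \<rho> :: complex)) \<le> conv_radius a" by (rule conv_radius_geI)
  moreover have "ereal 1 < ereal (norm (of_real \<rho> :: complex))" using \<rho> by simp
  ultimately have "ereal 1 < conv_radius a" by (rule order.strict_trans2[rotated])
  from powser_uniform_limit[OF this, of 0]
  have "\<forall>\<^sub>F n in sequentially. \<forall>x\<in>cball 0 1. dist (\<Sum>i<n. a i * (x - 0) ^ i) (\<Sum>i. a i * (x - 0) ^ i) < e"
    using e by (rule uniform_limitD)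
  then obtain n where n: "\<forall>x\<in>cball 0 1. dist (\<Sum>i<n. a i * (x - 0) ^ i) (\<Sum>i. a i * (x - 0) ^ i) < e"
    using eventually_happens'[OF sequentially_bot] by blast
  define p where "p = (\<Sum>i<n. monom (a i) i)"
  show thesis
  proof (rule that[of p])
    fix z :: complex assume z: "norm z \<le> 1"
    have "(\<Sum>i. a i * (z - 0) ^ i) = F z" using sums[of z] z R by (simp add: sums_iff)
    then show "norm (poly p z - F z) < e" using n[rule_format, of z] z by (simp add: p_def poly_sum poly_monom dist_norm)
  qed
qed

lemma polynomial_approx_dilation:
  assumes f: "f holomorphic_on ball 0 1" and r: "0 < r" "r < 1" and e: "0 < e"
  obtains p :: "complex poly" where "\<And>z. norm z \<le> 1 \<Longrightarrow> norm (poly p z - f (of_real r * z)) < e"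
proof -
  have "f \<circ> (\<lambda>z. of_real r * z) holomorphic_on ball 0 (1 / r)"
    by (rule holomorphic_on_compose_gen[OF _ f])
       (use r in \<open>auto intro!: holomorphic_intros simp: norm_mult field_simps\<close>)
  then have "(\<lambda>z. f (of_real r * z)) holomorphic_on ball 0 (1 / r)" by (simp add: comp_def)
  moreover have "1 < 1 / r" using r by simp
  ultimately show thesis using e that by (rule polynomial_approx_holomorphic)
qed

lemma bounded_holomorphic_polynomials:
  assumes f: "f holomorphic_on ball 0 1" and B: "\<And>z. norm z < 1 \<Longrightarrow> norm (f z) \<le> B"
  obtains p :: "nat \<Rightarrow> complex poly" and r :: "nat \<Rightarrow> real" where
    "\<And>n. 0 < r n" "\<And>n. r n < 1" "r \<longlonglongrightarrow> 1"
    "\<And>n z. norm z \<le> 1 \<Longrightarrow> norm (poly (p n) z - f (of_real (r n) * z)) < 1 / real (Suc n)"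
    "\<And>n z. norm z \<le> 1 \<Longrightarrow> norm (poly (p n) z) \<le> B + 1"
proof -
  define r where "r n = 1 - 1 / real (n + 2)" for n :: nat
  have r: "0 < r n" "r n < 1" for n by (auto simp: r_def field_simps)
  have "\<exists>p. \<forall>z. norm z \<le> 1 \<longrightarrow> norm (poly p z - f (of_real (r n) * z)) < 1 / real (Suc n)" for n
    by (rule polynomial_approx_dilation[OF f r(1) r(2), of "1 / real (Suc n)" n]) auto
  then obtain p where p: "\<And>n z. norm z \<le> 1 \<Longrightarrow> norm (poly (p n) z - f (of_real (r n) * z)) < 1 / real (Suc n)"
    by metis
  show thesis
  proof (rule that[of r p])
    have "(\<lambda>n. 1 - 1 / real (n + 2)) \<longlonglongrightarrow> 1 - 0"
      by (intro tendsto_intros LIMSEQ_ignore_initial_segment lim_1_over_n)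
    then show "r \<longlonglongrightarrow> 1" by (simp add: r_def[abs_def])
    fix n and z :: complex assume z: "norm z \<le> 1"
    have "r n * norm z \<le> r n" using r(1)[of n] z by (simp add: mult_left_le)
    then have "r n * norm z < 1" using r(2)[of n] by linarith
    then have "norm (f (of_real (r n) * z)) \<le> B" using r(1)[of n] by (intro B) (simp add: norm_mult)
    moreover have "norm (poly (p n) z) \<le> norm (f (of_real (r n) * z)) + norm (poly (p n) z - f (of_real (r n) * z))"
      by (rule norm_triangle_sub)
    moreover have "1 / real (Suc n) \<le> 1" by simp
    ultimately show "norm (poly (p n) z) \<le> B + 1" using p[OF z, of n] by linarith
  qed (use r p in auto)
qed

text \<open>
  The annulus \<open>1 - 2\<^bsup>-k\<^esup> \<le> |z| < 1\<close> has area at most \<open>2 \<pi>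
  2\<^bsup>-k\<^esup>\<close>, and each \<open>z\<close> in the disk lies in one for which
  \<open>(1 - |z|)\<^sup>\<gamma>\<close> is at most a constant times \<open>2\<^bsup>-k
  \<gamma>\<^esup>\<close>. The resulting geometric series has ratio
  \<open>2\<^bsup>-\<gamma>-1\<^esup> < 1\<close>.
\<close>

lemma nn_integral_weight_finite:
  assumes \<gamma>: "-1 < \<gamma>"
  shows "(\<integral>\<^sup>+z\<in>unit_disk. ennreal ((1 - norm z) powr \<gamma>) \<partial>lborel) < \<infinity>"
proof -
  \<comment> \<open>On a dyadic range of \<open>1 - |z|\<close> the weight is largest at the upper end if \<open>\<gamma> \<ge> 0\<close> and at the
    lower end if \<open>\<gamma> < 0\<close>; \<open>c\<close> covers both cases.\<close>
  define c where "c = max 1 (2 powr - \<gamma>)"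
  have c: "1 \<le> c" "2 powr - \<gamma> \<le> c" by (auto simp: c_def)
  define A where "A k = {z :: complex. 1 - (1/2) ^ k \<le> norm z \<and> norm z < 1}" for k :: nat
  have A_sets: "A k \<in> sets lborel" for k unfolding A_def by measurable
  define q where "q = (2::real) powr - \<gamma>"
  have q0: "0 < q" and q2: "q < 2"
    unfolding q_def using \<gamma> powr_less_mono[of "- \<gamma>" 1 2] by auto
  have half: "((1/2) ^ k) powr \<gamma> = q ^ k" for k
  proof -
    have "(1/2::real) ^ k = 2 powr - real k"
      by (simp add: powr_minus powr_realpow power_one_over inverse_eq_divide)
    then have "((1/2) ^ k) powr \<gamma> = 2 powr (- \<gamma> * real k)" by (simp add: powr_powr mult.commute)
    also have "\<dots> = q powr real k" by (simp add: q_def powr_powr)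
    also have "\<dots> = q ^ k" using q0 by (rule powr_realpow)
    finally show ?thesis .
  qed
  have pw: "ennreal ((1 - norm z) powr \<gamma>) * indicator unit_disk z \<le> (\<Sum>k. ennreal (c * q ^ k) * indicator (A k) z)" for z :: complex
  proof (cases "norm z < 1")
    case True
    define s where "s = 1 - norm z"
    have s: "0 < s" "s \<le> 1" using True by (auto simp: s_def)
    obtain m :: nat where m: "(1/2) ^ m < s" using real_arch_pow_inv[OF s(1), of "1/2"] by auto
    have "(1/2) ^ Suc m = (1/2::real) ^ m / 2" by simp
    then have "(1/2) ^ Suc m < s" using m s(1) by linarith
    then have ex: "\<exists>k. (1/2) ^ Suc k < s" by blast
    define k where "k = (LEAST k. (1/2) ^ Suc k < s)"
    have k1: "(1/2) ^ Suc k < s" unfolding k_def using ex by (rule LeastI_ex)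
    have k2: "s \<le> (1/2) ^ k"
    proof (cases k)
      case 0
      then show ?thesis using s by simp
    next
      case (Suc j)
      then have "\<not> (1/2) ^ Suc j < s" unfolding k_def by (intro not_less_Least) auto
      then show ?thesis using Suc by simp
    qed
    have "s powr \<gamma> \<le> c * q ^ k"
    proof (cases "0 \<le> \<gamma>")
      case True
      have "s powr \<gamma> \<le> ((1/2) ^ k) powr \<gamma>" using k2 s True by (intro powr_mono2) auto
      also have "\<dots> = q ^ k" by (rule half)
      also have "\<dots> \<le> c * q ^ k" using c q0 by simp
      finally show ?thesis .
    next
      case False
      have "s powr \<gamma> \<le> ((1/2) ^ Suc k) powr \<gamma>" using k1 s False by (intro powr_mono2') auto
      also have "\<dots> = q ^ Suc k" by (rule half)
      also have "\<dots> \<le> c * q ^ k" using c q0 by (simp add: q_def)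
      finally show ?thesis .
    qed
    then have "ennreal ((1 - norm z) powr \<gamma>) * indicator unit_disk z \<le> ennreal (c * q ^ k) * indicator (A k) z"
      using k2 True by (auto simp: s_def A_def intro!: ennreal_leI)
    also have "\<dots> \<le> (\<Sum>k. ennreal (c * q ^ k) * indicator (A k) z)" by (rule ennreal_le_suminf)
    finally show ?thesis .
  qed simp
  have A_le: "emeasure lborel (A k) \<le> ennreal (2 * pi * (1/2) ^ k)" for k
  proof -
    define \<rho> where "\<rho> = 1 - (1/2::real) ^ k"
    have \<rho>: "0 \<le> \<rho>" "\<rho> \<le> 1" by (auto simp: \<rho>_def power_le_one)
    have "emeasure lborel (A k) = emeasure lborel (ball (0::complex) 1 - ball 0 \<rho>)"
      by (rule arg_cong[where f="emeasure lborel"]) (auto simp: A_def \<rho>_def)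
    also have "emeasure lborel (ball (0::complex) 1 - ball 0 \<rho>) = 
        emeasure lborel (ball (0::complex) 1) - emeasure lborel (ball (0::complex) \<rho>)"
    proof (rule emeasure_Diff)
      show "emeasure lborel (ball (0::complex) \<rho>) \<noteq> \<infinity>"
        using emeasure_lborel_ball_finite[of "0::complex" \<rho>] by (simp add: less_top)
    qed (use \<rho> in \<open>auto simp: subset_ball\<close>)
    also have "\<dots> = ennreal pi - ennreal (pi * \<rho>\<^sup>2)"
      using \<rho> by (simp add: emeasure_ball unit_ball_vol_2 eval_unit_ball_vol)
    also have "\<dots> = ennreal (pi - pi * \<rho>\<^sup>2)" using \<rho> by (intro ennreal_minus) auto
    also have "\<dots> \<le> ennreal (2 * pi * (1/2) ^ k)"
    proof (rule ennreal_leI)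
      have "1 - \<rho>\<^sup>2 = (1 - \<rho>) * (1 + \<rho>)" by (simp add: power2_eq_square algebra_simps)
      also have "\<dots> \<le> (1 - \<rho>) * 2" using \<rho> by (intro mult_left_mono) auto
      finally have "pi * (1 - \<rho>\<^sup>2) \<le> pi * (2 * (1/2) ^ k)" by (intro mult_left_mono) (auto simp: \<rho>_def)
      then show "pi - pi * \<rho>\<^sup>2 \<le> 2 * pi * (1/2) ^ k" by (simp add: algebra_simps)
    qed
    finally show ?thesis .
  qed
  have "(\<integral>\<^sup>+z\<in>unit_disk. ennreal ((1 - norm z) powr \<gamma>) \<partial>lborel) 
      \<le> (\<integral>\<^sup>+z. (\<Sum>k. ennreal (c * q ^ k) * indicator (A k) z) \<partial>lborel)"
    by (intro nn_integral_mono pw)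
  also have "\<dots> = (\<Sum>k. \<integral>\<^sup>+z. ennreal (c * q ^ k) * indicator (A k) z \<partial>lborel)"
    by (rule nn_integral_suminf) (use A_sets in measurable)
  also have "\<dots> = (\<Sum>k. ennreal (c * q ^ k) * emeasure lborel (A k))"
    using A_sets by (intro suminf_cong nn_integral_cmult_indicator)
  also have "\<dots> \<le> (\<Sum>k. ennreal (2 * pi * c * (q / 2) ^ k))"
  proof (intro suminf_le)
    fix k
    have "ennreal (c * q ^ k) * emeasure lborel (A k) \<le> ennreal (c * q ^ k) * ennreal (2 * pi * (1/2) ^ k)"
      by (intro mult_left_mono A_le) auto
    also have "\<dots> = ennreal ((c * q ^ k) * (2 * pi * (1/2) ^ k))" using c q0 by (subst ennreal_mult') auto
    also have "(c * q ^ k) * (2 * pi * (1/2) ^ k) = 2 * pi * c * (q / 2) ^ k" by (simp add: power_divide)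
    finally show "ennreal (c * q ^ k) * emeasure lborel (A k) \<le> ennreal (2 * pi * c * (q / 2) ^ k)" .
  qed auto
  also have "\<dots> = ennreal (\<Sum>k. 2 * pi * c * (q / 2) ^ k)"
    by (rule suminf_ennreal2) (use c q0 q2 in \<open>auto intro!: summable_mult summable_geometric\<close>)
  also have "\<dots> < \<infinity>" by simp
  finally show ?thesis .
qed

lemma continuous_on_cball_bounded:
  fixes g :: "complex \<Rightarrow> complex"
  assumes "continuous_on (cball 0 1) g"
  obtains B where "\<And>z. norm z \<le> 1 \<Longrightarrow> norm (g z) \<le> B"
proof -
  have "compact (g ` cball 0 1)" using assms by (intro compact_continuous_image) auto
  then show thesis using that compact_imp_bounded bounded_iff by (metis imageI mem_cball_0)
qed

lemma norm_diff_powr_tendsto_0: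
  assumes "0 < t" "(w :: nat \<Rightarrow> complex) \<longlonglongrightarrow> l"
  shows "(\<lambda>n. norm (l - w n) powr t) \<longlonglongrightarrow> 0"
proof -
  have "(\<lambda>n. norm (l - w n)) \<longlonglongrightarrow> norm (l - l)" by (intro tendsto_intros assms)
  then have "(\<lambda>n. norm (l - w n) powr t) \<longlonglongrightarrow> 0 powr t"
    using assms(1) by (intro tendsto_powr2) auto
  then show ?thesis by simp
qed

lemma norm_add_powr_le:
  fixes a b :: complex
  assumes "0 < t"
  shows "norm (a + b) powr t \<le> 2 powr t * (norm a powr t + norm b powr t)"
proof -
  define m where "m = max (norm a) (norm b)"
  have "norm (a + b) \<le> 2 * m" using norm_triangle_ineq[of a b] by (auto simp: m_def)
  then have "norm (a + b) powr t \<le> (2 * m) powr t" using assms by (intro powr_mono2) auto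
  also have "\<dots> = 2 powr t * m powr t" by (rule powr_mult)
  also have "m powr t \<le> norm a powr t + norm b powr t" by (auto simp: m_def max_def)
  finally show ?thesis by simp
qed

lemma Lt_space_diff:
  assumes t: "0 < t" and f: "f \<in> Lt_space t M" and g: "g \<in> Lt_space t M"
  shows "(\<lambda>z. f z - g z) \<in> Lt_space t M"
proof -
  have [measurable]: "f \<in> borel_measurable M" "g \<in> borel_measurable M" using f g by (auto simp: Lt_space_def)
  have i: "integrable M (\<lambda>z. 2 powr t * (norm (f z) powr t + norm (g z) powr t))"
    using f g by (intro integrable_mult_right Bochner_Integration.integrable_add) (auto simp: Lt_space_def)
  have "integrable M (\<lambda>z. norm (f z - g z) powr t)"
  proof (rule Bochner_Integration.integrable_bound[OF i])
    show "AE z in M. norm (norm (f z - g z) powr t) \<le> norm (2 powr t * (norm (f z) powr t + norm (g z) powr t))"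
    proof (rule AE_I2)
      fix z
      show "norm (norm (f z - g z) powr t) \<le> norm (2 powr t * (norm (f z) powr t + norm (g z) powr t))"
        using norm_add_powr_le[OF t, of "f z" "- g z"] by simp
    qed
  qed measurable
  then show ?thesis by (simp add: Lt_space_def)
qed

text \<open>
  For \<open>t \<ge> 1\<close> this is the \<open>t\<close>-th power of the norm distance, for
  \<open>t < 1\<close> the distance itself. It defines the same closures, and satisfies the same
  weakened triangle inequality for all \<open>t > 0\<close>.
\<close>

definition Lt_mod :: "real \<Rightarrow> complex measure \<Rightarrow> (complex \<Rightarrow> complex) \<Rightarrow> (complex \<Rightarrow> complex) \<Rightarrow> real" where
  "Lt_mod t M f g = (LINT z|M. norm (f z - g z) powr t)"

lemma Lt_mod_nonneg: "0 \<le> Lt_mod t M f g"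
  unfolding Lt_mod_def by (rule integral_nonneg_AE) simp

lemma Lt_mod_triangle:
  assumes t: "0 < t" and f: "f \<in> Lt_space t M" and g: "g \<in> Lt_space t M" and h: "h \<in> Lt_space t M"
  shows "Lt_mod t M f h \<le> 2 powr t * (Lt_mod t M f g + Lt_mod t M g h)"
proof -
  have i: "integrable M (\<lambda>z. norm (u z - v z) powr t)" if "u \<in> Lt_space t M" "v \<in> Lt_space t M" for u v
    using Lt_space_diff[OF t that] by (simp add: Lt_space_def)
  have "Lt_mod t M f h \<le> (LINT z|M. 2 powr t * (norm (f z - g z) powr t + norm (g z - h z) powr t))"
    unfolding Lt_mod_def
  proof (rule integral_mono)
    show "norm (f z - h z) powr t \<le> 2 powr t * (norm (f z - g z) powr t + norm (g z - h z) powr t)" for z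
      using norm_add_powr_le[OF t, of "f z - g z" "g z - h z"] by simp
  qed (intro i f g h integrable_mult_right Bochner_Integration.integrable_add)+
  also have "\<dots> = 2 powr t * (Lt_mod t M f g + Lt_mod t M g h)"
    unfolding Lt_mod_def using i[OF f g] i[OF g h] by simp
  finally show ?thesis .
qed

lemma Lt_closure_iff:
  assumes t: "0 < t"
  shows "f \<in> Lt_closure t M S \<longleftrightarrow> 
     f \<in> Lt_space t M \<and> (\<forall>\<epsilon>>0. \<exists>g\<in>S \<inter> Lt_space t M. Lt_mod t M f g < \<epsilon>)"
proof (cases "t \<ge> 1")
  case False
  then show ?thesis by (simp add: Lt_closure_def Lt_dist_def Lt_mod_def)
next
  case True
  have *: "Lt_dist t M f g = Lt_mod t M f g powr (1 / t)" for g using True by (simp add: Lt_dist_def Lt_mod_def)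
  have 1: "Lt_mod t M f g powr (1 / t) < \<epsilon>" if "0 < \<epsilon>" "Lt_mod t M f g < \<epsilon> powr t" for \<epsilon> g
  proof -
    have "Lt_mod t M f g powr (1 / t) < (\<epsilon> powr t) powr (1 / t)"
      using that t by (intro powr_less_mono2 Lt_mod_nonneg) auto
    then show ?thesis using that t by (simp add: powr_powr)
  qed
  have 2: "Lt_mod t M f g < \<epsilon>" if "0 < \<epsilon>" "Lt_mod t M f g powr (1 / t) < \<epsilon> powr (1 / t)" for \<epsilon> g
  proof (rule ccontr)
    assume "\<not> ?thesis"
    then have "\<epsilon> powr (1 / t) \<le> Lt_mod t M f g powr (1 / t)" using that t by (intro powr_mono2) auto
    then show False using that by simp
  qed
  show ?thesis
    unfolding Lt_closure_def mem_Collect_eq *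
  proof (intro conj_cong refl iffI allI impI)
    fix \<epsilon> :: real assume "0 < \<epsilon>" and "\<forall>\<epsilon>>0. \<exists>g\<in>S \<inter> Lt_space t M. Lt_mod t M f g powr (1 / t) < \<epsilon>"
    then have "\<exists>g\<in>S \<inter> Lt_space t M. Lt_mod t M f g powr (1 / t) < \<epsilon> powr (1 / t)" by simp
    then show "\<exists>g\<in>S \<inter> Lt_space t M. Lt_mod t M f g < \<epsilon>" using 2[OF \<open>0 < \<epsilon>\<close>] by blast
  next
    fix \<epsilon> :: real assume "0 < \<epsilon>" and "\<forall>\<epsilon>>0. \<exists>g\<in>S \<inter> Lt_space t M. Lt_mod t M f g < \<epsilon>"
    then have "\<exists>g\<in>S \<inter> Lt_space t M. Lt_mod t M f g < \<epsilon> powr t" by simp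
    then show "\<exists>g\<in>S \<inter> Lt_space t M. Lt_mod t M f g powr (1 / t) < \<epsilon>" using 1[OF \<open>0 < \<epsilon>\<close>] by blast
  qed
qed

locale finite_disk_measure =
  fixes \<mu> :: "complex measure" and t :: real
  assumes finite_borel_disk: "finite_borel_measure_on (cball 0 1) \<mu>" and t_pos: "0 < t"
begin

sublocale finite_measure \<mu>
  using finite_borel_disk by (simp add: finite_borel_measure_on_def)

lemma sets_mu [measurable_cong, simp]: "sets \<mu> = sets (restrict_space borel (cball 0 1))"
  using finite_borel_disk by (simp add: finite_borel_measure_on_def)

lemma space_mu [simp]: "space \<mu> = cball 0 1"
  using sets_eq_imp_space_eq[OF sets_mu] by (simp add: space_restrict_space)

lemma sets_mu_iff: "A \<in> sets \<mu> \<longleftrightarrow> A \<in> sets borel \<and> A \<subseteq> cball 0 1"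
  unfolding sets_mu by (subst sets_restrict_space_iff) auto

lemma borel_imp_mu: "f \<in> borel_measurable borel \<Longrightarrow> f \<in> borel_measurable \<mu>"
  by (simp add: measurable_restrict_space1 cong: measurable_cong_sets)

lemma poly_measurable: "poly p \<in> borel_measurable \<mu>" for p :: "complex poly"
  by (intro borel_imp_mu borel_measurable_continuous_onI continuous_intros)

lemma poly_bounded:
  fixes p :: "complex poly"
  obtains B where "0 < B" "\<And>z. norm z \<le> 1 \<Longrightarrow> norm (poly p z) \<le> B"
proof -
  obtain B where "\<And>z. norm z \<le> 1 \<Longrightarrow> norm (poly p z) \<le> B"
    by (rule continuous_on_cball_bounded[of "poly p"]) (auto intro: continuous_intros)
  then show thesis by (intro that[of "max 1 B"]) (auto intro: max.coboundedI2)
qed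

lemma bounded_in_Lt_space:
  assumes f: "f \<in> borel_measurable \<mu>" and B: "\<And>z. norm z \<le> 1 \<Longrightarrow> norm (f z) \<le> B"
  shows "f \<in> Lt_space t \<mu>"
proof -
  have "integrable \<mu> (\<lambda>z. norm (f z) powr t)"
    by (rule integrable_const_bound[of _ "B powr t"])
       (use f B t_pos in \<open>auto intro!: powr_mono2\<close>)
  then show ?thesis using f by (simp add: Lt_space_def)
qed

lemma poly_in_Lt_space: "poly p \<in> Lt_space t \<mu>" for p :: "complex poly"
  by (rule poly_bounded[of p], rule bounded_in_Lt_space[OF poly_measurable]) auto

lemma mult_in_Lt_space:
  assumes "b \<in> borel_measurable \<mu>" "\<And>z. norm z \<le> 1 \<Longrightarrow> norm (b z) \<le> B" "f \<in> Lt_space t \<mu>"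
  shows "(\<lambda>z. b z * f z) \<in> Lt_space t \<mu>"
proof -
  have fm[measurable]: "f \<in> borel_measurable \<mu>" and i: "integrable \<mu> (\<lambda>z. norm (f z) powr t)"
    using assms(3) by (auto simp: Lt_space_def)
  note [measurable] = assms(1)
  have "integrable \<mu> (\<lambda>z. norm (b z * f z) powr t)"
  proof (rule Bochner_Integration.integrable_bound[OF integrable_mult_right[OF i, of "B powr t"]])
    show "AE z in \<mu>. norm (norm (b z * f z) powr t) \<le> norm (B powr t * norm (f z) powr t)"
    proof (rule AE_I2)
      fix z assume "z \<in> space \<mu>"
      then have "norm (b z) powr t \<le> B powr t" using assms(2) t_pos by (intro powr_mono2) auto
      then show "norm (norm (b z * f z) powr t) \<le> norm (B powr t * norm (f z) powr t)"
        by (simp add: norm_mult powr_mult mult_right_mono)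
    qed
  qed measurable
  then show ?thesis by (simp add: Lt_space_def)
qed

lemma Lt_mod_mult_le:
  assumes "b \<in> borel_measurable \<mu>" "\<And>z. norm z \<le> 1 \<Longrightarrow> norm (b z) \<le> B" 
    and f: "f \<in> Lt_space t \<mu>" and g: "g \<in> Lt_space t \<mu>"
  shows "Lt_mod t \<mu> (\<lambda>z. b z * f z) (\<lambda>z. b z * g z) \<le> B powr t * Lt_mod t \<mu> f g"
proof -
  note d = Lt_space_diff[OF t_pos f g]
  have "Lt_mod t \<mu> (\<lambda>z. b z * f z) (\<lambda>z. b z * g z) \<le> (LINT z|\<mu>. B powr t * norm (f z - g z) powr t)"
    unfolding Lt_mod_def right_diff_distrib[symmetric]
  proof (rule integral_mono)
    show "integrable \<mu> (\<lambda>z. norm (b z * (f z - g z)) powr t)"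
      using mult_in_Lt_space[OF assms(1,2) d] by (simp add: Lt_space_def)
    show "integrable \<mu> (\<lambda>z. B powr t * norm (f z - g z) powr t)"
      using d by (auto simp: Lt_space_def)
    fix z assume "z \<in> space \<mu>"
    then have "norm (b z) powr t \<le> B powr t" using assms(2) t_pos by (intro powr_mono2) auto
    then show "norm (b z * (f z - g z)) powr t \<le> B powr t * norm (f z - g z) powr t"
      by (simp add: norm_mult powr_mult mult_right_mono)
  qed
  then show ?thesis by (simp add: Lt_mod_def)
qed

text \<open>
  Multiplication by a polynomial is bounded on \<open>L\<^sup>t\<close>. So the hypothesis
  \<open>approx\<close> makes every \<open>p f\<close> a limit of polynomials, and the hypothesis
  \<open>inv\<close> makes every polynomial \<open>p\<close> a limit of products \<open>p q
  f\<close>.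
\<close>

theorem cyclic_for_Mz_criterion:
  assumes fm: "f \<in> borel_measurable \<mu>" and f1: "\<And>z. norm z \<le> 1 \<Longrightarrow> norm (f z) \<le> 1"
    and approx: "\<And>\<delta>. 0 < \<delta> \<Longrightarrow> \<exists>p :: complex poly. Lt_mod t \<mu> f (poly p) < \<delta>"
    and inv: "\<And>\<delta>. 0 < \<delta> \<Longrightarrow> \<exists>p :: complex poly. Lt_mod t \<mu> (\<lambda>z. 1) (\<lambda>z. poly p z * f z) < \<delta>"
  shows "cyclic_for_Mz t \<mu> f"
proof -
  define c where "c = (2::real) powr t"
  have c: "0 < c" by (simp add: c_def)
  have fL: "f \<in> Lt_space t \<mu>" by (rule bounded_in_Lt_space[OF fm f1])
  have pfL: "(\<lambda>z. poly p z * f z) \<in> Lt_space t \<mu>" for p :: "complex poly"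
    by (rule poly_bounded[of p], rule mult_in_Lt_space[OF poly_measurable _ fL]) auto
  have mod_le: "Lt_mod t \<mu> (\<lambda>z. poly p z * u z) (\<lambda>z. poly p z * v z) \<le> B powr t * Lt_mod t \<mu> u v"
    if "\<And>z. norm z \<le> 1 \<Longrightarrow> norm (poly p z) \<le> B" "u \<in> Lt_space t \<mu>" "v \<in> Lt_space t \<mu>" 
    for p :: "complex poly" and u v B
    by (rule Lt_mod_mult_le[OF poly_measurable that])
  have one: "(\<lambda>z. 1) \<in> Lt_space t \<mu>" by (rule bounded_in_Lt_space[of _ 1]) auto
  have "f \<in> Pt_space t \<mu>"
    unfolding Pt_space_def Lt_closure_iff[OF t_pos]
    using fL approx poly_in_Lt_space by blast
  moreover have "Lt_closure t \<mu> (range (\<lambda>p :: complex poly. \<lambda>z. poly p z * f z)) = Pt_space t \<mu>"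
  proof (intro subset_antisym subsetI)
    fix h assume "h \<in> Lt_closure t \<mu> (range (\<lambda>p :: complex poly. \<lambda>z. poly p z * f z))"
    then have hL: "h \<in> Lt_space t \<mu>" 
      and h: "\<And>\<epsilon>. 0 < \<epsilon> \<Longrightarrow> \<exists>p :: complex poly. Lt_mod t \<mu> h (\<lambda>z. poly p z * f z) < \<epsilon>"
      unfolding Lt_closure_iff[OF t_pos] by blast+
    have "\<exists>g\<in>range (poly :: complex poly \<Rightarrow> _) \<inter> Lt_space t \<mu>. Lt_mod t \<mu> h g < \<epsilon>" if \<epsilon>: "0 < \<epsilon>" for \<epsilon>
    proof -
      obtain p :: "complex poly" where p: "Lt_mod t \<mu> h (\<lambda>z. poly p z * f z) < \<epsilon> / (2 * c)"
        using h[of "\<epsilon> / (2 * c)"] \<epsilon> c by auto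
      obtain B where B: "0 < B" "\<And>z. norm z \<le> 1 \<Longrightarrow> norm (poly p z) \<le> B" using poly_bounded[of p] by blast
      obtain q :: "complex poly" where q: "Lt_mod t \<mu> f (poly q) < \<epsilon> / (2 * c * B powr t)"
        using approx[of "\<epsilon> / (2 * c * B powr t)"] \<epsilon> c B by auto
      have pq: "poly (p * q) = (\<lambda>z. poly p z * poly q z)" by (rule ext) simp
      have "Lt_mod t \<mu> (\<lambda>z. poly p z * f z) (\<lambda>z. poly p z * poly q z) \<le> B powr t * Lt_mod t \<mu> f (poly q)"
        by (rule mod_le[OF B(2) fL poly_in_Lt_space])
      also have "\<dots> < B powr t * (\<epsilon> / (2 * c * B powr t))" using q B by (intro mult_strict_left_mono) auto
      also have "\<dots> = \<epsilon> / (2 * c)" using B by simp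
      finally have 2: "Lt_mod t \<mu> (\<lambda>z. poly p z * f z) (poly (p * q)) < \<epsilon> / (2 * c)"
        unfolding pq .
      have "Lt_mod t \<mu> h (poly (p * q)) \<le> c * (Lt_mod t \<mu> h (\<lambda>z. poly p z * f z) + Lt_mod t \<mu> (\<lambda>z. poly p z * f z) (poly (p * q)))"
        unfolding c_def by (rule Lt_mod_triangle[OF t_pos hL pfL poly_in_Lt_space])
      also have "\<dots> < c * (\<epsilon> / (2 * c) + \<epsilon> / (2 * c))" using p 2 c by (intro mult_strict_left_mono) auto
      also have "\<dots> = \<epsilon>" using c by simp
      finally show ?thesis using poly_in_Lt_space by blast
    qed
    then show "h \<in> Pt_space t \<mu>" unfolding Pt_space_def Lt_closure_iff[OF t_pos] using hL by blast
  next
    fix h assume "h \<in> Pt_space t \<mu>"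
    then have hL: "h \<in> Lt_space t \<mu>" 
      and h: "\<And>\<epsilon>. 0 < \<epsilon> \<Longrightarrow> \<exists>p :: complex poly. Lt_mod t \<mu> h (poly p) < \<epsilon>"
      unfolding Pt_space_def Lt_closure_iff[OF t_pos] by blast+
    have "\<exists>g\<in>range (\<lambda>p :: complex poly. \<lambda>z. poly p z * f z) \<inter> Lt_space t \<mu>. Lt_mod t \<mu> h g < \<epsilon>" 
      if \<epsilon>: "0 < \<epsilon>" for \<epsilon>
    proof -
      obtain p :: "complex poly" where p: "Lt_mod t \<mu> h (poly p) < \<epsilon> / (2 * c)"
        using h[of "\<epsilon> / (2 * c)"] \<epsilon> c by auto
      obtain B where B: "0 < B" "\<And>z. norm z \<le> 1 \<Longrightarrow> norm (poly p z) \<le> B" using poly_bounded[of p] by blast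
      obtain q :: "complex poly" where q: "Lt_mod t \<mu> (\<lambda>z. 1) (\<lambda>z. poly q z * f z) < \<epsilon> / (2 * c * B powr t)"
        using inv[of "\<epsilon> / (2 * c * B powr t)"] \<epsilon> c B by auto
      have "Lt_mod t \<mu> (\<lambda>z. poly p z * 1) (\<lambda>z. poly p z * (poly q z * f z)) \<le> B powr t * Lt_mod t \<mu> (\<lambda>z. 1) (\<lambda>z. poly q z * f z)"
        by (rule mod_le[OF B(2) one pfL])
      also have "\<dots> < B powr t * (\<epsilon> / (2 * c * B powr t))" using q B by (intro mult_strict_left_mono) auto
      also have "\<dots> = \<epsilon> / (2 * c)" using B by simp
      finally have 2: "Lt_mod t \<mu> (poly p) (\<lambda>z. poly (p * q) z * f z) < \<epsilon> / (2 * c)" by (simp add: mult.assoc)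
      have "Lt_mod t \<mu> h (\<lambda>z. poly (p * q) z * f z) \<le> c * (Lt_mod t \<mu> h (poly p) + Lt_mod t \<mu> (poly p) (\<lambda>z. poly (p * q) z * f z))"
        unfolding c_def by (rule Lt_mod_triangle[OF t_pos hL poly_in_Lt_space pfL])
      also have "\<dots> < c * (\<epsilon> / (2 * c) + \<epsilon> / (2 * c))" using p 2 c by (intro mult_strict_left_mono) auto
      also have "\<dots> = \<epsilon>" using c by simp
      finally show ?thesis using pfL by blast
    qed
    then show "h \<in> Lt_closure t \<mu> (range (\<lambda>p :: complex poly. \<lambda>z. poly p z * f z))"
      unfolding Lt_closure_iff[OF t_pos] using hL by blast
  qed
  ultimately show ?thesis by (simp add: cyclic_for_Mz_def)
qed

end

section \<open>Boundary values\<close>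

lemma radial_limit_eq:
  assumes "((\<lambda>r. f (complex_of_real r * \<zeta>)) \<longlongrightarrow> l) (at_left 1)"
  shows "radial_limit f \<zeta> = l"
  using assms tendsto_Lim[OF trivial_limit_at_left_real assms] by (auto simp: radial_limit_def)

text \<open>
  Cauchy's criterion with quantifiers over \<open>k\<close> and \<open>n\<close> that range over a
  countable set; the inner condition will define a closed set, so that the set of convergence is
  Borel.
\<close>

lemma radial_convergence_iff:
  fixes h :: "real \<Rightarrow> complex"
  defines "J \<equiv> \<lambda>n::nat. {1 - 1 / real (Suc n)<..<1}"
  shows "(\<exists>l. (h \<longlongrightarrow> l) (at_left 1)) \<longleftrightarrow>
      (\<forall>k::nat. \<exists>n. \<forall>p\<in>J n. \<forall>q\<in>J n. dist (h p) (h q) \<le> 1 / real (Suc k))"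
proof
  assume "\<exists>l. (h \<longlongrightarrow> l) (at_left 1)"
  then obtain l where l: "(h \<longlongrightarrow> l) (at_left 1)" by blast
  show "\<forall>k::nat. \<exists>n. \<forall>p\<in>J n. \<forall>q\<in>J n. dist (h p) (h q) \<le> 1 / real (Suc k)"
  proof
    fix k :: nat
    have "\<forall>\<^sub>F r in at_left 1. dist (h r) l < 1 / real (Suc k) / 2" by (rule tendstoD[OF l]) simp
    then obtain b where b: "b < 1" "\<And>r. b < r \<Longrightarrow> r < 1 \<Longrightarrow> dist (h r) l < 1 / real (Suc k) / 2"
      unfolding eventually_at_left[of "0::real" 1, simplified] by blast
    obtain n where "inverse (real (Suc n)) < 1 - b" using reals_Archimedean[of "1 - b"] b by auto
    then have n: "b < 1 - 1 / real (Suc n)" by (simp add: inverse_eq_divide)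
    have "dist (h p) (h q) \<le> 1 / real (Suc k)" if "p \<in> J n" "q \<in> J n" for p q
    proof -
      have "dist (h p) l < 1 / real (Suc k) / 2" "dist (h q) l < 1 / real (Suc k) / 2"
        using that n unfolding J_def greaterThanLessThan_iff by (intro b(2); linarith)+
      then show ?thesis using dist_triangle2[of "h p" "h q" l] by linarith
    qed
    then show "\<exists>n. \<forall>p\<in>J n. \<forall>q\<in>J n. dist (h p) (h q) \<le> 1 / real (Suc k)" by blast
  qed
next
  assume *: "\<forall>k::nat. \<exists>n. \<forall>p\<in>J n. \<forall>q\<in>J n. dist (h p) (h q) \<le> 1 / real (Suc k)"
  define r where "r n = 1 - 1 / real (n + 2)" for n :: nat
  have rJ: "r m \<in> J n" if "n \<le> m" for m n using that by (auto simp: r_def J_def field_simps)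
  have "Cauchy (\<lambda>n. h (r n))"
  proof (rule metric_CauchyI)
    fix e :: real assume "0 < e"
    then obtain k where k: "1 / real (Suc k) < e" using reals_Archimedean[of e] by (auto simp: inverse_eq_divide)
    obtain n where "\<And>p q. p \<in> J n \<Longrightarrow> q \<in> J n \<Longrightarrow> dist (h p) (h q) \<le> 1 / real (Suc k)" using * by blast
    then show "\<exists>M. \<forall>m\<ge>M. \<forall>n\<ge>M. dist (h (r m)) (h (r n)) < e"
      using rJ k by (intro exI[of _ n]) (meson le_less_trans)
  qed
  then obtain l where l: "(\<lambda>n. h (r n)) \<longlonglongrightarrow> l" using Cauchy_convergent convergent_def by blast
  have "(h \<longlongrightarrow> l) (at_left 1)"
  proof (rule tendstoI)
    fix e :: real assume "0 < e"
    then obtain k where k: "1 / real (Suc k) < e" using reals_Archimedean[of e] by (auto simp: inverse_eq_divide)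
    obtain n where n: "\<And>p q. p \<in> J n \<Longrightarrow> q \<in> J n \<Longrightarrow> dist (h p) (h q) \<le> 1 / real (Suc k)" using * by blast
    have "dist (h p) l \<le> 1 / real (Suc k)" if p: "p \<in> J n" for p
    proof (rule LIMSEQ_le_const2)
      show "(\<lambda>m. dist (h p) (h (r m))) \<longlonglongrightarrow> dist (h p) l" by (intro tendsto_intros l)
      show "\<exists>N. \<forall>m\<ge>N. dist (h p) (h (r m)) \<le> 1 / real (Suc k)" using n[OF p rJ] by blast
    qed
    moreover have "\<forall>\<^sub>F p in at_left 1. p \<in> J n" unfolding J_def by (rule eventually_at_left_real) simp
    ultimately show "\<forall>\<^sub>F p in at_left 1. dist (h p) l < e"
      using k by (auto elim!: eventually_mono intro: le_less_trans)
  qed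
  then show "\<exists>l. (h \<longlongrightarrow> l) (at_left 1)" by blast
qed

lemma seq_at_left_1:
  assumes "r \<longlonglongrightarrow> 1" "\<And>n. r n < (1::real)"
  shows "filterlim r (at_left 1) sequentially"
  using assms by (auto simp: filterlim_at intro!: always_eventually less_imp_neq)

text \<open>
  The set where the radial limit exists is Borel, and on it the radial limit is the limit of a
  sequence of continuous functions.
\<close>

lemma with_boundary_values_measurable:
  assumes f: "continuous_on (ball 0 1) f"
  shows "with_boundary_values f \<in> borel_measurable (restrict_space borel (cball 0 1))"
proof -
  define J where "J n = {1 - 1 / real (Suc n)<..<1}" for n :: nat
  have J01: "0 < p" "p < 1" if "p \<in> J n" for p n
  proof -
    have "1 / real (Suc n) \<le> 1" by simp
    then show "0 < p" "p < 1" using that unfolding J_def greaterThanLessThan_iff by linarith+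
  qed
  have cont: "continuous_on unit_circle (\<lambda>x. f (of_real p * x))" if "0 < p" "p < 1" for p
    by (rule continuous_on_compose2[OF f]) (use that in \<open>auto intro!: continuous_intros simp: norm_mult\<close>)
  define E where "E k n = {x \<in> unit_circle. \<forall>p\<in>J n. \<forall>q\<in>J n. 
      dist (f (of_real p * x)) (f (of_real q * x)) \<le> 1 / real (Suc k)}" for k n
  have clE: "closed (E k n)" for k n
  proof -
    have eq: "E k n = (\<Inter>p\<in>J n. \<Inter>q\<in>J n. unit_circle \<inter> 
        (\<lambda>x. dist (f (of_real p * x)) (f (of_real q * x))) -` {..1 / real (Suc k)})"
    proof -
      have "1 - 1 / real (Suc n) / 2 \<in> J n" by (simp add: J_def field_simps)
      then show ?thesis unfolding E_def by auto
    qed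
    show ?thesis
      unfolding eq
      by (intro closed_INT ballI continuous_closed_preimage continuous_on_dist cont closed_sphere closed_atMost)
         (auto dest: J01)
  qed
  define Cv where "Cv = (\<Inter>k. \<Union>n. E k n)"
  have Cv_sets[measurable]: "Cv \<in> sets borel" unfolding Cv_def
    using clE by (intro sets.countable_INT sets.countable_UN) (auto intro: borel_closed)
  have Cv_iff: "x \<in> Cv \<longleftrightarrow> (\<exists>l. ((\<lambda>r. f (of_real r * x)) \<longlongrightarrow> l) (at_left 1))" if "x \<in> unit_circle" for x
    using that unfolding radial_convergence_iff[of "\<lambda>r. f (of_real r * x)"] by (auto simp: Cv_def E_def J_def)
  define r where "r n = 1 - 1 / real (n + 2)" for n :: nat
  have r: "0 < r n" "r n < 1" for n by (auto simp: r_def field_simps)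
  have "(\<lambda>n. 1 - 1 / real (n + 2)) \<longlonglongrightarrow> 1 - 0"
    by (intro tendsto_intros LIMSEQ_ignore_initial_segment lim_1_over_n)
  then have rlim: "filterlim r (at_left 1) sequentially"
    by (intro seq_at_left_1 r) (simp add: r_def[abs_def])
  define a where "a n x = (if x \<in> unit_circle then f (of_real (r n) * x) else 0)" for n x
  have [measurable]: "a n \<in> borel_measurable borel" for n
    unfolding a_def by (rule borel_measurable_continuous_on_if) (use cont r in auto)
  define f0 where "f0 z = (if z \<in> ball 0 1 then f z else 0)" for z
  define h where "h z = (if z \<in> ball 0 1 then f0 z
      else if z \<in> Cv then lim (\<lambda>n. a n z) else 0)" for z
  have [measurable]: "unit_disk \<in> sets (borel :: complex measure)" by simp
  have [measurable]: "f0 \<in> borel_measurable borel"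
    unfolding f0_def by (rule borel_measurable_continuous_on_if) (use f in auto)
  have "h \<in> borel_measurable borel" unfolding h_def by measurable
  then have "h \<in> borel_measurable (restrict_space borel (cball 0 1))" by (rule measurable_restrict_space1)
  moreover have "with_boundary_values f z = h z" if "z \<in> cball 0 1" for z
  proof (cases "z \<in> ball 0 1")
    case True
    then show ?thesis by (simp add: h_def f0_def with_boundary_values_def)
  next
    case False
    then have z: "z \<in> unit_circle" using that by auto
    show ?thesis
    proof (cases "z \<in> Cv")
      case True
      then obtain l where l: "((\<lambda>r. f (of_real r * z)) \<longlongrightarrow> l) (at_left 1)" using Cv_iff[OF z] by blast
      have "(\<lambda>n. a n z) \<longlonglongrightarrow> l" using filterlim_compose[OF l rlim] z by (simp add: a_def)
      then have "lim (\<lambda>n. a n z) = l" by (rule limI)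
      then show ?thesis using True False radial_limit_eq[OF l] by (auto simp: h_def with_boundary_values_def)
    next
      case nC: False
      then show ?thesis using False Cv_iff[OF z] by (auto simp: h_def with_boundary_values_def radial_limit_def)
    qed
  qed
  ultimately show ?thesis
    by (subst measurable_cong[of _ _ h]) (auto simp: space_restrict_space)
qed

section \<open>The support of the boundary part\<close>

lemma closed_closed_support:
  assumes "closed (space M)"
  shows "closed (closed_support M)"
proof -
  have "- closed_support M = - space M \<union> \<Union>{U. open U \<and> emeasure M (U \<inter> space M) = 0}"
    unfolding closed_support_def by (auto simp: zero_less_iff_neq_zero)
  then have "open (- closed_support M)" using assms by (auto intro!: open_Un open_Union)
  then show ?thesis by (simp add: closed_def)
qed

text \<open>
  The complement of the support is covered by those members of a countable basis that are null
  sets.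
\<close>

lemma AE_in_closed_support:
  assumes "\<And>U. open U \<Longrightarrow> U \<inter> space M \<in> sets M"
  shows "AE x in M. x \<in> closed_support M"
proof -
  obtain B :: "complex set set" where B: "countable B" "topological_basis B"
    using ex_countable_basis by blast
  let ?N = "{b \<in> B. emeasure M (b \<inter> space M) = 0}"
  have "AE x in M. \<forall>b\<in>?N. x \<notin> b \<inter> space M"
  proof (subst AE_ball_countable)
    show "countable ?N" using B(1) by (rule countable_subset[rotated]) auto
    show "\<forall>b\<in>?N. AE x in M. x \<notin> b \<inter> space M"
    proof
      fix b assume "b \<in> ?N"
      then have "b \<inter> space M \<in> null_sets M"
        using assms topological_basis_open[OF B(2)] by (auto simp: null_sets_def)
      then show "AE x in M. x \<notin> b \<inter> space M" by (rule AE_not_in)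
    qed
  qed
  then show ?thesis using AE_space
  proof eventually_elim
    case (elim x)
    show ?case
    proof (rule ccontr)
      assume "x \<notin> closed_support M"
      then obtain U where U: "open U" "x \<in> U" "emeasure M (U \<inter> space M) = 0"
        using elim(2) by (auto simp: closed_support_def zero_less_iff_neq_zero)
      obtain b where b: "b \<in> B" "x \<in> b" "b \<subseteq> U" using topological_basisE[OF B(2) U(1,2)] by blast
      have "emeasure M (b \<inter> space M) \<le> emeasure M (U \<inter> space M)"
        by (rule emeasure_mono) (use b assms[OF U(1)] in auto)
      then have "b \<in> ?N" using b U by simp
      then show False using elim b by blast
    qed
  qed
qed

section \<open>Cyclicity\<close>

lemma disk_weight_measurable:
  "(\<lambda>z :: complex. ennreal ((1 - norm z) powr \<gamma>) * indicator unit_disk z) \<in> borel_measurable borel"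
proof -
  have [measurable]: "unit_disk \<in> sets (borel :: complex measure)" by simp
  show ?thesis by measurable
qed

context finite_disk_measure
begin

lemma disk_circle_sets: "unit_disk \<in> sets \<mu>" "unit_circle \<in> sets \<mu>"
  unfolding sets_mu_iff by auto

lemma polynomials_tendsto:
  assumes r: "\<And>n. r n < 1" "r \<longlonglongrightarrow> 1"
    and p: "\<And>n. norm (poly (p n) z - f (of_real (r n) * z)) < 1 / real (Suc n)"
    and l: "((\<lambda>r. f (complex_of_real r * z)) \<longlongrightarrow> l) (at_left 1)"
  shows "(\<lambda>n. poly (p n) z) \<longlonglongrightarrow> l"
proof -
  have 1: "(\<lambda>n. f (of_real (r n) * z)) \<longlonglongrightarrow> l"
    by (rule filterlim_compose[OF l seq_at_left_1[OF r(2,1)]])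
  have 2: "(\<lambda>n. poly (p n) z - f (of_real (r n) * z)) \<longlonglongrightarrow> 0"
  proof (rule Lim_null_comparison)
    show "\<forall>\<^sub>F n in sequentially. norm (poly (p n) z - f (of_real (r n) * z)) \<le> 1 / real (Suc n)"
      using p by (auto intro!: always_eventually less_imp_le)
    show "(\<lambda>n. 1 / real (Suc n)) \<longlonglongrightarrow> 0" using LIMSEQ_inverse_real_of_nat by (simp add: inverse_eq_divide)
  qed
  show ?thesis using tendsto_add[OF 2 1] by simp
qed

lemma radial_tendsto_disk:
  assumes f: "continuous_on (ball 0 1) f" and z: "norm z < 1"
  shows "((\<lambda>r. f (complex_of_real r * z)) \<longlongrightarrow> f z) (at_left 1)"
proof -
  have "isCont f z" using f z continuous_on_eq_continuous_at[of "ball 0 1" f] by simp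
  moreover have "((\<lambda>r. complex_of_real r * z) \<longlongrightarrow> of_real 1 * z) (at_left 1)" by (intro tendsto_intros)
  ultimately show ?thesis using isCont_tendsto_compose[of "of_real 1 * z" f] by simp
qed

text \<open>
  An inequality between \<open>t\<close>-th power integrals that holds for polynomials extends to
  bounded holomorphic functions: these are bounded pointwise limits of polynomials, so Fatou's
  lemma applies on the left and dominated convergence on the right.
\<close>

lemma nn_integral_bounded_holomorphic_le:
  assumes \<beta>: "-1 < \<beta>"
    and le: "\<And>p :: complex poly. (\<integral>\<^sup>+z. ennreal (norm (poly p z) powr t) \<partial>restrict_space \<mu> unit_disk)
           \<le> ennreal C * (\<integral>\<^sup>+z\<in>unit_disk. ennreal (norm (poly p z) powr t * (1 - norm z) powr \<beta>) \<partial>lborel)"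
    and f: "f holomorphic_on ball 0 1" and B: "\<And>z. norm z < 1 \<Longrightarrow> norm (f z) \<le> B"
  shows "(\<integral>\<^sup>+z\<in>unit_disk. ennreal (norm (f z) powr t) \<partial>\<mu>)
           \<le> ennreal C * (\<integral>\<^sup>+z\<in>unit_disk. ennreal (norm (f z) powr t * (1 - norm z) powr \<beta>) \<partial>lborel)"
proof -
  have cf: "continuous_on (ball 0 1) f" by (rule holomorphic_on_imp_continuous_on[OF f])
  obtain p :: "nat \<Rightarrow> complex poly" and r where r: "\<And>n. 0 < r n" "\<And>n. r n < 1" "r \<longlonglongrightarrow> 1"
    and p: "\<And>n z. norm z \<le> 1 \<Longrightarrow> norm (poly (p n) z - f (of_real (r n) * z)) < 1 / real (Suc n)"
    and pB: "\<And>n z. norm z \<le> 1 \<Longrightarrow> norm (poly (p n) z) \<le> B + 1"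
    by (rule bounded_holomorphic_polynomials[OF f B]) blast+
  have conv: "(\<lambda>n. norm (poly (p n) z) powr t) \<longlonglongrightarrow> norm (f z) powr t" if "norm z < 1" for z
    by (intro tendsto_powr2 tendsto_norm polynomials_tendsto[OF r(2,3) p radial_tendsto_disk[OF cf]] tendsto_const)
       (use that t_pos in \<open>auto intro!: always_eventually\<close>)
  let ?X = "\<lambda>n z. ennreal (norm (poly (p n) z) powr t) * indicator unit_disk z"
  let ?Y = "\<lambda>n z. ennreal (norm (poly (p n) z) powr t * (1 - norm z) powr \<beta>) * indicator unit_disk z"
  have X_meas: "?X n \<in> borel_measurable \<mu>" for n
  proof -
    note [measurable] = disk_circle_sets(1) poly_measurable
    show ?thesis by measurable
  qed
  have [measurable]: "unit_disk \<in> sets (borel :: complex measure)" by simp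
  have [measurable]: "poly (p n) \<in> borel_measurable borel" for n
    by (intro borel_measurable_continuous_onI continuous_intros)
  have "(\<integral>\<^sup>+z\<in>unit_disk. ennreal (norm (f z) powr t) \<partial>\<mu>) = (\<integral>\<^sup>+z. liminf (\<lambda>n. ?X n z) \<partial>\<mu>)"
  proof (rule nn_integral_cong)
    fix z
    have "(\<lambda>n. ?X n z) \<longlonglongrightarrow> ennreal (norm (f z) powr t) * indicator unit_disk z"
    proof (cases "norm z < 1")
      case True
      then show ?thesis using tendsto_ennrealI[OF conv[OF True]] by simp
    qed simp
    then show "ennreal (norm (f z) powr t) * indicator unit_disk z = liminf (\<lambda>n. ?X n z)"
      by (rule lim_imp_Liminf[OF sequentially_bot, symmetric])
  qed
  also have "\<dots> \<le> liminf (\<lambda>n. \<integral>\<^sup>+z. ?X n z \<partial>\<mu>)"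
    by (rule nn_integral_liminf) (rule X_meas)
  also have "\<dots> \<le> liminf (\<lambda>n. ennreal C * (\<integral>\<^sup>+z. ?Y n z \<partial>lborel))"
  proof (intro Liminf_mono always_eventually allI)
    fix n
    have "(\<integral>\<^sup>+z. ?X n z \<partial>\<mu>) = (\<integral>\<^sup>+z. ennreal (norm (poly (p n) z) powr t) \<partial>restrict_space \<mu> unit_disk)"
    proof (rule nn_integral_restrict_space[symmetric])
      have "unit_disk \<inter> space \<mu> = unit_disk" by auto
      then show "unit_disk \<inter> space \<mu> \<in> sets \<mu>" using disk_circle_sets(1) by metis
    qed
    then show "(\<integral>\<^sup>+z. ?X n z \<partial>\<mu>) \<le> ennreal C * (\<integral>\<^sup>+z. ?Y n z \<partial>lborel)" using le[of "p n"] by simp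
  qed
  also have "\<dots> = ennreal C * (\<integral>\<^sup>+z\<in>unit_disk. ennreal (norm (f z) powr t * (1 - norm z) powr \<beta>) \<partial>lborel)"
  proof (rule lim_imp_Liminf[OF sequentially_bot], rule ennreal_tendsto_cmult)
    show "(\<lambda>n. \<integral>\<^sup>+z. ?Y n z \<partial>lborel) \<longlonglongrightarrow> 
       (\<integral>\<^sup>+z\<in>unit_disk. ennreal (norm (f z) powr t * (1 - norm z) powr \<beta>) \<partial>lborel)"
    proof (rule nn_integral_dominated_convergence
        [where w="\<lambda>z. ennreal ((B + 1) powr t) * (ennreal ((1 - norm z) powr \<beta>) * indicator unit_disk z)"])
      show "(\<lambda>z. ennreal (norm (f z) powr t * (1 - norm z) powr \<beta>) * indicator unit_disk z) \<in> borel_measurable lborel"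
      proof -
        have [measurable]: "unit_disk \<in> sets (borel :: complex measure)" by simp
        define f0 where "f0 z = (if z \<in> ball 0 1 then f z else 0)" for z
        have [measurable]: "f0 \<in> borel_measurable borel"
          unfolding f0_def by (rule borel_measurable_continuous_on_if) (use cf in auto)
        have "(\<lambda>z. ennreal (norm (f0 z) powr t * (1 - norm z) powr \<beta>) * indicator unit_disk z) \<in> borel_measurable lborel"
          by measurable
        moreover have "(\<lambda>z. ennreal (norm (f0 z) powr t * (1 - norm z) powr \<beta>) * indicator unit_disk z) = 
           (\<lambda>z. ennreal (norm (f z) powr t * (1 - norm z) powr \<beta>) * indicator unit_disk z)"
          by (auto simp: f0_def fun_eq_iff indicator_def)
        ultimately show ?thesis by simp
      qed
      show "(\<integral>\<^sup>+z. ennreal ((B + 1) powr t) * (ennreal ((1 - norm z) powr \<beta>) * indicator unit_disk z) \<partial>lborel) < \<infinity>"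
        using nn_integral_weight_finite[OF \<beta>] disk_weight_measurable[of \<beta>]
        by (subst nn_integral_cmult) (auto simp: ennreal_mult_less_top)
      show "AE z in lborel. ?Y n z \<le> ennreal ((B + 1) powr t) * (ennreal ((1 - norm z) powr \<beta>) * indicator unit_disk z)" for n
      proof (rule AE_I2)
        fix z :: complex
        show "?Y n z \<le> ennreal ((B + 1) powr t) * (ennreal ((1 - norm z) powr \<beta>) * indicator unit_disk z)"
        proof (cases "norm z < 1")
          case True
          then have "norm (poly (p n) z) powr t \<le> (B + 1) powr t" using pB t_pos by (intro powr_mono2) auto
          then show ?thesis using True by (simp add: ennreal_mult'[symmetric] mult_right_mono ennreal_leI)
        qed simp
      qed
      show "AE z in lborel. (\<lambda>n. ?Y n z) \<longlonglongrightarrow> ennreal (norm (f z) powr t * (1 - norm z) powr \<beta>) * indicator unit_disk z"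
      proof (rule AE_I2)
        fix z :: complex
        show "(\<lambda>n. ?Y n z) \<longlonglongrightarrow> ennreal (norm (f z) powr t * (1 - norm z) powr \<beta>) * indicator unit_disk z"
        proof (cases "norm z < 1")
          case True
          then show ?thesis using tendsto_ennrealI[OF tendsto_mult[OF conv[OF True] tendsto_const]] by simp
        qed simp
      qed
    qed measurable
  qed simp
  finally show ?thesis .
qed

end

context finite_disk_measure
begin

lemma Lt_mod_tendsto_0:
  assumes um: "u \<in> borel_measurable \<mu>" and vm: "\<And>n. v n \<in> borel_measurable \<mu>"
    and bd: "\<And>z. norm z \<le> 1 \<Longrightarrow> norm (u z) \<le> B" "\<And>n z. norm z \<le> 1 \<Longrightarrow> norm (v n z) \<le> B"
    and conv: "AE z in \<mu>. (\<lambda>n. v n z) \<longlonglongrightarrow> u z"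
  shows "(\<lambda>n. Lt_mod t \<mu> u (v n)) \<longlonglongrightarrow> 0"
proof -
  have [measurable]: "u \<in> borel_measurable \<mu>" "v n \<in> borel_measurable \<mu>" for n by (fact um, fact vm)
  have "(\<lambda>n. LINT z|\<mu>. norm (u z - v n z) powr t) \<longlonglongrightarrow> (LINT z|\<mu>. 0)"
  proof (rule integral_dominated_convergence[where w="\<lambda>_. (2 * B) powr t"])
    show "AE z in \<mu>. (\<lambda>n. norm (u z - v n z) powr t) \<longlonglongrightarrow> 0"
      using conv
      by eventually_elim (rule norm_diff_powr_tendsto_0[OF t_pos])
    show "AE z in \<mu>. norm (norm (u z - v n z) powr t) \<le> (2 * B) powr t" for n
    proof (rule AE_I2)
      fix z assume "z \<in> space \<mu>"
      then have z: "norm z \<le> 1" by simp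
      have "norm (u z - v n z) \<le> 2 * B"
        using bd(1)[OF z] bd(2)[OF z, of n] norm_triangle_ineq4[of "u z" "v n z"] by linarith
      then show "norm (norm (u z - v n z) powr t) \<le> (2 * B) powr t" using t_pos by (simp add: powr_mono2)
    qed
  qed measurable
  then show ?thesis by (simp add: Lt_mod_def)
qed

text \<open>
  On the closed disk \<open>g\<close> is a uniform limit of polynomials.
\<close>

lemma exists_polynomial_inverse:
  assumes fm: "f \<in> borel_measurable \<mu>" and f1: "\<And>z. norm z \<le> 1 \<Longrightarrow> norm (f z) \<le> 1"
    and g: "g holomorphic_on ball 0 R" "1 < R" and \<delta>: "0 < \<delta>"
    and le: "Lt_mod t \<mu> (\<lambda>z. 1) (\<lambda>z. g z * f z) < \<delta>"
  shows "\<exists>p :: complex poly. Lt_mod t \<mu> (\<lambda>z. 1) (\<lambda>z. poly p z * f z) < 2 powr t * (2 * \<delta>)"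
proof -
  define m where "m = measure \<mu> (cball 0 1) + 1"
  have m: "0 < m" "measure \<mu> (space \<mu>) < m" by (auto simp: m_def add_pos_nonneg add_nonneg_pos)
  \<comment> \<open>Then \<open>\<eta>\<^sup>t\<close> times the total mass of \<open>\<mu>\<close> is at most \<open>\<delta>\<close>.\<close>
  define \<eta> where "\<eta> = (\<delta> / m) powr (1 / t)"
  have \<eta>: "0 < \<eta>" "\<eta> powr t = \<delta> / m" using \<delta> m t_pos by (auto simp: \<eta>_def powr_powr)
  obtain p :: "complex poly" where p: "\<And>z. norm z \<le> 1 \<Longrightarrow> norm (poly p z - g z) < \<eta>"
    by (rule polynomial_approx_holomorphic[OF g \<eta>(1)]) blast
  have cg: "continuous_on (cball 0 1) g"
    by (rule continuous_on_subset[OF holomorphic_on_imp_continuous_on[OF g(1)]]) (use g(2) in auto)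
  have gm: "g \<in> borel_measurable \<mu>"
    using borel_measurable_continuous_on_restrict[OF cg] by (simp cong: measurable_cong_sets)
  obtain B where B: "\<And>z. norm z \<le> 1 \<Longrightarrow> norm (g z) \<le> B"
    using continuous_on_cball_bounded[OF cg] by blast
  have fL: "f \<in> Lt_space t \<mu>" by (rule bounded_in_Lt_space[OF fm f1])
  have gf: "(\<lambda>z. g z * f z) \<in> Lt_space t \<mu>" by (rule mult_in_Lt_space[OF gm B fL])
  have pf: "(\<lambda>z. poly p z * f z) \<in> Lt_space t \<mu>"
    by (rule poly_bounded[of p], rule mult_in_Lt_space[OF poly_measurable _ fL]) auto
  have one: "(\<lambda>z. 1) \<in> Lt_space t \<mu>" by (rule bounded_in_Lt_space[of _ 1]) auto
  have "Lt_mod t \<mu> (\<lambda>z. g z * f z) (\<lambda>z. poly p z * f z) \<le> (LINT z|\<mu>. \<delta> / m)"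
    unfolding Lt_mod_def
  proof (rule integral_mono)
    show "integrable \<mu> (\<lambda>z. norm (g z * f z - poly p z * f z) powr t)"
      using Lt_space_diff[OF t_pos gf pf] by (simp add: Lt_space_def)
    fix z assume "z \<in> space \<mu>"
    then have z: "norm z \<le> 1" by simp
    have "g z * f z - poly p z * f z = - ((poly p z - g z) * f z)" by (simp add: algebra_simps)
    then have "norm (g z * f z - poly p z * f z) = norm (poly p z - g z) * norm (f z)" by (simp add: norm_mult)
    also have "\<dots> \<le> \<eta> * 1" using p[OF z] f1[OF z] \<eta> by (intro mult_mono) auto
    finally have "norm (g z * f z - poly p z * f z) powr t \<le> \<eta> powr t" using t_pos by (intro powr_mono2) auto
    then show "norm (g z * f z - poly p z * f z) powr t \<le> \<delta> / m" using \<eta> by simp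
  qed simp
  also have "\<dots> = \<delta> * (measure \<mu> (space \<mu>) / m)" by simp
  also have "\<dots> \<le> \<delta> * 1" using m \<delta> by (intro mult_left_mono) auto
  finally have 2: "Lt_mod t \<mu> (\<lambda>z. g z * f z) (\<lambda>z. poly p z * f z) \<le> \<delta>" by simp
  have "Lt_mod t \<mu> (\<lambda>z. 1) (\<lambda>z. poly p z * f z) \<le> 
      2 powr t * (Lt_mod t \<mu> (\<lambda>z. 1) (\<lambda>z. g z * f z) + Lt_mod t \<mu> (\<lambda>z. g z * f z) (\<lambda>z. poly p z * f z))"
    by (rule Lt_mod_triangle[OF t_pos one gf pf])
  also have "\<dots> < 2 powr t * (2 * \<delta>)" using le 2 by (intro mult_strict_left_mono) auto
  finally show ?thesis by blast
qed

text \<open>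
  The integral over the disk is transferred to the weight \<open>(1 - |z|)\<^sup>\<beta>\<close>.
  The exponent in the growth condition is chosen so that taking \<open>t\<close>-th powers uses up
  half of \<open>1 + \<beta>\<close>, which leaves the integrable majorant \<open>(1 - |z|) powr
  ((\<beta> - 1) / 2)\<close>.
\<close>

lemma Lt_mod_inverse_tendsto_0:
  assumes \<beta>: "-1 < \<beta>"
    and le: "\<And>p :: complex poly. (\<integral>\<^sup>+z. ennreal (norm (poly p z) powr t) \<partial>restrict_space \<mu> unit_disk)
           \<le> ennreal C * (\<integral>\<^sup>+z\<in>unit_disk. ennreal (norm (poly p z) powr t * (1 - norm z) powr \<beta>) \<partial>lborel)"
    and S: "S holomorphic_on ball 0 1" "\<And>z. norm z < 1 \<Longrightarrow> norm (S z) \<le> 1"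
    and fm: "f \<in> borel_measurable \<mu>" and f1: "\<And>z. norm z \<le> 1 \<Longrightarrow> norm (f z) \<le> 1"
    and fS: "\<And>z. norm z < 1 \<Longrightarrow> f z = S z"
    and g: "\<And>j. \<exists>R>1. g j holomorphic_on ball 0 R"
    and grow: "\<And>j z. norm z < 1 \<Longrightarrow> norm (g j z * S z) \<le> K * (1 - norm z) powr - ((1 + \<beta>) / (2 * t))"
    and conv: "\<And>z. norm z < 1 \<Longrightarrow> (\<lambda>j. g j z * S z) \<longlonglongrightarrow> 1"
    and bdry: "AE z in \<mu>. norm z = 1 \<longrightarrow> (\<forall>j. norm (g j z) \<le> 2) \<and> (\<lambda>j. g j z * f z) \<longlonglongrightarrow> 1"
  shows "(\<lambda>j. Lt_mod t \<mu> (\<lambda>z. 1) (\<lambda>z. g j z * f z)) \<longlonglongrightarrow> 0"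
proof -
  have cg: "continuous_on (cball 0 1) (g j)" for j
  proof -
    obtain R where "1 < R" "g j holomorphic_on ball 0 R" using g by blast
    then show ?thesis by (intro continuous_on_subset[OF holomorphic_on_imp_continuous_on]) auto
  qed
  have gm: "g j \<in> borel_measurable \<mu>" for j
    using borel_measurable_continuous_on_restrict[OF cg] by (simp cong: measurable_cong_sets)
  define u where "u j z = ennreal (norm (1 - g j z * f z) powr t)" for j z
  have um: "u j \<in> borel_measurable \<mu>" for j
  proof -
    note [measurable] = gm fm
    show ?thesis unfolding u_def by measurable
  qed
  define \<epsilon> where "\<epsilon> = (1 + \<beta>) / (2 * t)"
  have "\<epsilon> * t = (1 + \<beta>) / 2" using t_pos by (simp add: \<epsilon>_def)
  moreover have "0 < \<epsilon>" using \<beta> t_pos by (simp add: \<epsilon>_def)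
  moreover from calculation have "-1 < \<beta> - \<epsilon> * t" using \<beta> by simp
  ultimately have \<epsilon>: "0 < \<epsilon>" "-1 < \<beta> - \<epsilon> * t" by blast+
  have K: "0 \<le> K"
    using order_trans[OF norm_ge_zero grow[of 0 0]] by simp
  have D0: "(\<lambda>j. \<integral>\<^sup>+z\<in>unit_disk. u j z \<partial>\<mu>) \<longlonglongrightarrow> 0"
  proof (rule tendsto_sandwich[OF _ _ tendsto_const])
    let ?Y = "\<lambda>j z. ennreal (norm (1 - g j z * S z) powr t * (1 - norm z) powr \<beta>) * indicator unit_disk z"
    show "\<forall>\<^sub>F j in sequentially. (\<integral>\<^sup>+z\<in>unit_disk. u j z \<partial>\<mu>) \<le> ennreal C * (\<integral>\<^sup>+z. ?Y j z \<partial>lborel)"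
    proof (intro always_eventually allI)
      fix j
      have hol: "(\<lambda>z. 1 - g j z * S z) holomorphic_on ball 0 1"
      proof -
        obtain R where "1 < R" "g j holomorphic_on ball 0 R" using g by blast
        then have "g j holomorphic_on ball 0 1" by (meson holomorphic_on_subset less_imp_le subset_ball)
        then show ?thesis by (intro holomorphic_intros S)
      qed
      obtain B where B: "\<And>z. norm z \<le> 1 \<Longrightarrow> norm (g j z) \<le> B"
        using continuous_on_cball_bounded[OF cg] by blast
      have "norm (1 - g j z * S z) \<le> 1 + B" if z: "norm z < 1" for z
      proof -
        have "norm (1 - g j z * S z) \<le> 1 + norm (g j z) * norm (S z)"
          using norm_triangle_ineq4[of 1 "g j z * S z"] by (simp add: norm_mult)
        also have "norm (g j z) * norm (S z) \<le> norm (g j z) * 1" using S(2)[OF z] by (intro mult_left_mono) auto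
        finally show ?thesis using B[of z] z by simp
      qed
      then have "(\<integral>\<^sup>+z\<in>unit_disk. ennreal (norm (1 - g j z * S z) powr t) \<partial>\<mu>) \<le> ennreal C * (\<integral>\<^sup>+z. ?Y j z \<partial>lborel)"
        by (rule nn_integral_bounded_holomorphic_le[OF \<beta> le hol])
      moreover have "(\<integral>\<^sup>+z\<in>unit_disk. u j z \<partial>\<mu>) = (\<integral>\<^sup>+z\<in>unit_disk. ennreal (norm (1 - g j z * S z) powr t) \<partial>\<mu>)"
        by (intro nn_integral_cong) (auto simp: u_def fS indicator_def)
      ultimately show "(\<integral>\<^sup>+z\<in>unit_disk. u j z \<partial>\<mu>) \<le> ennreal C * (\<integral>\<^sup>+z. ?Y j z \<partial>lborel)" by simp
    qed
    have "(\<lambda>j. \<integral>\<^sup>+z. ?Y j z \<partial>lborel) \<longlonglongrightarrow> (\<integral>\<^sup>+z. 0 \<partial>(lborel :: complex measure))"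
    proof (rule nn_integral_dominated_convergence
        [where w="\<lambda>z. ennreal ((1 + K) powr t) * (ennreal ((1 - norm z) powr (\<beta> - \<epsilon> * t)) * indicator unit_disk z)"])
      show "?Y j \<in> borel_measurable lborel" for j
      proof -
        have [measurable]: "unit_disk \<in> sets (borel :: complex measure)" by simp
        define h where "h z = (if z \<in> ball 0 1 then 1 - g j z * S z else 0)" for z
        have "continuous_on (ball 0 1) (\<lambda>z. 1 - g j z * S z)"
          by (intro continuous_intros holomorphic_on_imp_continuous_on[OF S(1)] continuous_on_subset[OF cg]) auto
        then have [measurable]: "h \<in> borel_measurable borel"
          unfolding h_def by (intro borel_measurable_continuous_on_if) auto
        have "(\<lambda>z. ennreal (norm (h z) powr t * (1 - norm z) powr \<beta>) * indicator unit_disk z) \<in> borel_measurable lborel"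
          by measurable
        moreover have "(\<lambda>z. ennreal (norm (h z) powr t * (1 - norm z) powr \<beta>) * indicator unit_disk z) = ?Y j"
          by (auto simp: h_def fun_eq_iff indicator_def)
        ultimately show ?thesis by simp
      qed
      show "(\<lambda>z. ennreal ((1 + K) powr t) * (ennreal ((1 - norm z) powr (\<beta> - \<epsilon> * t)) * indicator unit_disk z)) \<in> borel_measurable lborel"
      proof -
        have [measurable]: "unit_disk \<in> sets (borel :: complex measure)" by simp
        show ?thesis by measurable
      qed
      show "(\<integral>\<^sup>+z. ennreal ((1 + K) powr t) * (ennreal ((1 - norm z) powr (\<beta> - \<epsilon> * t)) * indicator unit_disk z) \<partial>lborel) < \<infinity>"
        using nn_integral_weight_finite[OF \<epsilon>(2)] disk_weight_measurable[of "\<beta> - \<epsilon> * t"]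
        by (subst nn_integral_cmult) (auto simp: ennreal_mult_less_top)
      show "AE z in lborel. ?Y j z \<le> ennreal ((1 + K) powr t) * (ennreal ((1 - norm z) powr (\<beta> - \<epsilon> * t)) * indicator unit_disk z)" for j
      proof (rule AE_I2)
        fix z :: complex
        show "?Y j z \<le> ennreal ((1 + K) powr t) * (ennreal ((1 - norm z) powr (\<beta> - \<epsilon> * t)) * indicator unit_disk z)"
        proof (cases "norm z < 1")
          case True
          define s where "s = 1 - norm z"
          have s: "0 < s" "s \<le> 1" using True by (auto simp: s_def)
          have s1: "1 \<le> s powr - \<epsilon>" using s \<epsilon> by (simp add: powr_minus one_le_inverse_iff powr_le1)
          have "norm (1 - g j z * S z) \<le> 1 + K * s powr - \<epsilon>"
            using norm_triangle_ineq4[of 1 "g j z * S z"] grow[OF True, of j] by (simp add: s_def \<epsilon>_def)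
          also have "\<dots> \<le> (1 + K) * s powr - \<epsilon>" using s1 by (simp add: distrib_right)
          finally have "norm (1 - g j z * S z) powr t \<le> ((1 + K) * s powr - \<epsilon>) powr t"
            using t_pos by (intro powr_mono2) auto
          also have "\<dots> = (1 + K) powr t * s powr (- \<epsilon> * t)" using K s by (simp add: powr_mult powr_powr)
          finally have "norm (1 - g j z * S z) powr t * s powr \<beta> \<le> (1 + K) powr t * s powr (- \<epsilon> * t) * s powr \<beta>"
            by (intro mult_right_mono) auto
          also have "\<dots> = (1 + K) powr t * s powr (\<beta> - \<epsilon> * t)" by (simp add: powr_add[symmetric])
          finally show ?thesis using True
            by (simp add: s_def ennreal_mult'[symmetric] ennreal_leI)
        qed simp
      qed
      show "AE z in lborel. (\<lambda>j. ?Y j z) \<longlonglongrightarrow> 0"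
      proof (rule AE_I2)
        fix z :: complex
        show "(\<lambda>j. ?Y j z) \<longlonglongrightarrow> 0"
        proof (cases "norm z < 1")
          case True
          have "(\<lambda>j. norm (1 - g j z * S z) powr t * (1 - norm z) powr \<beta>) \<longlonglongrightarrow> 0 * (1 - norm z) powr \<beta>"
            by (intro tendsto_mult[OF _ tendsto_const] norm_diff_powr_tendsto_0 t_pos conv True)
          from tendsto_ennrealI[OF this] show ?thesis using True by simp
        qed simp
      qed
    qed auto
    then have "(\<lambda>j. ennreal C * (\<integral>\<^sup>+z. ?Y j z \<partial>lborel)) \<longlonglongrightarrow> ennreal C * 0"
      by (intro ennreal_tendsto_cmult) auto
    then show "(\<lambda>j. ennreal C * (\<integral>\<^sup>+z. ?Y j z \<partial>lborel)) \<longlonglongrightarrow> 0" by simp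
  qed auto
  have C0: "(\<lambda>j. \<integral>\<^sup>+z\<in>unit_circle. u j z \<partial>\<mu>) \<longlonglongrightarrow> 0"
  proof -
    have "(\<lambda>j. \<integral>\<^sup>+z. u j z * indicator unit_circle z \<partial>\<mu>) \<longlonglongrightarrow> (\<integral>\<^sup>+z. 0 \<partial>\<mu>)"
    proof (rule nn_integral_dominated_convergence[where w="\<lambda>_. ennreal (3 powr t)"])
      show "(\<lambda>z. u j z * indicator unit_circle z) \<in> borel_measurable \<mu>" for j
        by (intro borel_measurable_times_ennreal um borel_measurable_indicator disk_circle_sets)
      show "(\<integral>\<^sup>+z. ennreal (3 powr t) \<partial>\<mu>) < \<infinity>"
        by (simp add: emeasure_eq_measure ennreal_mult_less_top)
      show "AE z in \<mu>. u j z * indicator unit_circle z \<le> ennreal (3 powr t)" for j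
        using bdry
      proof eventually_elim
        case (elim z)
        show ?case
        proof (cases "norm z = 1")
          case True
          then have "norm (g j z) \<le> 2" using elim by blast
          then have "norm (g j z) * norm (f z) \<le> 2 * 1" using f1[of z] True by (intro mult_mono) auto
          then have "norm (1 - g j z * f z) \<le> 3"
            using norm_triangle_ineq4[of 1 "g j z * f z"] by (simp add: norm_mult)
          then have "norm (1 - g j z * f z) powr t \<le> 3 powr t" using t_pos by (intro powr_mono2) auto
          then show ?thesis using True by (simp add: u_def ennreal_leI)
        qed simp
      qed
      show "AE z in \<mu>. (\<lambda>j. u j z * indicator unit_circle z) \<longlonglongrightarrow> 0"
        using bdry
      proof eventually_elim
        case (elim z)
        show ?case
        proof (cases "norm z = 1")
          case True
          then have *: "(\<lambda>j. g j z * f z) \<longlonglongrightarrow> 1" using elim by blast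
          from tendsto_ennrealI[OF norm_diff_powr_tendsto_0[OF t_pos *]] show ?thesis using True by (simp add: u_def)
        qed simp
      qed
    qed auto
    then show ?thesis by simp
  qed
  have split: "(\<integral>\<^sup>+z. u j z \<partial>\<mu>) = (\<integral>\<^sup>+z\<in>unit_disk. u j z \<partial>\<mu>) + (\<integral>\<^sup>+z\<in>unit_circle. u j z \<partial>\<mu>)" for j
  proof -
    have "(\<integral>\<^sup>+z. u j z \<partial>\<mu>) = (\<integral>\<^sup>+z. u j z * indicator unit_disk z + u j z * indicator unit_circle z \<partial>\<mu>)"
      by (rule nn_integral_cong) (auto simp: indicator_def)
    also have "\<dots> = (\<integral>\<^sup>+z\<in>unit_disk. u j z \<partial>\<mu>) + (\<integral>\<^sup>+z\<in>unit_circle. u j z \<partial>\<mu>)"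
      by (rule nn_integral_add) (intro borel_measurable_times_ennreal um borel_measurable_indicator disk_circle_sets)+
    finally show ?thesis .
  qed
  have "(\<lambda>j. \<integral>\<^sup>+z. u j z \<partial>\<mu>) \<longlonglongrightarrow> 0 + 0" unfolding split by (intro tendsto_add D0 C0)
  then have "(\<lambda>j. enn2real (\<integral>\<^sup>+z. u j z \<partial>\<mu>)) \<longlonglongrightarrow> enn2real 0"
    by (intro tendsto_enn2real) auto
  moreover have "Lt_mod t \<mu> (\<lambda>z. 1) (\<lambda>z. g j z * f z) = enn2real (\<integral>\<^sup>+z. u j z \<partial>\<mu>)" for j
  proof -
    note [measurable] = gm fm
    show ?thesis unfolding Lt_mod_def u_def by (rule integral_eq_nn_integral) auto
  qed
  ultimately show ?thesis by simp
qed

end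

lemma norm_with_boundary_values_le:
  assumes f: "\<And>z. norm z < 1 \<Longrightarrow> norm (f z) \<le> B" and B: "0 \<le> B" and z: "norm z \<le> 1"
  shows "norm (with_boundary_values f z) \<le> B"
proof (cases "norm z < 1")
  case False
  then have nz: "norm z = 1" using z by simp
  show ?thesis
  proof (cases "\<exists>l. ((\<lambda>r. f (complex_of_real r * z)) \<longlongrightarrow> l) (at_left 1)")
    case True
    then obtain l where l: "((\<lambda>r. f (complex_of_real r * z)) \<longlongrightarrow> l) (at_left 1)" by blast
    have "\<forall>\<^sub>F r in at_left (1::real). r \<in> {0<..<1}" by (rule eventually_at_left_real) simp
    then have "\<forall>\<^sub>F r in at_left 1. norm (f (complex_of_real r * z)) \<le> B"
      by eventually_elim (use nz in \<open>auto intro!: f simp: norm_mult\<close>)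
    then have "norm l \<le> B" by (rule tendsto_upperbound[OF tendsto_norm[OF l]]) simp
    then show ?thesis using False radial_limit_eq[OF l] by (simp add: with_boundary_values_def)
  next
    case no: False
    then show ?thesis using False B by (simp add: with_boundary_values_def radial_limit_def)
  qed
qed (use f in \<open>simp add: with_boundary_values_def\<close>)

theorem theorem1p3:
  fixes t :: real and \<mu> \<nu> :: "complex measure" and \<omega> :: "complex \<Rightarrow> real"
  assumes "t > 0"
    and "finite_borel_measure_on (cball 0 1) \<mu>"
    and "\<omega> \<in> borel_measurable circle_measure" and "\<forall>\<zeta>\<in>unit_circle. 0 \<le> \<omega> \<zeta>"
    and "restrict_space \<mu> unit_circle = density circle_measure (\<lambda>\<zeta>. ennreal (\<omega> \<zeta>))"
    and "condition_B t \<mu>"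
    and "korenblum_roberts \<nu>"
    and "concentrated_on \<nu> (unit_circle - closed_support (restrict_space \<mu> unit_circle))"
  shows "cyclic_for_Mz t \<mu> (with_boundary_values (singular_inner \<nu>))"
proof -
  interpret \<mu>: finite_disk_measure \<mu> t using assms(1,2) by unfold_locales
  interpret \<nu>: finite_circle_measure \<nu> using assms(7) by unfold_locales (simp add: korenblum_roberts_def)
  let ?S = "singular_inner \<nu>" and ?f = "with_boundary_values (singular_inner \<nu>)"
  define F where "F = closed_support (restrict_space \<mu> unit_circle)"
  have cs: "unit_circle \<inter> space \<mu> = unit_circle" "unit_circle \<inter> space \<mu> \<in> sets \<mu>"
    using \<mu>.disk_circle_sets(2) by (auto simp: Int_absorb2 subset_iff)
  have spR: "space (restrict_space \<mu> unit_circle) = unit_circle" using cs by (simp add: space_restrict_space)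
  have Fcl: "closed F" unfolding F_def by (rule closed_closed_support) (simp add: spR)
  have Fsub: "F \<subseteq> unit_circle" unfolding F_def closed_support_def spR by blast
  have F0: "emeasure \<nu> F = 0"
  proof -
    have "F \<in> sets \<nu>" using Fcl Fsub by (auto simp: sets_borel_circle)
    then have "emeasure \<nu> F = emeasure \<nu> (F \<inter> (unit_circle - F))"
      using assms(8) unfolding concentrated_on_def F_def by blast
    then show ?thesis by simp
  qed
  have KR: "emeasure \<nu> E = 0" if "beurling_carleson E" "emeasure circle_measure E = 0" for E
    using assms(7) that by (simp add: korenblum_roberts_def)
  obtain \<alpha> \<beta> C :: real where \<beta>: "-1 < \<beta>"
    and le: "\<And>p :: complex poly. (\<integral>\<^sup>+z. ennreal (norm (poly p z) powr t) \<partial>restrict_space \<mu> unit_disk)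
           \<le> ennreal C * (\<integral>\<^sup>+z\<in>unit_disk. ennreal (norm (poly p z) powr t * (1 - norm z) powr \<beta>) \<partial>lborel)"
    using assms(6) unfolding condition_B_def by blast
  have \<epsilon>: "0 < (1 + \<beta>) / (2 * t)" using \<beta> assms(1) by simp
  obtain g :: "nat \<Rightarrow> complex \<Rightarrow> complex" and K :: real where
    g: "\<And>j. \<exists>R>1. g j holomorphic_on ball 0 R"
    and grow: "\<And>j z. norm z < 1 \<Longrightarrow> norm (g j z * ?S z) \<le> K * (1 - norm z) powr - ((1 + \<beta>) / (2 * t))"
    and conv: "\<And>z. norm z < 1 \<Longrightarrow> (\<lambda>j. g j z * ?S z) \<longlonglongrightarrow> 1"
    and g2: "\<And>j x. x \<in> F \<Longrightarrow> norm (g j x) \<le> 2"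
    and AEm: "AE x in circle_measure. x \<in> F \<longrightarrow> (\<exists>l. ((\<lambda>r. ?S (of_real r * x)) \<longlongrightarrow> l) (at_left 1) \<and>
        norm l \<le> 1 \<and> (\<lambda>j. g j x * l) \<longlonglongrightarrow> 1)"
    by (rule \<nu>.singular_inner_approximate_inverses[OF KR Fcl Fsub F0 \<epsilon>]) blast+
  have S_hol: "?S holomorphic_on ball 0 1"
  proof -
    have "(\<lambda>z. exp (- \<nu>.herglotz (\<lambda>_. 1) z)) holomorphic_on ball 0 1"
      by (intro holomorphic_intros \<nu>.herglotz_holomorphic \<nu>.weight_one)
    then show ?thesis by (simp add: \<nu>.singular_inner_herglotz[abs_def])
  qed
  have S1: "norm (?S z) \<le> 1" if "norm z < 1" for z
    unfolding \<nu>.singular_inner_herglotz by (rule \<nu>.norm_exp_herglotz_le[OF \<nu>.weight_one that])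
  have cS: "continuous_on (ball 0 1) ?S" by (rule holomorphic_on_imp_continuous_on[OF S_hol])
  have fm: "?f \<in> borel_measurable \<mu>"
    using with_boundary_values_measurable[OF cS] by (simp cong: measurable_cong_sets)
  have f1: "norm (?f z) \<le> 1" if "norm z \<le> 1" for z
    by (rule norm_with_boundary_values_le[OF S1 _ that]) auto
  have fS: "?f z = ?S z" if "norm z < 1" for z using that by (simp add: with_boundary_values_def)
  have AE\<mu>: "AE x in \<mu>. norm x = 1 \<longrightarrow> x \<in> F \<and> ((\<lambda>r. ?S (of_real r * x)) \<longlongrightarrow> ?f x) (at_left 1) \<and>
        (\<lambda>j. g j x * ?f x) \<longlonglongrightarrow> 1"
  proof -
    have 1: "AE x in restrict_space \<mu> unit_circle. x \<in> F"
      unfolding F_def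
    proof (rule AE_in_closed_support)
      fix U :: "complex set" assume "open U"
      then have "U \<inter> unit_circle \<in> sets \<mu>" unfolding \<mu>.sets_mu_iff by auto
      then show "U \<inter> space (restrict_space \<mu> unit_circle) \<in> sets (restrict_space \<mu> unit_circle)"
        unfolding spR by (subst sets_restrict_space_iff[OF cs(2)]) auto
    qed
    have 2: "AE x in restrict_space \<mu> unit_circle. x \<in> F \<longrightarrow> (\<exists>l. ((\<lambda>r. ?S (of_real r * x)) \<longlongrightarrow> l) (at_left 1) \<and>
        norm l \<le> 1 \<and> (\<lambda>j. g j x * l) \<longlonglongrightarrow> 1)"
      unfolding assms(5) using assms(3) AEm by (subst AE_density) (auto elim!: eventually_mono)
    have "AE x in restrict_space \<mu> unit_circle. x \<in> F \<and> ((\<lambda>r. ?S (of_real r * x)) \<longlongrightarrow> ?f x) (at_left 1) \<and>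
        (\<lambda>j. g j x * ?f x) \<longlonglongrightarrow> 1"
      using 1 2
    proof eventually_elim
      case (elim x)
      then obtain l where l: "((\<lambda>r. ?S (of_real r * x)) \<longlongrightarrow> l) (at_left 1)" "(\<lambda>j. g j x * l) \<longlonglongrightarrow> 1" by blast
      have "?f x = l" using elim(1) Fsub radial_limit_eq[OF l(1)] by (auto simp: with_boundary_values_def)
      then show ?case using l elim by simp
    qed
    then show ?thesis unfolding AE_restrict_space_iff[OF cs(2)] by simp
  qed
  show ?thesis
  proof (rule \<mu>.cyclic_for_Mz_criterion[OF fm f1])
    fix \<delta> :: real assume \<delta>: "0 < \<delta>"
    obtain p :: "nat \<Rightarrow> complex poly" and r where r: "\<And>n. 0 < r n" "\<And>n. r n < 1" "r \<longlonglongrightarrow> 1"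
      and p: "\<And>n z. norm z \<le> 1 \<Longrightarrow> norm (poly (p n) z - ?S (of_real (r n) * z)) < 1 / real (Suc n)"
      and p2: "\<And>n z. norm z \<le> 1 \<Longrightarrow> norm (poly (p n) z) \<le> 1 + 1"
      by (rule bounded_holomorphic_polynomials[OF S_hol S1]) blast+
    have "(\<lambda>n. Lt_mod t \<mu> ?f (poly (p n))) \<longlonglongrightarrow> 0"
    proof (rule \<mu>.Lt_mod_tendsto_0[OF fm \<mu>.poly_measurable _ p2])
      show "norm (?f z) \<le> 1 + 1" if "norm z \<le> 1" for z using f1[OF that] by simp
      show "AE z in \<mu>. (\<lambda>n. poly (p n) z) \<longlonglongrightarrow> ?f z"
        using AE\<mu> AE_space
      proof eventually_elim
        case (elim z)
        then have z: "norm z \<le> 1" by simp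
        have "((\<lambda>r. ?S (of_real r * z)) \<longlongrightarrow> ?f z) (at_left 1)"
        proof (cases "norm z = 1")
          case False
          then have "norm z < 1" using z by simp
          then show ?thesis using \<mu>.radial_tendsto_disk[OF cS] fS by simp
        qed (use elim in blast)
        then show ?case by (rule \<mu>.polynomials_tendsto[OF r(2,3) p[OF z]])
      qed
    qed
    then have "\<forall>\<^sub>F n in sequentially. Lt_mod t \<mu> ?f (poly (p n)) < \<delta>" using \<delta> by (rule order_tendstoD)
    then show "\<exists>p :: complex poly. Lt_mod t \<mu> ?f (poly p) < \<delta>" by (auto simp: eventually_sequentially)
  next
    fix \<delta> :: real assume \<delta>: "0 < \<delta>"
    have "(\<lambda>j. Lt_mod t \<mu> (\<lambda>z. 1) (\<lambda>z. g j z * ?f z)) \<longlonglongrightarrow> 0"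
    proof (rule \<mu>.Lt_mod_inverse_tendsto_0[OF \<beta> le S_hol S1 fm f1 fS g grow conv])
      show "AE z in \<mu>. norm z = 1 \<longrightarrow> (\<forall>j. norm (g j z) \<le> 2) \<and> (\<lambda>j. g j z * ?f z) \<longlonglongrightarrow> 1"
        using AE\<mu> by eventually_elim (use g2 in blast)
    qed
    then have "\<forall>\<^sub>F j in sequentially. Lt_mod t \<mu> (\<lambda>z. 1) (\<lambda>z. g j z * ?f z) < \<delta> / (2 * 2 powr t)"
      by (rule order_tendstoD) (use \<delta> in simp)
    then obtain j where j: "Lt_mod t \<mu> (\<lambda>z. 1) (\<lambda>z. g j z * ?f z) < \<delta> / (2 * 2 powr t)"
      by (auto simp: eventually_sequentially)
    obtain R where R: "1 < R" "g j holomorphic_on ball 0 R" using g by blast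
    have "\<exists>p :: complex poly. Lt_mod t \<mu> (\<lambda>z. 1) (\<lambda>z. poly p z * ?f z) < 2 powr t * (2 * (\<delta> / (2 * 2 powr t)))"
      by (rule \<mu>.exists_polynomial_inverse[OF fm f1 R(2,1) _ j]) (use \<delta> in auto)
    then show "\<exists>p :: complex poly. Lt_mod t \<mu> (\<lambda>z. 1) (\<lambda>z. poly p z * ?f z) < \<delta>" by simp
  qed
qed

end
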